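(* Let $\mathfrak{g}=\mathfrak{sl}_2(\mathbb{C})$ and let $\lambda',\lambda'',\lambda'''\in\mathbb{C}$ satisfy $\lambda'''-\lambda'-\lambda''\in 2\mathbb{N}$. Then the following four conditions on the triple $(\lambda',\lambda'',\lambda''')$ are equivalent: (i) $\dim H(\lambda',\lambda'',\lambda''')=2$. (ii) $\lambda',\lambda'',\lambda'''\in\mathbb{Z}$, $2\geq\lambda'+\lambda''+\lambda'''$, and $\lambda'''\geq|\lambda'-\lambda''|+2$. (iii) $\mathcal{RC}_{\lambda',\lambda''}^{\lambda'''}=0$. (iv) $2\leq\lambda'''$ (in particular $\lambda'''$ is real) and $(M(-\lambda')\otimes M(-\lambda''))^{\chi_{-\lambda'''+1}}\cong M(-\lambda''')\oplus M(\lambda'''-2)$ as $\mathfrak{g}$-modules.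
   Context: $\mathbb{N}=\{0,1,2,\dots\}$. For $\mathfrak{g}=\mathfrak{sl}_2(\mathbb{C})$ fix a Cartan subalgebra $\mathfrak{h}$ and a Borel subalgebra $\mathfrak{b}\supset\mathfrak{h}$, and identify $\mathfrak{h}^*$ with $\mathbb{C}$ so that the unique positive root is $2$ (so $\rho=1$). For $\mu\in\mathbb{C}$, $M(\mu)=U(\mathfrak{g})\otimes_{U(\mathfrak{b})}\mathbb{C}_\mu$ is the Verma module of highest weight $\mu$. Tensor products are over $\mathbb{C}$ with the diagonal $\mathfrak{g}$-action. The multiplicity space is $H(\lambda',\lambda'',\lambda'''):=\mathrm{Hom}_{\mathfrak{g}}(M(-\lambda'''),M(-\lambda')\otimes M(-\lambda''))$. Infinitesimal characters: let $Z(\mathfrak{g})$ be the center of $U(\mathfrak{g})$. The Harish-Chandra isomorphism gives a bijection $\mathfrak{h}^*/W\cong\mathrm{Hom}_{\mathbb{C}\text{-alg}}(Z(\mathfrak{g}),\mathbb{C})$, $\nu\mapsto\chi_\nu$ (here $W=\{\pm1\}$ acts on $\mathbb{C}$ by sign), normalized so that $Z(\mathfrak{g})$ acts on $M(\lambda)$ by $\chi_{\lambda+\rho}=\chi_{\lambda+1}$. For a $\mathfrak{g}$-module $M$, $M^{\chi_\nu}$ is the submodule of elements annihilated by some power of $\ker(\chi_\nu:Z(\mathfrak{g})\to\mathbb{C})$. The Rankin-Cohen bracket: with $\ell:=\frac12(\lambda'''-\lambda'-\lambda'')\in\mathbb{N}$, it is the bidifferential operator (acting on holomorphic functions of two complex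 variables $(z_1,z_2)$, followed by restriction to the diagonal $z_1=z_2$) $$\mathcal{RC}_{\lambda',\lambda''}^{\lambda'''}:=\sum_{j=0}^{\ell}(-1)^j\frac{(\lambda'+\ell-1)_j(\lambda''+\ell-1)_{\ell-j}}{j!(\ell-j)!}\left.\frac{\partial^\ell}{\partial z_1^{\ell-j}\partial z_2^{j}}\right|_{z_1=z_2},$$ where $(x)_n:=x(x-1)\cdots(x-n+1)$ is the descending factorial (with $(x)_0=1$). *)

theory Defs
  imports
    "HOL-Analysis.Analysis"
    "HOL-Algebra.QuotRing"
    "HOL-Algebra.Module"
    "HOL-Algebra.Ideal_Product"
    "HOL-Algebra.Algebraic_Closure_Type"
    "HOL-Library.Poly_Mapping"
begin

section \<open>The Lie algebra sl2\<close>

type_synonym cmat = "complex^2^2"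

definition mscale :: "complex \<Rightarrow> cmat \<Rightarrow> cmat" where
  "mscale c A = (\<chi> i j. c * A $ i $ j)"

global_interpretation mat_vs: vector_space mscale
  by unfold_locales (simp_all add: mscale_def vec_eq_iff algebra_simps)

definition lie :: "cmat \<Rightarrow> cmat \<Rightarrow> cmat" where
  "lie x y = x ** y - y ** x"

definition sl2 :: "cmat set" where
  "sl2 = {x. trace x = 0}"

definition lie_subalgebra :: "cmat set \<Rightarrow> bool" where
  "lie_subalgebra L \<longleftrightarrow> mat_vs.subspace L \<and> (\<forall>x\<in>L. \<forall>y\<in>L. lie x y \<in> L)"

definition lie_comm :: "cmat set \<Rightarrow> cmat set \<Rightarrow> cmat set" where
  "lie_comm A B = mat_vs.span {lie x y | x y. x \<in> A \<and> y \<in> B}"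

definition lie_solvable :: "cmat set \<Rightarrow> bool" where
  "lie_solvable L \<longleftrightarrow> (\<exists>n. ((\<lambda>A. lie_comm A A) ^^ n) L = {0})"

definition lie_nilpotent :: "cmat set \<Rightarrow> bool" where
  "lie_nilpotent L \<longleftrightarrow> (\<exists>n. ((\<lambda>A. lie_comm L A) ^^ n) L = {0})"

definition cartan_subalgebra :: "cmat set \<Rightarrow> bool" where
  "cartan_subalgebra h \<longleftrightarrow> lie_subalgebra h \<and> h \<subseteq> sl2 \<and> lie_nilpotent h
     \<and> {x \<in> sl2. \<forall>y\<in>h. lie x y \<in> h} = h"

definition borel_subalgebra :: "cmat set \<Rightarrow> bool" where
  "borel_subalgebra b \<longleftrightarrow> lie_subalgebra b \<and> b \<subseteq> sl2 \<and> lie_solvable b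
     \<and> (\<forall>b'. lie_subalgebra b' \<and> b' \<subseteq> sl2 \<and> lie_solvable b' \<and> b \<subseteq> b' \<longrightarrow> b' = b)"

text \<open>Functionals on the Cartan subalgebra \<open>h\<close> are functions that are \<^const>\<open>extensional\<close> on \<open>h\<close>.\<close>

definition root_space :: "cmat set \<Rightarrow> (cmat \<Rightarrow> complex) \<Rightarrow> cmat set" where
  "root_space h \<alpha> = {e \<in> sl2. \<forall>y\<in>h. lie y e = mscale (\<alpha> y) e}"

definition positive_root :: "cmat set \<Rightarrow> cmat set \<Rightarrow> (cmat \<Rightarrow> complex) \<Rightarrow> bool" where
  "positive_root h b \<alpha> \<longleftrightarrow> \<alpha> \<in> extensional h \<and> (\<exists>y\<in>h. \<alpha> y \<noteq> 0)
     \<and> root_space h \<alpha> \<noteq> {0} \<and> root_space h \<alpha> \<subseteq> b"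

definition the_positive_root :: "cmat set \<Rightarrow> cmat set \<Rightarrow> cmat \<Rightarrow> complex" where
  "the_positive_root h b = (THE \<alpha>. positive_root h b \<alpha>)"

text \<open>The identification of the dual of \<open>h\<close> with the complex numbers under which the positive
  root is \<open>2\<close>.\<close>

definition weight :: "cmat set \<Rightarrow> cmat set \<Rightarrow> complex \<Rightarrow> cmat \<Rightarrow> complex" where
  "weight h b \<mu> y = \<mu> / 2 * the_positive_root h b y"

text \<open>The weight extended from \<open>h\<close> to \<open>b\<close> by zero on the nilradical, which is the root space of the
  positive root.\<close>

definition borel_char :: "cmat set \<Rightarrow> cmat set \<Rightarrow> complex \<Rightarrow> cmat \<Rightarrow> complex" where
  "borel_char h b \<mu> x =
     (THE c. \<exists>y\<in>h. x - y \<in> root_space h (the_positive_root h b) \<and> c = weight h b \<mu> y)"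

section \<open>Modules over a Lie algebra\<close>

text \<open>A representation is recorded as a complex vector space together with an action \<open>lact\<close> of
  matrices. The fields \<open>mult\<close> and \<open>one\<close>, inherited from the library record for modules, play no role
  and are left undefined. Only the action of elements of the Lie algebra at hand matters.\<close>

abbreviation complex_ring :: "complex ring" where
  "complex_ring \<equiv> ring_of_type_algebra"

record 'v lie_module = "(complex, 'v) module" +
  lact :: "cmat \<Rightarrow> 'v \<Rightarrow> 'v"

definition one_dim_module :: "(cmat \<Rightarrow> complex) \<Rightarrow> complex lie_module" where
  "one_dim_module \<phi> = \<lparr>carrier = UNIV, mult = undefined, one = undefined, zero = 0, add = (+),
     smult = (*), lact = (\<lambda>x z. \<phi> x * z)\<rparr>"

definition lie_dsum :: "'v lie_module \<Rightarrow> 'w lie_module \<Rightarrow> ('v \<times> 'w) lie_module" where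
  "lie_dsum V W = \<lparr>carrier = carrier V \<times> carrier W, mult = undefined, one = undefined,
     zero = (\<zero>\<^bsub>V\<^esub>, \<zero>\<^bsub>W\<^esub>),
     add = (\<lambda>(v, w) (v', w'). (v \<oplus>\<^bsub>V\<^esub> v', w \<oplus>\<^bsub>W\<^esub> w')),
     smult = (\<lambda>c (v, w). (c \<odot>\<^bsub>V\<^esub> v, c \<odot>\<^bsub>W\<^esub> w)),
     lact = (\<lambda>x (v, w). (lact V x v, lact W x w))\<rparr>"

definition lie_quot :: "'v lie_module \<Rightarrow> 'v set \<Rightarrow> 'v set lie_module" where
  "lie_quot V N = \<lparr>carrier = a_rcosets\<^bsub>V\<^esub> N, mult = undefined, one = undefined,
     zero = N, add = set_add V,
     smult = (\<lambda>c A. \<Union>a\<in>A. N +>\<^bsub>V\<^esub> (c \<odot>\<^bsub>V\<^esub> a)),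
     lact = (\<lambda>x A. \<Union>a\<in>A. N +>\<^bsub>V\<^esub> lact V x a)\<rparr>"

definition lie_hom :: "cmat set \<Rightarrow> 'v lie_module \<Rightarrow> 'w lie_module \<Rightarrow> ('v \<Rightarrow> 'w) set" where
  "lie_hom L V W = {f \<in> carrier V \<rightarrow>\<^sub>E carrier W.
     (\<forall>v\<in>carrier V. \<forall>v'\<in>carrier V. f (v \<oplus>\<^bsub>V\<^esub> v') = f v \<oplus>\<^bsub>W\<^esub> f v') \<and>
     (\<forall>c. \<forall>v\<in>carrier V. f (c \<odot>\<^bsub>V\<^esub> v) = c \<odot>\<^bsub>W\<^esub> f v) \<and>
     (\<forall>x\<in>L. \<forall>v\<in>carrier V. f (lact V x v) = lact W x (f v))}"

definition lie_iso :: "cmat set \<Rightarrow> 'v lie_module \<Rightarrow> 'w lie_module \<Rightarrow> bool" where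
  "lie_iso L V W \<longleftrightarrow> (\<exists>f\<in>lie_hom L V W. bij_betw f (carrier V) (carrier W))"

definition lie_hom_space ::
    "cmat set \<Rightarrow> 'v lie_module \<Rightarrow> 'w lie_module \<Rightarrow> (complex, 'v \<Rightarrow> 'w) module" where
  "lie_hom_space L V W = \<lparr>carrier = lie_hom L V W, mult = undefined, one = undefined,
     zero = (\<lambda>v\<in>carrier V. \<zero>\<^bsub>W\<^esub>),
     add = (\<lambda>f g. \<lambda>v\<in>carrier V. f v \<oplus>\<^bsub>W\<^esub> g v),
     smult = (\<lambda>c f. \<lambda>v\<in>carrier V. c \<odot>\<^bsub>W\<^esub> f v)\<rparr>"

definition finite_basis :: "(complex, 'v) module \<Rightarrow> 'v set \<Rightarrow> bool" where
  "finite_basis V B \<longleftrightarrow> finite B \<and> B \<subseteq> carrier V \<and>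
     (\<forall>v\<in>carrier V. \<exists>!c. c \<in> B \<rightarrow>\<^sub>E UNIV \<and> v = (\<Oplus>\<^bsub>V\<^esub>b\<in>B. c b \<odot>\<^bsub>V\<^esub> b))"

definition has_dimension :: "(complex, 'v) module \<Rightarrow> nat \<Rightarrow> bool" where
  "has_dimension V n \<longleftrightarrow> (\<exists>B. finite_basis V B \<and> card B = n)"

section \<open>Free vector spaces and tensor products\<close>

text \<open>The free vector space on a set \<open>B\<close> consists of the finitely supported functions with support
  in \<open>B\<close>; the function \<open>single b 1\<close> is the basis vector of \<open>b\<close>, and \<open>pextend f\<close> is the linear
  extension of \<open>f\<close> from basis vectors.\<close>

definition pscale :: "complex \<Rightarrow> ('b \<Rightarrow>\<^sub>0 complex) \<Rightarrow> ('b \<Rightarrow>\<^sub>0 complex)" where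
  "pscale c p = Poly_Mapping.map ((*) c) p"

definition pextend :: "('a \<Rightarrow> ('b \<Rightarrow>\<^sub>0 complex)) \<Rightarrow> ('a \<Rightarrow>\<^sub>0 complex) \<Rightarrow> ('b \<Rightarrow>\<^sub>0 complex)" where
  "pextend f p = (\<Sum>k\<in>Poly_Mapping.keys p. pscale (Poly_Mapping.lookup p k) (f k))"

abbreviation basis_vec :: "'b \<Rightarrow> ('b \<Rightarrow>\<^sub>0 complex)" where
  "basis_vec b \<equiv> Poly_Mapping.single b 1"

definition free_module ::
    "'b set \<Rightarrow> (cmat \<Rightarrow> 'b \<Rightarrow> ('b \<Rightarrow>\<^sub>0 complex)) \<Rightarrow> ('b \<Rightarrow>\<^sub>0 complex) lie_module" where
  "free_module B act = \<lparr>carrier = {p. Poly_Mapping.keys p \<subseteq> B}, mult = undefined, one = undefined,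
     zero = 0, add = (+), smult = pscale, lact = (\<lambda>x. pextend (act x))\<rparr>"

definition submodule_span :: "'v lie_module \<Rightarrow> 'v set \<Rightarrow> 'v set" where
  "submodule_span V S = \<Inter>{N. submodule N complex_ring V \<and> S \<subseteq> N}"

definition bilinear_relations ::
    "(complex, 'p, 'm) module_scheme \<Rightarrow> (complex, 'q, 'n) module_scheme \<Rightarrow> ('p \<times> 'q \<Rightarrow>\<^sub>0 complex) set" where
  "bilinear_relations P Q =
     {basis_vec (x \<oplus>\<^bsub>P\<^esub> x', y) - basis_vec (x, y) - basis_vec (x', y) | x x' y.
        x \<in> carrier P \<and> x' \<in> carrier P \<and> y \<in> carrier Q} \<union>
     {basis_vec (x, y \<oplus>\<^bsub>Q\<^esub> y') - basis_vec (x, y) - basis_vec (x, y') | x y y'.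
        x \<in> carrier P \<and> y \<in> carrier Q \<and> y' \<in> carrier Q} \<union>
     {basis_vec (c \<odot>\<^bsub>P\<^esub> x, y) - pscale c (basis_vec (x, y)) | c x y.
        x \<in> carrier P \<and> y \<in> carrier Q} \<union>
     {basis_vec (x, c \<odot>\<^bsub>Q\<^esub> y) - pscale c (basis_vec (x, y)) | c x y.
        x \<in> carrier P \<and> y \<in> carrier Q}"

text \<open>\<open>ract\<close> and \<open>act\<close> are the right and left actions of the algebra with carrier \<open>A\<close> over which
  the tensor product is formed.\<close>

definition balancing_relations ::
    "'a set \<Rightarrow> (complex, 'p, 'm) module_scheme \<Rightarrow> (complex, 'q, 'n) module_scheme \<Rightarrow>
     ('p \<Rightarrow> 'a \<Rightarrow> 'p) \<Rightarrow> ('a \<Rightarrow> 'q \<Rightarrow> 'q) \<Rightarrow> ('p \<times> 'q \<Rightarrow>\<^sub>0 complex) set" where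
  "balancing_relations A P Q ract act =
     {basis_vec (ract x a, y) - basis_vec (x, act a y) | x a y.
        x \<in> carrier P \<and> a \<in> A \<and> y \<in> carrier Q}"

definition lie_tensor :: "'v lie_module \<Rightarrow> 'w lie_module \<Rightarrow> ('v \<times> 'w \<Rightarrow>\<^sub>0 complex) set lie_module" where
  "lie_tensor V W =
     (let F = free_module (carrier V \<times> carrier W)
                (\<lambda>x (v, w). basis_vec (lact V x v, w) + basis_vec (v, lact W x w))
      in lie_quot F (submodule_span F (bilinear_relations V W)))"

section \<open>Universal enveloping algebras\<close>

text \<open>The free associative algebra on a set \<open>L\<close> has the words over \<open>L\<close> as a basis. The enveloping
  algebra of a Lie algebra \<open>L\<close> is its quotient by the linear relations of \<open>L\<close>, which by themselves
  yield the tensor algebra, and the commutator relations.\<close>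

definition free_algebra :: "cmat set \<Rightarrow> (cmat list \<Rightarrow>\<^sub>0 complex) ring" where
  "free_algebra L = \<lparr>carrier = {p. Poly_Mapping.keys p \<subseteq> lists L},
     mult = (\<lambda>p q. pextend (\<lambda>u. pextend (\<lambda>v. basis_vec (u @ v)) q) p),
     one = basis_vec [], zero = 0, add = (+)\<rparr>"

definition uea_relations :: "cmat set \<Rightarrow> (cmat list \<Rightarrow>\<^sub>0 complex) set" where
  "uea_relations L =
     {basis_vec [x + y] - basis_vec [x] - basis_vec [y] | x y. x \<in> L \<and> y \<in> L} \<union>
     {basis_vec [mscale c x] - pscale c (basis_vec [x]) | c x. x \<in> L} \<union>
     {basis_vec [x, y] - basis_vec [y, x] - basis_vec [lie x y] | x y. x \<in> L \<and> y \<in> L}"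

definition uea_ideal :: "cmat set \<Rightarrow> (cmat list \<Rightarrow>\<^sub>0 complex) set" where
  "uea_ideal L = genideal (free_algebra L) (uea_relations L)"

type_synonym uea = "(cmat list \<Rightarrow>\<^sub>0 complex) set"

definition UEA :: "cmat set \<Rightarrow> (complex, uea) module" where
  "UEA L = ring.extend (free_algebra L Quot uea_ideal L)
     \<lparr>smult = (\<lambda>c A. \<Union>p\<in>A. uea_ideal L +>\<^bsub>free_algebra L\<^esub> pscale c p)\<rparr>"

definition uea_gen :: "cmat set \<Rightarrow> cmat \<Rightarrow> uea" where
  "uea_gen L x = uea_ideal L +>\<^bsub>free_algebra L\<^esub> basis_vec [x]"

text \<open>The algebra map from the enveloping algebra of a subalgebra into that of \<open>L\<close>; all cosets in
  the union coincide.\<close>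

definition uea_map :: "cmat set \<Rightarrow> uea \<Rightarrow> uea" where
  "uea_map L A = (\<Union>p\<in>A. uea_ideal L +>\<^bsub>free_algebra L\<^esub> p)"

text \<open>The action of the enveloping algebra on a representation \<open>V\<close>, computed on any coset
  representative in the free algebra.\<close>

definition free_algebra_act :: "'v lie_module \<Rightarrow> (cmat list \<Rightarrow>\<^sub>0 complex) \<Rightarrow> 'v \<Rightarrow> 'v" where
  "free_algebra_act V p v =
     (\<Oplus>\<^bsub>V\<^esub>w\<in>Poly_Mapping.keys p. Poly_Mapping.lookup p w \<odot>\<^bsub>V\<^esub> foldr (lact V) w v)"

definition uea_act :: "'v lie_module \<Rightarrow> uea \<Rightarrow> 'v \<Rightarrow> 'v" where
  "uea_act V A v = (THE v'. \<exists>p\<in>A. v' = free_algebra_act V p v)"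

definition uea_center :: "cmat set \<Rightarrow> (complex, uea) module" where
  "uea_center L = (UEA L)\<lparr>carrier := {z \<in> carrier (UEA L).
     \<forall>u\<in>carrier (UEA L). z \<otimes>\<^bsub>UEA L\<^esub> u = u \<otimes>\<^bsub>UEA L\<^esub> z}\<rparr>"

section \<open>Verma modules and infinitesimal characters\<close>

definition verma :: "cmat set \<Rightarrow> cmat set \<Rightarrow> complex \<Rightarrow> (uea \<times> complex \<Rightarrow>\<^sub>0 complex) set lie_module" where
  "verma h b \<mu> =
     (let C = one_dim_module (borel_char h b \<mu>);
          U = UEA sl2;
          F = free_module (carrier U \<times> carrier C) (\<lambda>x (u, z). basis_vec (uea_gen sl2 x \<otimes>\<^bsub>U\<^esub> u, z))
      in lie_quot F (submodule_span F (bilinear_relations U C \<union>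
           balancing_relations (carrier (UEA b)) U C (\<lambda>u a. u \<otimes>\<^bsub>U\<^esub> uea_map sl2 a) (uea_act C))))"

text \<open>The character \<open>\<chi>\<^sub>\<nu>\<close> of the center, normalized by its action on the Verma module of highest
  weight \<open>\<nu> - 1\<close>.\<close>

definition inf_char :: "cmat set \<Rightarrow> cmat set \<Rightarrow> complex \<Rightarrow> uea \<Rightarrow> complex" where
  "inf_char h b \<nu> z = (let M = verma h b (\<nu> - 1) in
     THE c. \<forall>v\<in>carrier M. uea_act M z v = c \<odot>\<^bsub>M\<^esub> v)"

definition inf_char_ker :: "cmat set \<Rightarrow> cmat set \<Rightarrow> complex \<Rightarrow> uea set" where
  "inf_char_ker h b \<nu> = {z \<in> carrier (uea_center sl2). inf_char h b \<nu> z = 0}"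

definition inf_char_part :: "cmat set \<Rightarrow> cmat set \<Rightarrow> 'v lie_module \<Rightarrow> complex \<Rightarrow> 'v lie_module" where
  "inf_char_part h b V \<nu> = V\<lparr>carrier := {v \<in> carrier V.
     \<exists>n::nat. \<forall>z \<in> inf_char_ker h b \<nu> [^]\<^bsub>ideals_set (uea_center sl2)\<^esub> n. uea_act V z v = \<zero>\<^bsub>V\<^esub>}\<rparr>"

definition mult_space where
  "mult_space h b lam1 lam2 lam3 =
     lie_hom_space sl2 (verma h b (- lam3)) (lie_tensor (verma h b (- lam1)) (verma h b (- lam2)))"

section \<open>Rankin-Cohen brackets\<close>

definition desc_factorial :: "complex \<Rightarrow> nat \<Rightarrow> complex" where
  "desc_factorial x n = (\<Prod>i<n. x - of_nat i)"

definition holomorphic2 :: "(complex \<times> complex \<Rightarrow> complex) \<Rightarrow> (complex \<times> complex) set \<Rightarrow> bool" where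
  "holomorphic2 f U \<longleftrightarrow>
     (\<forall>p\<in>U. \<exists>a b. (f has_derivative (\<lambda>(w1, w2). a * w1 + b * w2)) (at p))"

definition mixed_deriv ::
    "nat \<Rightarrow> nat \<Rightarrow> (complex \<times> complex \<Rightarrow> complex) \<Rightarrow> complex \<times> complex \<Rightarrow> complex" where
  "mixed_deriv m n f = (\<lambda>(z1, z2). (deriv ^^ m) (\<lambda>w1. (deriv ^^ n) (\<lambda>w2. f (w1, w2)) z2) z1)"

definition rc_order :: "complex \<Rightarrow> complex \<Rightarrow> complex \<Rightarrow> nat" where
  "rc_order lam1 lam2 lam3 = (THE l. of_nat l = (lam3 - lam1 - lam2) / 2)"

definition rankin_cohen ::
    "complex \<Rightarrow> complex \<Rightarrow> complex \<Rightarrow> (complex \<times> complex \<Rightarrow> complex) \<Rightarrow> complex \<Rightarrow> complex" where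
  "rankin_cohen lam1 lam2 lam3 f z = (let l = rc_order lam1 lam2 lam3 in
     \<Sum>j\<le>l. (-1) ^ j * (desc_factorial (lam1 + of_nat l - 1) j * desc_factorial (lam2 + of_nat l - 1) (l - j))
       / (fact j * fact (l - j)) * mixed_deriv (l - j) j f (z, z))"

text \<open>The bracket acts on functions holomorphic on an arbitrary open set \<open>U\<close> and yields functions on
  the part of the diagonal inside \<open>U\<close>.\<close>

definition rankin_cohen_vanishes :: "complex \<Rightarrow> complex \<Rightarrow> complex \<Rightarrow> bool" where
  "rankin_cohen_vanishes lam1 lam2 lam3 \<longleftrightarrow>
     (\<forall>U f z. open U \<longrightarrow> holomorphic2 f U \<longrightarrow> (z, z) \<in> U \<longrightarrow> rankin_cohen lam1 lam2 lam3 f z = 0)"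

end

theory Submission
  imports Defs
begin

text \<open>
  Write \<open>\<mu> = - lam1\<close>, \<open>\<nu> = - lam2\<close> and \<open>lam3 = lam1 + lam2 + 2 l\<close>. The Verma module of highest weight
  \<open>\<mu>\<close> has the basis \<open>f^k v\<close>, so the tensor product \<open>T\<close> has a basis indexed by pairs \<open>(i, j)\<close>, and its
  weight spaces are the levels \<open>i + j = m\<close>. A homomorphism from the Verma module of highest weight
  \<open>- lam3\<close> to \<open>T\<close> is the same as a vector of level \<open>l\<close> that is killed by \<open>e\<close>, and in coordinates
  \<open>x\<^sub>0, \<dots>, x\<^sub>l\<close> this is the two-term recurrence
  \<open>(i + 1) (\<mu> - i) x\<^sub>i\<^sub>+\<^sub>1 + (j + 1) (\<nu> - j) x\<^sub>i = 0\<close> for \<open>i + j = l - 1\<close>. Its solution space has dimension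
  one unless the recurrence breaks in two places, which means that \<open>\<mu> = a\<close> and \<open>\<nu> = b\<close> are natural
  numbers below \<open>l\<close>, and then dimension two occurs exactly if the breaks come in the right order,
  \<open>l \<le> a + b + 1\<close>. This is the predicate \<open>exceptional\<close>. Each of the four conditions is shown to be
  equivalent to it: the first by \<open>hom_space_dimension\<close>, the second by rewriting the inequalities
  (\<open>exceptional_iff_integral\<close>), and the third by testing the bracket on \<open>exp (z\<^sub>1 + t z\<^sub>2)\<close>, which shows
  that it vanishes only if all its coefficients do (\<open>rankin_cohen_vanishes_iff\<close>).

  For the fourth condition let \<open>\<kappa> = - lam3\<close> and \<open>\<kappa>' = lam3 - 2\<close>. These are linked weights, with the same
  infinitesimal character. If the block of \<open>T\<close> is the direct sum of the two Verma modules, both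
  summands contain a singular vector of weight \<open>\<kappa>\<close>, because the second Verma module contains the
  first, and two independent solutions of the recurrence force \<open>exceptional\<close>
  (\<open>decomposition_exceptional\<close>). Conversely, in the exceptional case there is a singular vector \<open>w\<close> of
  weight \<open>\<kappa>'\<close> on level \<open>n = a + b + 1 - l\<close>, and a singular vector \<open>u\<close> of weight \<open>\<kappa>\<close> on level \<open>l\<close> that
  is not a multiple of \<open>f^(l - n) w\<close>. Since \<open>f\<close> is injective on \<open>T\<close>, the two generate a direct sum of
  Verma modules. It exhausts the block: \<open>f\<close> maps each level onto a hyperplane of the next one, and the
  Casimir element acts on the one-dimensional quotient by a scalar that equals the central value
  only on the levels \<open>n\<close> and \<open>l\<close>. Hence a generalised Casimir eigenvector can be reduced level by level
  to \<open>u\<close> and \<open>w\<close> (\<open>generalised_eigenvector_in_blk\<close>).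

  All of this happens in concrete spaces of finitely supported functions. The passage from the
  modules given by quotients to these spaces is \<open>verma_model\<close> and \<open>tensor_model\<close>; the choice of a
  Cartan and a Borel subalgebra is reduced to diagonal and upper triangular matrices by
  \<open>cartan_borel_frame\<close>.
\<close>

section \<open>Linear extension from a basis\<close>

abbreviation "lk \<equiv> Poly_Mapping.lookup"
abbreviation "keys \<equiv> Poly_Mapping.keys"

abbreviation clinear :: "(complex \<Rightarrow> 'v::ab_group_add \<Rightarrow> 'v) \<Rightarrow> (complex \<Rightarrow> 'w::ab_group_add \<Rightarrow> 'w) \<Rightarrow> ('v \<Rightarrow> 'w) \<Rightarrow> bool" where
  "clinear \<equiv> Vector_Spaces.linear"

lemma lookup_pscale [simp]: "lk (pscale c p) k = c * lk p k"
  by (simp add: pscale_def Poly_Mapping.map.rep_eq when_def)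

global_interpretation pm: vector_space pscale
  by unfold_locales (auto intro!: poly_mapping_eqI simp: lookup_add algebra_simps)

lemma vector_space_complex: "vector_space ((*) :: complex \<Rightarrow> complex \<Rightarrow> complex)"
  by unfold_locales (auto simp: algebra_simps)

lemma clinearI:
  assumes "vector_space s1" "vector_space s2"
    and "\<And>x y. f (x + y) = f x + f y" and "\<And>c x. f (s1 c x) = s2 c (f x)"
  shows "clinear s1 s2 f"
  using assms by (simp add: Vector_Spaces.linear_def module_hom_def module_hom_axioms_def
      vector_space_def Modules.module_def)

lemma
  assumes "clinear s1 s2 f"
  shows clinear_add: "f (x + y) = f x + f y"
    and clinear_scale: "f (s1 c x) = s2 c (f x)"
    and clinear_diff: "f (x - y) = f x - f y"
    and clinear_zero: "f 0 = 0"
    and clinear_neg: "f (- x) = - f x"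
    and clinear_sum: "f (sum g A) = (\<Sum>a\<in>A. f (g a))"
  using assms unfolding Vector_Spaces.linear_def
  by (auto simp: module_hom.add module_hom.scale module_hom.diff module_hom.zero module_hom.neg module_hom.sum)

lemma clinear_vs: "clinear s1 s2 f \<Longrightarrow> vector_space s1 \<and> vector_space s2"
  by (simp add: Vector_Spaces.linear_def)

lemma clinear_compose: "clinear s1 s2 f \<Longrightarrow> clinear s2 s3 g \<Longrightarrow> clinear s1 s3 (\<lambda>x. g (f x))"
  using Vector_Spaces.linear_compose[of s1 s2 f s3 g] by (simp add: o_def)

lemma pm_id_clinear: "clinear pscale pscale (\<lambda>p. p)"
  by (rule clinearI) (simp_all add: pm.vector_space_axioms)

lemma clinear_funpow: "clinear s s f \<Longrightarrow> clinear s s (f ^^ n)"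
proof (induction n)
  case 0
  then show ?case by (auto intro!: clinearI dest: clinear_vs)
next
  case (Suc n)
  then show ?case by (auto simp: o_def intro: clinear_compose)
qed

text \<open>The variant of \<^const>\<open>pextend\<close> with values in an arbitrary complex vector space; it serves both for maps into the
  coefficient field and for the action of words on a representation.\<close>

definition lin_ext :: "(complex \<Rightarrow> 'v::ab_group_add \<Rightarrow> 'v) \<Rightarrow> ('a \<Rightarrow> 'v) \<Rightarrow> ('a \<Rightarrow>\<^sub>0 complex) \<Rightarrow> 'v" where
  "lin_ext s f p = (\<Sum>k\<in>keys p. s (lk p k) (f k))"

lemma pextend_eq_lin_ext: "pextend f = lin_ext pscale f"
  by (simp add: fun_eq_iff pextend_def lin_ext_def)

lemma lin_ext_superset:
  assumes "finite A" "keys p \<subseteq> A" "vector_space s"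
  shows "lin_ext s f p = (\<Sum>k\<in>A. s (lk p k) (f k))"
proof -
  interpret vector_space s by fact
  show ?thesis
    unfolding lin_ext_def using assms
    by (intro sum.mono_neutral_left) (auto simp: in_keys_iff)
qed

lemma lin_ext_clinear:
  assumes "vector_space s"
  shows "clinear pscale s (lin_ext s f)"
proof -
  interpret vector_space s by fact
  show ?thesis
  proof (rule clinearI)
    fix p q :: "'b \<Rightarrow>\<^sub>0 complex"
    let ?A = "keys p \<union> keys q"
    have "keys (p + q) \<subseteq> ?A" by (rule keys_add)
    then show "lin_ext s f (p + q) = lin_ext s f p + lin_ext s f q"
      by (simp add: lin_ext_superset[of ?A _ s] assms lookup_add scale_left_distrib sum.distrib)
  next
    fix c and p :: "'b \<Rightarrow>\<^sub>0 complex"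
    have "keys (pscale c p) \<subseteq> keys p"
      by (auto simp: in_keys_iff)
    then show "lin_ext s f (pscale c p) = s c (lin_ext s f p)"
      by (simp add: lin_ext_superset[of "keys p" _ s] assms scale_sum_right)
  qed (unfold_locales)
qed

lemma lin_ext_basis [simp]: "vector_space s \<Longrightarrow> lin_ext s f (basis_vec k) = f k"
  by (simp add: lin_ext_def vector_space.vector_space_assms(4))

lemma pm_basis_expansion: "p = (\<Sum>k\<in>keys p. pscale (lk p k) (basis_vec k))"
proof (rule poly_mapping_eqI)
  fix i
  have "lk (\<Sum>k\<in>keys p. pscale (lk p k) (basis_vec k)) i
      = (\<Sum>k\<in>keys p. lk p k * (if k = i then 1 else 0))"
    by (simp add: lookup_sum lookup_single when_def)
  also have "\<dots> = lk p i"
    by (simp add: if_distrib sum.delta not_in_keys_iff_lookup_eq_zero cong: if_cong)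
  finally show "lk p i = lk
      (\<Sum>k\<in>keys p. pscale (lk p k) (basis_vec k)) i" by simp
qed

lemma clinear_eq_lin_ext:
  assumes "clinear pscale s g"
  shows "g p = lin_ext s (\<lambda>k. g (basis_vec k)) p"
  by (subst pm_basis_expansion) (simp add: clinear_sum[OF assms] clinear_scale[OF assms] lin_ext_def)

text \<open>Only the support of \<open>p\<close> matters, so identities that hold for words over a subalgebra, but not for all
  words, can still be checked on basis vectors.\<close>

lemma clinear_eqI:
  assumes f: "clinear pscale s f" and g: "clinear pscale s g"
    and eq: "\<And>k. k \<in> keys p \<Longrightarrow> f (basis_vec k) = g (basis_vec k)"
  shows "f p = g p"
  unfolding clinear_eq_lin_ext[OF f, of p] clinear_eq_lin_ext[OF g, of p] lin_ext_def
  using eq by (intro sum.cong) auto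

text \<open>The way in which membership of all elements in a linear congruence is reduced to basis vectors; \<open>S\<close> is typically
  a submodule of relations and \<open>f\<close> the difference of two linear maps.\<close>

lemma clinear_closed_span:
  assumes f: "clinear pscale s f"
    and S: "0 \<in> S" "\<And>a b. a \<in> S \<Longrightarrow> b \<in> S \<Longrightarrow> a + b \<in> S" "\<And>c a. a \<in> S \<Longrightarrow> s c a \<in> S"
    and b: "\<And>k. k \<in> keys p \<Longrightarrow> f (basis_vec k) \<in> S"
  shows "f p \<in> S"
proof -
  have "(\<Sum>k\<in>A. s (lk p k) (f (basis_vec k))) \<in> S" if "finite A" "A \<subseteq> keys p" for A
    using that by (induction A) (auto intro: S b)
  then show ?thesis
    unfolding clinear_eq_lin_ext[OF f, of p] lin_ext_def by simp
qed

lemma pextend_clinear: "clinear pscale pscale (pextend f)"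
  unfolding pextend_eq_lin_ext by (rule lin_ext_clinear) unfold_locales

lemmas pextend_add = clinear_add[OF pextend_clinear]
  and pextend_scale = clinear_scale[OF pextend_clinear]
  and pextend_diff = clinear_diff[OF pextend_clinear]
  and pextend_zero = clinear_zero[OF pextend_clinear]

lemma pextend_basis [simp]: "pextend f (basis_vec k) = f k"
  by (simp add: pextend_eq_lin_ext pm.vector_space_axioms)

lemma keys_subset_add: "keys p \<subseteq> S \<Longrightarrow> keys q \<subseteq> S \<Longrightarrow> keys (p + q) \<subseteq> S"
  using keys_add[of p q] by (rule subset_trans) (rule Un_least)

lemma keys_pscale_subset: "keys (pscale c p) \<subseteq> keys p"
  by (auto simp: in_keys_iff)

lemma keys_subset_diff: "keys p \<subseteq> S \<Longrightarrow> keys q \<subseteq> S \<Longrightarrow> keys (p - q) \<subseteq> S"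
  using keys_diff[of p q] by (rule subset_trans) (rule Un_least)

lemma keys_pextend:
  assumes "\<And>k. k \<in> keys p \<Longrightarrow> keys (f k) \<subseteq> S"
  shows "keys (pextend f p) \<subseteq> S"
proof -
  have "pextend f p \<in> {q. keys q \<subseteq> S}"
    by (rule clinear_closed_span[OF pextend_clinear])
      (simp_all add: assms keys_subset_add subset_trans[OF keys_pscale_subset])
  then show ?thesis by simp
qed

section \<open>The free algebra and the enveloping algebra\<close>

definition fm :: "('x list \<Rightarrow>\<^sub>0 complex) \<Rightarrow> ('x list \<Rightarrow>\<^sub>0 complex) \<Rightarrow> ('x list \<Rightarrow>\<^sub>0 complex)" where
  "fm p q = pextend (\<lambda>u. pextend (\<lambda>v. basis_vec (u @ v)) q) p"

lemma fm_clinear_left: "clinear pscale pscale (\<lambda>p. fm p q)"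
  unfolding fm_def by (rule pextend_clinear)

lemma fm_basis [simp]: "fm (basis_vec u) (basis_vec v) = basis_vec (u @ v)"
  by (simp add: fm_def)

lemma fm_clinear_right: "clinear pscale pscale (fm p)"
proof (rule clinearI)
  show "fm p (x + y) = fm p x + fm p y" for x y
    unfolding fm_def pextend_def[of _ p]
    by (simp add: pextend_add pm.scale_right_distrib sum.distrib)
  show "fm p (pscale c x) = pscale c (fm p x)" for c x
    unfolding fm_def pextend_def[of _ p]
    by (simp add: pextend_scale pm.scale_sum_right mult.commute)
qed unfold_locales

lemmas fm_linear_simps =
  clinear_add[OF fm_clinear_left] clinear_scale[OF fm_clinear_left] clinear_diff[OF fm_clinear_left]
  clinear_zero[OF fm_clinear_left]
  clinear_add[OF fm_clinear_right] clinear_scale[OF fm_clinear_right] clinear_diff[OF fm_clinear_right]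
  clinear_zero[OF fm_clinear_right]

lemma fm_assoc: "fm (fm p q) r = fm p (fm q r)"
proof -
  have 1: "fm (fm (basis_vec u) (basis_vec v)) r = fm (basis_vec u) (fm (basis_vec v) r)" for u v
    by (rule clinear_eqI[OF fm_clinear_right clinear_compose[OF fm_clinear_right fm_clinear_right]]) simp
  have 2: "fm (fm (basis_vec u) q) r = fm (basis_vec u) (fm q r)" for u
    by (rule clinear_eqI[OF clinear_compose[OF fm_clinear_right fm_clinear_left]
          clinear_compose[OF fm_clinear_left fm_clinear_right]]) (rule 1)
  show ?thesis
    by (rule clinear_eqI[OF clinear_compose[OF fm_clinear_left fm_clinear_left] fm_clinear_left]) (rule 2)
qed

lemma fm_one [simp]: "fm (basis_vec []) p = p" "fm p (basis_vec []) = p"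
proof -
  show "fm (basis_vec []) p = p"
    by (rule clinear_eqI[OF fm_clinear_right pm_id_clinear]) simp
  show "fm p (basis_vec []) = p"
    by (rule clinear_eqI[OF fm_clinear_left pm_id_clinear]) simp
qed

abbreviation words :: "'x set \<Rightarrow> ('x list \<Rightarrow>\<^sub>0 complex) set" where
  "words L \<equiv> {p. keys p \<subseteq> lists L}"

lemma words_add: "p \<in> words L \<Longrightarrow> q \<in> words L \<Longrightarrow> p + q \<in> words L"
  by (simp add: keys_subset_add)

lemma words_pscale: "p \<in> words L \<Longrightarrow> pscale c p \<in> words L"
  using subset_trans[OF keys_pscale_subset] by simp

lemma words_diff: "p \<in> words L \<Longrightarrow> q \<in> words L \<Longrightarrow> p - q \<in> words L"
  by (simp add: keys_subset_diff)

lemma words_fm: "p \<in> words L \<Longrightarrow> q \<in> words L \<Longrightarrow> fm p q \<in> words L"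
  unfolding fm_def mem_Collect_eq by (intro keys_pextend) auto

lemma free_algebra_simps [simp]:
  "carrier (free_algebra L) = words L"
  "x \<otimes>\<^bsub>free_algebra L\<^esub> y = fm x y" "x \<oplus>\<^bsub>free_algebra L\<^esub> y = x + y"
  "\<one>\<^bsub>free_algebra L\<^esub> = basis_vec []" "\<zero>\<^bsub>free_algebra L\<^esub> = 0"
  by (simp_all add: free_algebra_def fm_def)

lemma ring_free_algebra: "ring (free_algebra L)"
proof (rule ringI)
  show "abelian_group (free_algebra L)"
  proof (rule abelian_groupI)
    show "\<exists>y\<in>carrier (free_algebra L). y \<oplus>\<^bsub>free_algebra L\<^esub> x = \<zero>\<^bsub>free_algebra L\<^esub>"
      if "x \<in> carrier (free_algebra L)" for x
      using that words_pscale[of x L "-1"]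
      by (intro bexI[of _ "- x"]) (simp_all add: pm.scale_minus_left)
  qed (simp_all add: keys_subset_add add.assoc add.commute)
  show "monoid (free_algebra L)"
    by (rule monoidI) (simp_all add: words_fm[simplified] fm_assoc)
qed (auto simp: fm_linear_simps)

text \<open>Additive inverses come for free, since the scalar \<open>- 1\<close> is an element of the algebra.\<close>

lemma ideal_free_algebraI:
  assumes sub: "I \<subseteq> words L" and zero: "0 \<in> I" and add: "\<And>p q. p \<in> I \<Longrightarrow> q \<in> I \<Longrightarrow> p + q \<in> I"
    and left: "\<And>p q. p \<in> I \<Longrightarrow> q \<in> words L \<Longrightarrow> fm q p \<in> I"
    and right: "\<And>p q. p \<in> I \<Longrightarrow> q \<in> words L \<Longrightarrow> fm p q \<in> I"
  shows "ideal I (free_algebra L)"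
proof (rule idealI[OF ring_free_algebra])
  note ab = ring.is_abelian_group[OF ring_free_algebra]
  show "subgroup I (add_monoid (free_algebra L))"
  proof (rule group.subgroupI[OF abelian_group.a_group[OF ab]])
    fix p assume p: "p \<in> I"
    have "fm (pscale (-1) (basis_vec [])) p \<in> I" by (intro left p words_pscale) simp
    then have m: "- p \<in> I" by (simp add: fm_linear_simps clinear_neg[OF fm_clinear_left] pm.scale_minus_left)
    have "\<ominus>\<^bsub>free_algebra L\<^esub> p = - p"
      by (rule abelian_group.minus_equality[OF ab]) (use p m sub in auto)
    then show "inv\<^bsub>add_monoid (free_algebra L)\<^esub> p \<in> I" using m by (simp add: a_inv_def)
  qed (use sub zero add in auto)
qed (use left right in auto)

lemma uea_relations_subset: "lie_subalgebra L \<Longrightarrow> uea_relations L \<subseteq> words L"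
proof -
  assume L: "lie_subalgebra L"
  have 1: "x + y \<in> L" "mscale c x \<in> L" "lie x y \<in> L" if "x \<in> L" "y \<in> L" for x y c
    using L that by (auto simp: lie_subalgebra_def mat_vs.subspace_def)
  show ?thesis
    unfolding uea_relations_def
  proof (intro Un_least subsetI; elim CollectE exE conjE)
    fix p x y assume "p = basis_vec [x + y] - basis_vec [x] - basis_vec [y]" "x \<in> L" "y \<in> L"
    then show "p \<in> words L"
      using 1 by (simp only:) (intro words_diff; simp)
  next
    fix p c x assume "p = basis_vec [mscale c x] - pscale c (basis_vec [x])" "x \<in> L"
    then show "p \<in> words L"
      using 1 by (simp only:) (intro words_diff words_pscale; simp)
  next
    fix p x y assume "p = basis_vec [x, y] - basis_vec [y, x] - basis_vec [lie x y]" "x \<in> L" "y \<in> L"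
    then show "p \<in> words L"
      using 1 by (simp only:) (intro words_diff; simp)
  qed
qed

subsection \<open>Cosets of words\<close>

text \<open>The coset of \<open>p\<close> described by its differences, which turns computations in the enveloping algebra into membership
  statements about the ideal.\<close>

definition cls :: "cmat set \<Rightarrow> (cmat list \<Rightarrow>\<^sub>0 complex) \<Rightarrow> uea" where
  "cls L p = {q. q - p \<in> uea_ideal L}"

lemma coset_eq_cls: "uea_ideal L +>\<^bsub>free_algebra L\<^esub> p = cls L p"
  unfolding a_r_coset_def' cls_def
proof (intro equalityI subsetI CollectI)
  fix q assume "q \<in> {q. q - p \<in> uea_ideal L}"
  then show "q \<in> (\<Union>h\<in>uea_ideal L. {h \<oplus>\<^bsub>free_algebra L\<^esub> p})"
    by (intro UN_I[of "q - p"]) simp_all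
qed auto

lemma uea_simps:
  "carrier (UEA L) = a_rcosets\<^bsub>free_algebra L\<^esub> (uea_ideal L)"
  "x \<otimes>\<^bsub>UEA L\<^esub> y = rcoset_mult (free_algebra L) (uea_ideal L) x y"
  "x \<oplus>\<^bsub>UEA L\<^esub> y = set_add (free_algebra L) x y"
  "\<one>\<^bsub>UEA L\<^esub> = cls L (basis_vec [])" "\<zero>\<^bsub>UEA L\<^esub> = uea_ideal L"
  "c \<odot>\<^bsub>UEA L\<^esub> x = (\<Union>p\<in>x. cls L (pscale c p))"
  by (simp_all add: UEA_def ring.defs FactRing_def coset_eq_cls)

lemma uea_gen_eq_cls: "uea_gen L x = cls L (basis_vec [x])"
  by (simp add: uea_gen_def coset_eq_cls)

lemma carrier_uea: "carrier (UEA L) = cls L ` words L"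
  by (auto simp: uea_simps A_RCOSETS_def' coset_eq_cls)

context
  fixes L assumes L: "lie_subalgebra L"
begin

lemma ideal_uea: "ideal (uea_ideal L) (free_algebra L)"
  unfolding uea_ideal_def
  using uea_relations_subset[OF L] by (intro ring.genideal_ideal ring_free_algebra) simp

lemma uea_ideal_relations: "uea_relations L \<subseteq> uea_ideal L"
  unfolding uea_ideal_def
  using uea_relations_subset[OF L] by (intro ring.genideal_self ring_free_algebra) simp

lemma uea_ideal_words: "p \<in> uea_ideal L \<Longrightarrow> p \<in> words L"
  using ideal.Icarr[OF ideal_uea, of p] by simp

lemma uea_ideal_add: "p \<in> uea_ideal L \<Longrightarrow> q \<in> uea_ideal L \<Longrightarrow> p + q \<in> uea_ideal L"
  using additive_subgroup.a_closed[OF ideal.axioms(1)[OF ideal_uea], of p q] by simp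

lemma uea_ideal_zero: "0 \<in> uea_ideal L"
  using additive_subgroup.zero_closed[OF ideal.axioms(1)[OF ideal_uea]] by simp

lemma uea_ideal_fm_left: "p \<in> uea_ideal L \<Longrightarrow> q \<in> words L \<Longrightarrow> fm q p \<in> uea_ideal L"
  using ideal.I_l_closed[OF ideal_uea, of p q] by simp

lemma uea_ideal_fm_right: "p \<in> uea_ideal L \<Longrightarrow> q \<in> words L \<Longrightarrow> fm p q \<in> uea_ideal L"
  using ideal.I_r_closed[OF ideal_uea, of p q] by simp

lemma uea_ideal_pscale: "p \<in> uea_ideal L \<Longrightarrow> pscale c p \<in> uea_ideal L"
  using uea_ideal_fm_left[of p "pscale c (basis_vec [])"] words_pscale[of "basis_vec []" L c]
  by (simp add: fm_linear_simps)

lemma uea_ideal_diff: "p \<in> uea_ideal L \<Longrightarrow> q \<in> uea_ideal L \<Longrightarrow> p - q \<in> uea_ideal L"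
  using uea_ideal_add[OF _ uea_ideal_pscale, of p q "-1"] by (simp add: pm.scale_minus_left)

lemma cls_self: "p \<in> cls L p"
  by (simp add: cls_def uea_ideal_zero)

lemma cls_eq_iff: "cls L p = cls L q \<longleftrightarrow> p - q \<in> uea_ideal L"
proof
  assume "cls L p = cls L q"
  then show "p - q \<in> uea_ideal L" using cls_self[of p] by (simp add: cls_def)
next
  assume pq: "p - q \<in> uea_ideal L"
  have "r - q \<in> uea_ideal L" if "r - p \<in> uea_ideal L" for r
    using uea_ideal_add[OF that pq] by simp
  moreover have "r - p \<in> uea_ideal L" if "r - q \<in> uea_ideal L" for r
    using uea_ideal_diff[OF that pq] by simp
  ultimately show "cls L p = cls L q" by (auto simp: cls_def)
qed

lemma uea_mult_cls: "p \<in> words L \<Longrightarrow> q \<in> words L \<Longrightarrow> cls L p \<otimes>\<^bsub>UEA L\<^esub> cls L q = cls L (fm p q)"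
  using ideal.rcoset_mult_add[OF ideal_uea, of p q] by (simp add: uea_simps coset_eq_cls)

lemma uea_add_cls: "p \<in> words L \<Longrightarrow> q \<in> words L \<Longrightarrow> cls L p \<oplus>\<^bsub>UEA L\<^esub> cls L q = cls L (p + q)"
  using abelian_subgroup.a_rcos_sum[OF abelian_subgroupI3[OF ideal.axioms(1)[OF ideal_uea]
        ring.is_abelian_group[OF ring_free_algebra]], of p q]
  by (simp add: uea_simps coset_eq_cls)
  
lemma uea_smult_cls: "c \<odot>\<^bsub>UEA L\<^esub> cls L p = cls L (pscale c p)"
proof -
  have "cls L (pscale c q) = cls L (pscale c p)" if "q \<in> cls L p" for q
    unfolding cls_eq_iff using uea_ideal_pscale[of "q - p" c] that
    by (simp add: cls_def pm.scale_right_diff_distrib)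
  moreover have "cls L p \<noteq> {}" using cls_self[of p] by blast
  ultimately show ?thesis unfolding uea_simps by (intro SUP_eq_const)
qed

end

section \<open>Representations on vector spaces\<close>

text \<open>Linearity and the bracket relation are required for elements of \<open>L\<close> only, since the action of other matrices is arbitrary.\<close>

locale lie_rep = vector_space s for s :: "complex \<Rightarrow> 'v::ab_group_add \<Rightarrow> 'v" +
  fixes L :: "cmat set" and act :: "cmat \<Rightarrow> 'v \<Rightarrow> 'v"
  assumes L: "lie_subalgebra L"
    and act_clinear: "x \<in> L \<Longrightarrow> clinear s s (act x)"
    and act_add: "x \<in> L \<Longrightarrow> y \<in> L \<Longrightarrow> act (x + y) v = act x v + act y v"
    and act_mscale: "x \<in> L \<Longrightarrow> act (mscale c x) v = s c (act x v)"
    and act_lie: "x \<in> L \<Longrightarrow> y \<in> L \<Longrightarrow> act (lie x y) v = act x (act y v) - act y (act x v)"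
begin

definition wact :: "(cmat list \<Rightarrow>\<^sub>0 complex) \<Rightarrow> 'v \<Rightarrow> 'v" where
  "wact p v = lin_ext s (\<lambda>w. foldr act w v) p"

lemma wact_clinear_left: "clinear pscale s (\<lambda>p. wact p v)"
  unfolding wact_def by (rule lin_ext_clinear[OF vector_space_axioms])

lemmas wact_linear = clinear_add[OF wact_clinear_left] clinear_scale[OF wact_clinear_left]
  clinear_diff[OF wact_clinear_left] clinear_zero[OF wact_clinear_left]

lemma wact_basis [simp]: "wact (basis_vec w) v = foldr act w v"
  by (simp add: wact_def vector_space_axioms)

lemma foldr_clinear: "w \<in> lists L \<Longrightarrow> clinear s s (foldr act w)"
proof (induction w)
  case Nil
  show ?case by (rule clinearI) (simp_all add: vector_space_axioms)
next
  case (Cons x w)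
  then have "clinear s s (foldr act w)" "clinear s s (act x)" by (simp_all add: act_clinear)
  then have "clinear s s (\<lambda>v. act x (foldr act w v))" by (rule clinear_compose)
  then show ?case by (simp add: o_def)
qed

lemma wact_clinear_right:
  assumes "p \<in> words L"
  shows "clinear s s (wact p)"
proof (rule clinearI)
  have *: "k \<in> keys p \<Longrightarrow> clinear s s (foldr act k)" for k
    using foldr_clinear assms by auto
  show "wact p (x + y) = wact p x + wact p y" for x y
    unfolding wact_def lin_ext_def
    by (simp add: clinear_add[OF *] scale_right_distrib sum.distrib)
  show "wact p (s c x) = s c (wact p x)" for c x
    unfolding wact_def lin_ext_def
    by (simp add: clinear_scale[OF *] scale_sum_right mult.commute)
qed (unfold_locales)

lemma wact_fm:
  assumes "p \<in> words L" "q \<in> words L"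
  shows "wact (fm p q) v = wact p (wact q v)"
proof (rule clinear_eqI[OF clinear_compose[OF fm_clinear_left wact_clinear_left] wact_clinear_left])
  fix u assume "u \<in> keys p"
  then have u: "u \<in> lists L" using assms by auto
  show "wact (fm (basis_vec u) q) v = wact (basis_vec u) (wact q v)"
    by (rule clinear_eqI[OF clinear_compose[OF fm_clinear_right wact_clinear_left]
          clinear_compose[OF wact_clinear_left wact_clinear_right]])
      (use u in auto)
qed

text \<open>The elements that act by zero on the whole representation form a two-sided ideal containing the defining
  relations, so they contain the ideal generated by these. Hence the enveloping algebra acts.\<close>

lemma wact_uea_ideal:
  assumes "p \<in> uea_ideal L"
  shows "wact p v = 0"
proof -
  let ?K = "{p \<in> words L. \<forall>v. wact p v = 0}"
  have "ideal ?K (free_algebra L)"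
  proof (rule ideal_free_algebraI)
    fix p q assume "p \<in> ?K" "q \<in> words L"
    then show "fm q p \<in> ?K" "fm p q \<in> ?K"
      using words_fm[of p L q] words_fm[of q L p]
      by (simp_all add: wact_fm clinear_zero[OF wact_clinear_right])
  qed (auto simp: wact_linear keys_subset_add simp del: in_lists_conv_set)
  moreover have "uea_relations L \<subseteq> ?K"
  proof
    fix p assume p: "p \<in> uea_relations L"
    then have "wact p v = 0" for v
      unfolding uea_relations_def
      by (auto simp: wact_linear act_add act_mscale act_lie)
    then show "p \<in> ?K" using p uea_relations_subset[OF L] by auto
  qed
  ultimately have "uea_ideal L \<subseteq> ?K"
    unfolding uea_ideal_def by (intro ring.genideal_minimal ring_free_algebra)
  then show ?thesis using assms by auto
qed

lemma wact_cls: "q \<in> cls L p \<Longrightarrow> wact q v = wact p v"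
  using wact_uea_ideal[of "q - p"] by (simp add: cls_def wact_linear)

end

section \<open>Models of modules\<close>

text \<open>A module given by a record is compared with a representation on a whole type through a linear bijection \<open>\<phi>\<close>. All
  notions of the statement are invariant under such a comparison, so that the construction of the module can be
  forgotten once a model is known.\<close>

locale lie_model = lie_rep s L act
  for s :: "complex \<Rightarrow> 'c::ab_group_add \<Rightarrow> 'c" and L act +
  fixes V :: "'v lie_module" and \<phi> :: "'v \<Rightarrow> 'c"
  assumes bij: "bij_betw \<phi> (carrier V) UNIV"
    and zero_closed: "\<zero>\<^bsub>V\<^esub> \<in> carrier V" and zero: "\<phi> \<zero>\<^bsub>V\<^esub> = 0"
    and add_closed: "v \<in> carrier V \<Longrightarrow> w \<in> carrier V \<Longrightarrow> v \<oplus>\<^bsub>V\<^esub> w \<in> carrier V"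
    and add: "v \<in> carrier V \<Longrightarrow> w \<in> carrier V \<Longrightarrow> \<phi> (v \<oplus>\<^bsub>V\<^esub> w) = \<phi> v + \<phi> w"
    and smult_closed: "v \<in> carrier V \<Longrightarrow> c \<odot>\<^bsub>V\<^esub> v \<in> carrier V"
    and smult: "v \<in> carrier V \<Longrightarrow> \<phi> (c \<odot>\<^bsub>V\<^esub> v) = s c (\<phi> v)"
    and lact_closed: "x \<in> L \<Longrightarrow> v \<in> carrier V \<Longrightarrow> lact V x v \<in> carrier V"
    and lact: "x \<in> L \<Longrightarrow> v \<in> carrier V \<Longrightarrow> \<phi> (lact V x v) = act x (\<phi> v)"
begin

lemma phi_eq_iff: "v \<in> carrier V \<Longrightarrow> w \<in> carrier V \<Longrightarrow> \<phi> v = \<phi> w \<longleftrightarrow> v = w"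
  using bij by (auto simp: bij_betw_def inj_on_def)

definition \<psi> :: "'c \<Rightarrow> 'v" where "\<psi> = inv_into (carrier V) \<phi>"

lemma psi_closed [simp]: "\<psi> c \<in> carrier V"
  using bij_betw_inv_into[OF bij] by (auto simp: \<psi>_def bij_betw_def)

lemma phi_psi [simp]: "\<phi> (\<psi> c) = c"
  using bij_betw_inv_into_right[OF bij] by (simp add: \<psi>_def)

lemma psi_phi [simp]: "v \<in> carrier V \<Longrightarrow> \<psi> (\<phi> v) = v"
  using bij_betw_inv_into_left[OF bij] by (simp add: \<psi>_def)

lemma psi_add: "\<psi> (p + q) = \<psi> p \<oplus>\<^bsub>V\<^esub> \<psi> q"
  and psi_smult: "\<psi> (s c p) = c \<odot>\<^bsub>V\<^esub> \<psi> p"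
  and psi_lact: "x \<in> L \<Longrightarrow> \<psi> (act x p) = lact V x (\<psi> p)"
  by (subst phi_eq_iff[symmetric]; simp add: add add_closed smult smult_closed lact lact_closed)+

lemma abelian_group: "abelian_group V"
proof (rule abelian_groupI)
  fix x assume x: "x \<in> carrier V"
  show "\<exists>y\<in>carrier V. y \<oplus>\<^bsub>V\<^esub> x = \<zero>\<^bsub>V\<^esub>"
    by (rule bexI[of _ "\<psi> (- \<phi> x)"])
      (use x in \<open>simp_all add: add add_closed zero zero_closed flip: phi_eq_iff\<close>)
qed (simp_all add: add add_closed zero zero_closed add_ac flip: phi_eq_iff)

lemma abelian_monoid: "abelian_monoid V"
  using abelian_group by (rule abelian_group.axioms)

lemma finsum_phi:
  assumes "finite A" "f \<in> A \<rightarrow> carrier V"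
  shows "finsum V f A \<in> carrier V \<and> \<phi> (finsum V f A) = (\<Sum>a\<in>A. \<phi> (f a))"
proof -
  interpret V: abelian_monoid V by (rule abelian_monoid)
  show ?thesis using assms
    by (induction A) (simp_all add: zero zero_closed add add_closed Pi_def)
qed

lemma foldr_lact:
  assumes "w \<in> lists L" "v \<in> carrier V"
  shows "foldr (lact V) w v \<in> carrier V \<and> \<phi> (foldr (lact V) w v) = foldr act w (\<phi> v)"
  using assms by (induction w) (simp_all add: lact lact_closed)

lemma free_algebra_act:
  assumes p: "p \<in> words L" and v: "v \<in> carrier V"
  shows "free_algebra_act V p v \<in> carrier V" "\<phi> (free_algebra_act V p v) = wact p (\<phi> v)"
proof -
  let ?f = "\<lambda>w. lk p w \<odot>\<^bsub>V\<^esub> foldr (lact V) w v"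
  have w: "w \<in> lists L" if "w \<in> keys p" for w
    using p that by auto
  have "?f \<in> keys p \<rightarrow> carrier V"
    using foldr_lact[OF w v] by (auto intro: smult_closed)
  from finsum_phi[OF finite_keys this]
  show "free_algebra_act V p v \<in> carrier V" "\<phi> (free_algebra_act V p v) = wact p (\<phi> v)"
    using foldr_lact[OF w v]
    by (simp_all add: free_algebra_act_def wact_def lin_ext_def smult cong: sum.cong)
qed

text \<open>The description of the action refers to a unique value over all coset representatives; it exists because words in
  the ideal act by zero on the model.\<close>

lemma uea_act:
  assumes p: "p \<in> words L" and v: "v \<in> carrier V"
  shows "uea_act V (cls L p) v \<in> carrier V" "\<phi> (uea_act V (cls L p) v) = wact p (\<phi> v)"
proof -
  have q: "free_algebra_act V q v = free_algebra_act V p v" if "q \<in> cls L p" for q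
  proof -
    have "q - p \<in> words L" using that uea_ideal_words[OF L] by (simp add: cls_def)
    then have "q \<in> words L" using words_add[OF p, of "q - p"] by simp
    then show ?thesis
      using p v wact_cls[OF that] by (simp add: free_algebra_act flip: phi_eq_iff)
  qed
  have "uea_act V (cls L p) v = free_algebra_act V p v"
    unfolding uea_act_def
    by (rule the_equality) (use q cls_self[OF L, of p] in blast)+
  then show "uea_act V (cls L p) v \<in> carrier V" "\<phi> (uea_act V (cls L p) v) = wact p (\<phi> v)"
    using free_algebra_act[OF p v] by simp_all
qed

end

section \<open>Quotients of free modules\<close>

lemma free_module_simps [simp]:
  "carrier (free_module B a) = {p. keys p \<subseteq> B}"
  "x \<oplus>\<^bsub>free_module B a\<^esub> y = x + y" "\<zero>\<^bsub>free_module B a\<^esub> = 0"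
  "c \<odot>\<^bsub>free_module B a\<^esub> x = pscale c x" "lact (free_module B a) = (\<lambda>x. pextend (a x))"
  by (simp_all add: free_module_def)

lemma submodule_free_module_iff:
  "submodule N complex_ring (free_module B a) \<longleftrightarrow> N \<subseteq> {p. keys p \<subseteq> B} \<and> 0 \<in> N \<and>
     (\<forall>p\<in>N. \<forall>q\<in>N. p + q \<in> N) \<and> (\<forall>c. \<forall>p\<in>N. pscale c p \<in> N)"
  (is "?L \<longleftrightarrow> ?R")
proof -
  have ag: "abelian_group (free_module B a)"
  proof (rule abelian_groupI)
    fix x assume "x \<in> carrier (free_module B a)"
    then show "\<exists>y\<in>carrier (free_module B a). y \<oplus>\<^bsub>free_module B a\<^esub> x = \<zero>\<^bsub>free_module B a\<^esub>"
      using keys_pscale_subset[of "-1" x]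
      by (intro bexI[of _ "- x"]) (simp_all add: pm.scale_minus_left)
  qed (simp_all add: keys_subset_add add_ac)
  show ?thesis
  proof
    assume ?L
    then interpret submodule N complex_ring "free_module B a" .
    show ?R
      using subset m_closed one_closed smult_closed by (auto simp: ring_of_type_algebra_def)
  next
    assume R: ?R
    have "inv\<^bsub>add_monoid (free_module B a)\<^esub> p \<in> N" if p: "p \<in> N" for p
    proof -
      have m: "pscale (-1) p \<in> N" using R p by blast
      have "\<ominus>\<^bsub>free_module B a\<^esub> p = - p"
        by (rule abelian_group.minus_equality[OF ag]) (use R p m in \<open>auto simp: pm.scale_minus_left\<close>)
      then show ?thesis using m by (simp add: a_inv_def pm.scale_minus_left)
    qed
    then show ?L
      using R by (intro submodule.intro subgroup.intro) (auto simp: submodule_axioms_def)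
  qed
qed

lemma
  assumes "R \<subseteq> {p. keys p \<subseteq> B}"
  shows submodule_span_superset: "R \<subseteq> submodule_span (free_module B a) R"
    and submodule_span_zero: "0 \<in> submodule_span (free_module B a) R"
    and submodule_span_add: "p \<in> submodule_span (free_module B a) R \<Longrightarrow>
      q \<in> submodule_span (free_module B a) R \<Longrightarrow> p + q \<in> submodule_span (free_module B a) R"
    and submodule_span_pscale: "p \<in> submodule_span (free_module B a) R \<Longrightarrow>
      pscale c p \<in> submodule_span (free_module B a) R"
    and submodule_span_carrier: "submodule_span (free_module B a) R \<subseteq> {p. keys p \<subseteq> B}"
proof -
  have "submodule {p. keys p \<subseteq> B} complex_ring (free_module B a)"
    by (simp add: submodule_free_module_iff keys_subset_add subset_trans[OF keys_pscale_subset])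
  then show "submodule_span (free_module B a) R \<subseteq> {p. keys p \<subseteq> B}"
    unfolding submodule_span_def using assms by (intro Inter_lower) blast
qed (auto simp: submodule_span_def submodule_free_module_iff)

lemma submodule_span_minimal:
  assumes "\<And>p. p \<in> R \<Longrightarrow> p \<in> N" "N \<subseteq> {p. keys p \<subseteq> B}" "0 \<in> N"
    "\<And>p q. p \<in> N \<Longrightarrow> q \<in> N \<Longrightarrow> p + q \<in> N" "\<And>c p. p \<in> N \<Longrightarrow> pscale c p \<in> N"
  shows "submodule_span (free_module B a) R \<subseteq> N"
  unfolding submodule_span_def using assms
  by (intro Inter_lower) (auto simp: submodule_free_module_iff)

text \<open>A quotient of a free module is identified by a linear map \<open>\<Phi>\<close> that kills the relations and a section \<open>\<sigma>\<close> such
  that every generator is congruent to the section of its image: then \<open>p - \<sigma> (\<Phi> p)\<close> is a relation for every \<open>p\<close>,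
  and the span of the relations is exactly the kernel of \<open>\<Phi>\<close>. Both the Verma module and the tensor product
  are recognised in this way.\<close>

lemma lie_quot_model:
  fixes s :: "complex \<Rightarrow> 'c::ab_group_add \<Rightarrow> 'c" and \<Phi>\<^sub>0 :: "'b \<Rightarrow> 'c"
  assumes rep: "lie_rep s L act"
    and R: "R \<subseteq> {p. keys p \<subseteq> B}"
    and R0: "\<And>r. r \<in> R \<Longrightarrow> lin_ext s \<Phi>\<^sub>0 r = 0"
    and aB: "\<And>x b. x \<in> L \<Longrightarrow> b \<in> B \<Longrightarrow> keys (a x b) \<subseteq> B"
    and a\<Phi>: "\<And>x b. x \<in> L \<Longrightarrow> b \<in> B \<Longrightarrow> lin_ext s \<Phi>\<^sub>0 (a x b) = act x (\<Phi>\<^sub>0 b)"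
    and \<sigma>: "clinear s pscale \<sigma>"
    and \<sigma>B: "\<And>c. keys (\<sigma> c) \<subseteq> B"
    and \<Phi>\<sigma>: "\<And>c. lin_ext s \<Phi>\<^sub>0 (\<sigma> c) = c"
    and \<sigma>N: "\<And>b. b \<in> B \<Longrightarrow> basis_vec b - \<sigma> (\<Phi>\<^sub>0 b) \<in> submodule_span (free_module B a) R"
  shows "lie_model s L act (lie_quot (free_module B a) (submodule_span (free_module B a) R))
           (\<lambda>A. the_elem (lin_ext s \<Phi>\<^sub>0 ` A))"
proof -
  interpret lie_rep s L act by (rule rep)
  define F where "F = free_module B a"
  define \<Phi> where "\<Phi> = lin_ext s \<Phi>\<^sub>0"
  define N where "N = submodule_span F R"
  have lin: "clinear pscale s \<Phi>"
    unfolding \<Phi>_def by (rule lin_ext_clinear[OF vector_space_axioms])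
  note lin_simps = clinear_add[OF lin] clinear_scale[OF lin] clinear_zero[OF lin] clinear_diff[OF lin]
  note span = submodule_span_superset[OF R] submodule_span_zero[OF R] submodule_span_add[OF R]
    submodule_span_pscale[OF R] submodule_span_carrier[OF R]
  define C where "C = {p :: 'b \<Rightarrow>\<^sub>0 complex. keys p \<subseteq> B}"
  have C: "0 \<in> C" "\<And>p q. p \<in> C \<Longrightarrow> q \<in> C \<Longrightarrow> p + q \<in> C" "\<And>c p. p \<in> C \<Longrightarrow> pscale c p \<in> C"
    by (simp_all add: C_def keys_subset_add subset_trans[OF keys_pscale_subset])
  have C_diff: "p - q \<in> C" if "p \<in> C" "q \<in> C" for p q using that by (simp add: C_def keys_subset_diff)
  have carF: "carrier F = C" by (simp add: F_def C_def)
  have N_eq: "N = {p\<in>C. \<Phi> p = 0}"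
  proof
    show "N \<subseteq> {p\<in>C. \<Phi> p = 0}"
      unfolding N_def F_def
    proof (rule submodule_span_minimal)
      show "p \<in> {p\<in>C. \<Phi> p = 0}" if "p \<in> R" for p
        using R R0 that by (auto simp: C_def \<Phi>_def)
    qed (use C in \<open>simp_all add: lin_simps C_def Collect_mono\<close>)
    have id: "clinear pscale pscale (\<lambda>p. p - \<sigma> (\<Phi> p))"
      by (rule clinearI)
        (auto simp: lin_simps clinear_add[OF \<sigma>] clinear_scale[OF \<sigma>] pm.scale_right_diff_distrib
          intro: pm.vector_space_axioms)
    have "p - \<sigma> (\<Phi> p) \<in> N" if "p \<in> C" for p
      by (rule clinear_closed_span[OF id])
        (use that span \<sigma>N in \<open>auto simp: N_def F_def C_def \<Phi>_def vector_space_axioms\<close>)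
    then show "{p\<in>C. \<Phi> p = 0} \<subseteq> N"
      using clinear_zero[OF \<sigma>] by fastforce
  qed
  \<comment> \<open>The cosets are the fibres of \<open>\<Phi>\<close>.\<close>
  define fib where "fib c = {p\<in>C. \<Phi> p = c}" for c
  have \<sigma>fib: "\<sigma> c \<in> fib c" for c
    using \<sigma>B \<Phi>\<sigma> by (simp add: fib_def C_def \<Phi>_def)
  have coset: "N +>\<^bsub>F\<^esub> p = fib (\<Phi> p)" if "p \<in> C" for p
    unfolding a_r_coset_def'
  proof (intro equalityI subsetI)
    fix q assume "q \<in> fib (\<Phi> p)"
    then show "q \<in> (\<Union>h\<in>N. {h \<oplus>\<^bsub>F\<^esub> p})"
      using that by (intro UN_I[of "q - p"]) (auto simp: fib_def N_eq lin_simps F_def C_diff)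
  qed (use that in \<open>auto simp: fib_def N_eq lin_simps F_def C\<close>)
  have car: "carrier (lie_quot F N) = range fib"
  proof -
    have "carrier (lie_quot F N) = (\<lambda>p. N +>\<^bsub>F\<^esub> p) ` C"
      by (auto simp: lie_quot_def A_RCOSETS_def' carF)
    also have "\<dots> = (\<lambda>p. fib (\<Phi> p)) ` C" using coset by (intro image_cong) auto
    also have "\<dots> = range fib"
    proof (intro equalityI subsetI)
      fix y assume "y \<in> range fib"
      then obtain c where "y = fib c" by auto
      moreover have "\<sigma> c \<in> C" "\<Phi> (\<sigma> c) = c" using \<sigma>fib[of c] by (auto simp: fib_def)
      ultimately show "y \<in> (\<lambda>p. fib (\<Phi> p)) ` C" by force
    qed auto
    finally show ?thesis .
  qed
  have \<phi>fib: "the_elem (\<Phi> ` fib c) = c" for c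
  proof -
    have "\<Phi> ` fib c = {c}" using \<sigma>fib[of c] by (auto simp: fib_def image_iff intro!: exI[of _ "\<sigma> c"])
    then show ?thesis by simp
  qed
  have aC: "pextend (a x) p \<in> C" if "x \<in> L" "p \<in> C" for x p
    using that aB unfolding C_def mem_Collect_eq by (intro keys_pextend) auto
  have \<Phi>a: "\<Phi> (pextend (a x) p) = act x (\<Phi> p)" if "x \<in> L" "p \<in> C" for x p
    by (rule clinear_eqI[OF clinear_compose[OF pextend_clinear lin] clinear_compose[OF lin act_clinear]])
      (use that a\<Phi> in \<open>auto simp: C_def \<Phi>_def vector_space_axioms\<close>)
  have fib_zero: "\<zero>\<^bsub>lie_quot F N\<^esub> = fib 0"
    by (auto simp: lie_quot_def N_eq fib_def)
  have fib_add: "fib c \<oplus>\<^bsub>lie_quot F N\<^esub> fib d = fib (c + d)" for c d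
  proof -
    have "fib c \<oplus>\<^bsub>lie_quot F N\<^esub> fib d = (\<Union>p\<in>fib c. \<Union>q\<in>fib d. {p + q})"
      by (simp add: lie_quot_def set_add_def' F_def)
    also have "\<dots> = fib (c + d)"
    proof (intro equalityI subsetI)
      fix q assume "q \<in> fib (c + d)"
      then have "q - \<sigma> d \<in> fib c" "q = (q - \<sigma> d) + \<sigma> d"
        using \<sigma>fib[of d] by (auto simp: fib_def lin_simps C_diff)
      then show "q \<in> (\<Union>p\<in>fib c. \<Union>q\<in>fib d. {p + q})" using \<sigma>fib[of d] by blast
    qed (auto simp: fib_def lin_simps C)
    finally show ?thesis .
  qed
  have fib_smult: "k \<odot>\<^bsub>lie_quot F N\<^esub> fib c = fib (s k c)" for k c
  proof -
    have "k \<odot>\<^bsub>lie_quot F N\<^esub> fib c = (\<Union>p\<in>fib c. N +>\<^bsub>F\<^esub> pscale k p)"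
      by (simp add: lie_quot_def F_def)
    also have "\<dots> = fib (s k c)"
      using \<sigma>fib[of c] by (intro SUP_eq_const) (auto simp: fib_def coset C lin_simps)
    finally show ?thesis .
  qed
  have fib_lact: "lact (lie_quot F N) x (fib c) = fib (act x c)" if "x \<in> L" for x c
  proof -
    have "lact (lie_quot F N) x (fib c) = (\<Union>p\<in>fib c. N +>\<^bsub>F\<^esub> pextend (a x) p)"
      by (simp add: lie_quot_def F_def)
    also have "\<dots> = fib (act x c)"
      using \<sigma>fib[of c] that by (intro SUP_eq_const) (auto simp: fib_def coset aC \<Phi>a)
    finally show ?thesis .
  qed
  have "lie_model s L act (lie_quot F N) (\<lambda>A. the_elem (\<Phi> ` A))"
  proof unfold_locales
    show "bij_betw (\<lambda>A. the_elem (\<Phi> ` A)) (carrier (lie_quot F N)) UNIV"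
      unfolding car by (rule bij_betwI[of _ _ _ fib]) (auto simp: \<phi>fib)
  qed (auto simp: car \<phi>fib fib_zero fib_add fib_smult fib_lact)
  then show ?thesis by (simp add: F_def N_def \<Phi>_def)
qed

lemma one_dim_model:
  assumes L: "lie_subalgebra L"
    and "\<And>x y. x \<in> L \<Longrightarrow> y \<in> L \<Longrightarrow> f (x + y) = f x + f y"
    and "\<And>x c. x \<in> L \<Longrightarrow> f (mscale c x) = c * f x"
    and "\<And>x y. x \<in> L \<Longrightarrow> y \<in> L \<Longrightarrow> f (lie x y) = 0"
  shows "lie_model (*) L (\<lambda>x z. f x * z) (one_dim_module f) id"
  using assms
  by unfold_locales (auto simp: one_dim_module_def algebra_simps intro!: clinearI vector_space_complex)

section \<open>Cartan and Borel subalgebras of sl2\<close>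

definition mat2 :: "complex \<Rightarrow> complex \<Rightarrow> complex \<Rightarrow> complex \<Rightarrow> cmat" where
  "mat2 a b c d = vector [vector [a, b], vector [c, d]]"

lemma mat2_nth [simp]:
  "mat2 a b c d $ 1 $ 1 = a" "mat2 a b c d $ 1 $ 2 = b" "mat2 a b c d $ 2 $ 1 = c" "mat2 a b c d $ 2 $ 2 = d"
  by (simp_all add: mat2_def)

lemma mat2_cases: obtains a b c d where "A = mat2 a b c d"
  by (rule that[of "A $ 1 $ 1" "A $ 1 $ 2" "A $ 2 $ 1" "A $ 2 $ 2"]) (simp add: vec_eq_iff forall_2)

lemma mat2_eq_iff [simp]: "mat2 a b c d = mat2 a' b' c' d' \<longleftrightarrow> a = a' \<and> b = b' \<and> c = c' \<and> d = d'"
  by (auto simp: vec_eq_iff forall_2)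

lemma mat2_ops [simp]:
  "mat2 a b c d + mat2 a' b' c' d' = mat2 (a + a') (b + b') (c + c') (d + d')"
  "mat2 a b c d - mat2 a' b' c' d' = mat2 (a - a') (b - b') (c - c') (d - d')"
  "- mat2 a b c d = mat2 (-a) (-b) (-c) (-d)"
  "mscale k (mat2 a b c d) = mat2 (k * a) (k * b) (k * c) (k * d)"
  "mat2 a b c d ** mat2 a' b' c' d' = mat2 (a * a' + b * c') (a * b' + b * d') (c * a' + d * c') (c * b' + d * d')"
  "trace (mat2 a b c d) = a + d" "(0 = mat2 a b c d) = (a = 0 \<and> b = 0 \<and> c = 0 \<and> d = 0)"
  "(mat2 a b c d = 0) = (a = 0 \<and> b = 0 \<and> c = 0 \<and> d = 0)"
  by (auto simp: vec_eq_iff forall_2 mscale_def matrix_matrix_mult_def sum_2 trace_def)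

lemma lie_mat2 [simp]: "lie (mat2 a b c d) (mat2 a' b' c' d')
   = mat2 (b * c' - c * b') (a * b' + b * d' - a' * b - b' * d)
      (c * a' + d * c' - c' * a - d' * c) (c * b' - b * c')"
  by (simp add: lie_def algebra_simps)

lemma lie_mscale_right: "lie x (mscale c z) = mscale c (lie x z)"
  by (cases x rule: mat2_cases; cases z rule: mat2_cases; simp add: algebra_simps)

lemma sl2_mat2 [simp]: "mat2 a b c d \<in> sl2 \<longleftrightarrow> d = - a"
  by (auto simp: sl2_def eq_neg_iff_add_eq_0 add.commute)

lemma lie_subalgebra_sl2: "lie_subalgebra sl2"
  unfolding lie_subalgebra_def
proof (intro conjI ballI)
  show "mat_vs.subspace sl2"
    unfolding mat_vs.subspace_def
    by (auto simp: sl2_def trace_def sum_2 mscale_def algebra_simps simp flip: distrib_left)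
next
  fix x y show "lie x y \<in> sl2"
    by (cases x rule: mat2_cases; cases y rule: mat2_cases; simp)
qed

lemma mscale_mult_left: "mscale c A ** B = mscale c (A ** B)"
  and mscale_mult_right: "A ** mscale c B = mscale c (A ** B)"
  by (cases A rule: mat2_cases; cases B rule: mat2_cases; simp add: algebra_simps)+

lemma mult_add_left: "(A + B) ** C = A ** C + B ** (C :: cmat)"
  and mult_add_right: "A ** (B + C) = A ** B + A ** (C :: cmat)"
  and mult_diff_left: "(A - B) ** C = A ** C - B ** (C :: cmat)"
  and mult_diff_right: "A ** (B - C) = A ** B - A ** (C :: cmat)"
  by (cases A rule: mat2_cases; cases B rule: mat2_cases; cases C rule: mat2_cases; simp add: algebra_simps)+

lemma trace_mult_commute: "trace (A ** B) = trace (B ** (A :: cmat))"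
  by (cases A rule: mat2_cases; cases B rule: mat2_cases; simp add: algebra_simps)

text \<open>The condition on the coefficients says that the matrix \<open>A\<close> satisfies \<open>A\<^sup>2 = 1\<close>; its centralizer in \<open>sl2\<close> is the line
  that it spans.\<close>

lemma lie_eq_0_mat2:
  assumes "a * a + b * c = 1" and "lie (mat2 a b c (- a)) (mat2 p q r (- p)) = 0"
  shows "mat2 p q r (- p) = mscale (a * p + b * r) (mat2 a b c (- a))"
proof -
  have eqs: "b * r = c * q" "a * q = b * p" "a * r = c * p"
  proof -
    have e: "b * r - c * q = 0 \<and> a * q + b * - p - p * b - q * - a = 0 \<and> c * p + - a * r - r * a - - p * c = 0"
      using assms(2) unfolding lie_mat2 mat2_ops by blast
    show "b * r = c * q" using e by simp
    have "2 * (a * q - b * p) = a * q + b * - p - p * b - q * - a"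
      "2 * (c * p - a * r) = c * p + - a * r - r * a - - p * c" by (simp_all add: algebra_simps)
    then have "2 * (a * q - b * p) = 0" "2 * (c * p - a * r) = 0" using e by metis+
    then show "a * q = b * p" "a * r = c * p" by simp_all
  qed
  show ?thesis
    unfolding mat2_ops mat2_eq_iff by (intro conjI; use assms(1) eqs in Groebner_Basis.algebra)
qed

text \<open>The eigenvalues of \<open>ad A\<close> are \<open>0\<close>, \<open>2\<close> and \<open>- 2\<close>. This gives semisimplicity in the form in which it is used: a
  power of \<open>ad A\<close> that kills \<open>y\<close> can be replaced by the first power.\<close>

lemma ad_ad_ad_mat2:
  assumes "a * a + b * c = 1" and "y \<in> sl2"
  shows "lie (mat2 a b c (- a)) (lie (mat2 a b c (- a)) (lie (mat2 a b c (- a)) y))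
    = mscale 4 (lie (mat2 a b c (- a)) y)"
proof (cases y rule: mat2_cases)
  case (1 p q r s)
  then have y: "y = mat2 p q r (- p)" using assms(2) by simp
  show ?thesis
    unfolding y lie_mat2 mat2_ops mat2_eq_iff by (intro conjI; use assms(1) in Groebner_Basis.algebra)
qed

text \<open>The hypotheses say that both matrices and their sum have determinant zero: a subspace of nilpotent matrices in
  \<open>sl2\<close> is at most a line.\<close>

lemma isotropic_pair:
  assumes "a * a + b * c = 0" "p * p + q * r = 0" "2 * a * p + b * r + c * q = (0::complex)"
    "mat2 a b c (- a) \<noteq> 0"
  shows "\<exists>t. mat2 p q r (- p) = mscale t (mat2 a b c (- a))"
proof (cases "b = 0")
  case True
  then have "a = 0" "c \<noteq> 0" using assms by auto
  then have "q = 0" using assms True by auto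
  then have "p = 0" using assms by simp
  then show ?thesis using \<open>q = 0\<close> \<open>a = 0\<close> \<open>b = 0\<close> \<open>c \<noteq> 0\<close> by (intro exI[of _ "r / c"]) simp
next
  case False
  have "(a * q - b * p) * (a * q - b * p) = 0"
    using assms(1-3) by Groebner_Basis.algebra
  then have 1: "a * q = b * p" by simp
  have "b * (b * r - c * q) = 0" using assms(1-3) 1 by Groebner_Basis.algebra
  then have "b * r = c * q" using False by simp
  then show ?thesis using False 1 by (intro exI[of _ "q / b"]) (simp add: field_simps)
qed

lemma nilpotent_normalizer:
  assumes "a * a + b * c = 0" "mat2 a b c (- a) \<noteq> 0"
  shows "\<exists>p q r. p * p + q * r = 1 \<and> lie (mat2 p q r (- p)) (mat2 a b c (- a)) = mscale 2 (mat2 a b c (- a))"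
proof (cases "b = 0")
  case True
  then have "a = 0" using assms by simp
  then show ?thesis using True by (intro exI[of _ "-1"] exI[of _ 0]) simp
next
  case False
  then have "c = - a * a / b" using assms by (simp add: field_simps add_eq_0_iff)
  then show ?thesis using False
    by (intro exI[of _ "1"] exI[of _ 0] exI[of _ "- 2 * a / b"]) (simp add: field_simps)
qed

text \<open>If a Cartan subalgebra contains an invertible element, this can be scaled to have square one; nilpotency and
  semisimplicity of its adjoint action put the whole subalgebra into its centralizer. Otherwise the subalgebra
  is a nilpotent line, and the element \<open>n\<close> with \<open>[n, x] = 2 x\<close> normalizes it without belonging to it.\<close>

lemma cartan_subalgebra_line:
  assumes "cartan_subalgebra h"
  shows "\<exists>a b c. a * a + b * c = 1 \<and> h = range (\<lambda>t. mscale t (mat2 a b c (- a)))"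
proof -
  have sub: "mat_vs.subspace h" and hsl: "h \<subseteq> sl2" and nil: "lie_nilpotent h"
    and norm: "\<And>x. x \<in> sl2 \<Longrightarrow> (\<And>y. y \<in> h \<Longrightarrow> lie x y \<in> h) \<Longrightarrow> x \<in> h"
    using assms by (auto simp: cartan_subalgebra_def lie_subalgebra_def)
  have cases: "\<exists>a b c. x = mat2 a b c (- a)" if "x \<in> sl2" for x
    using that by (cases x rule: mat2_cases) auto
  have h0: "h \<noteq> {0}"
  proof
    assume h: "h = {0}"
    have "mat2 1 0 0 (-1) \<in> h"
      by (rule norm) (auto simp: h lie_def)
    then show False using h by simp
  qed
  show ?thesis
  proof (cases "\<exists>a b c. mat2 a b c (- a) \<in> h \<and> a * a + b * c \<noteq> 0")
    case True
    then obtain a b c where x: "mat2 a b c (- a) \<in> h" and D: "a * a + b * c \<noteq> 0" by blast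
    define r where "r = csqrt (a * a + b * c)"
    have r: "r * r = a * a + b * c" "r \<noteq> 0" using D power2_csqrt[of "a * a + b * c"]
      by (auto simp: r_def power2_eq_square)
    define H where "H = mat2 (a / r) (b / r) (c / r) (- (a / r))"
    have n: "a / r * (a / r) + b / r * (c / r) = 1" 
    proof -
      have "a / r * (a / r) + b / r * (c / r) = (a * a + b * c) / (r * r)" by (simp add: add_divide_distrib)
      then show ?thesis using r D by (metis divide_self)
    qed
    have "H = mscale (1 / r) (mat2 a b c (- a))" by (simp add: H_def)
    then have Hh: "H \<in> h" using mat_vs.subspace_scale[OF sub x, of "1 / r"] by metis
    have "y \<in> range (\<lambda>t. mscale t H)" if y: "y \<in> h" for y
    proof -
      have ysl: "y \<in> sl2" using y hsl by auto
      obtain n where n0: "((\<lambda>A. lie_comm h A) ^^ n) h = {0}"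
        using nil unfolding lie_nilpotent_def by blast
      have "(lie H ^^ k) y \<in> ((\<lambda>A. lie_comm h A) ^^ k) h" for k
      proof (induction k)
        case (Suc k)
        then show ?case using Hh by (auto simp: lie_comm_def intro!: mat_vs.span_base)
      qed (use y in simp)
      then have "(lie H ^^ n) y = 0" using n0 by blast
      moreover have "(lie H ^^ m) 0 = 0" for m
        by (induction m) (simp_all add: lie_def)
      ultimately have "(lie H ^^ (Suc n + n)) y = 0" by (metis comp_apply funpow_add)
      moreover have "(lie H ^^ (Suc k + k)) y = mscale (4 ^ k) (lie H y)" for k
      proof (induction k)
        case (Suc k)
        have "(lie H ^^ (Suc (Suc k) + Suc k)) y = lie H (lie H ((lie H ^^ (Suc k + k)) y))" by simp
        also have "\<dots> = mscale (4 ^ k) (lie H (lie H (lie H y)))"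
          by (simp only: Suc.IH lie_mscale_right)
        also have "\<dots> = mscale (4 ^ Suc k) (lie H y)"
          unfolding H_def by (subst ad_ad_ad_mat2[OF n ysl]) (simp only: mat_vs.scale_scale power_Suc2)
        finally show ?case .
      qed simp
      ultimately have "mscale (4 ^ n) (lie H y) = 0" by metis
      then have "lie H y = 0" by simp
      moreover obtain p q r where "y = mat2 p q r (- p)" using cases[OF ysl] by blast
      ultimately show ?thesis
        using lie_eq_0_mat2[OF n] unfolding H_def by blast
    qed
    moreover have "mscale t H \<in> h" for t using mat_vs.subspace_scale[OF sub Hh] .
    ultimately have "h = range (\<lambda>t. mscale t H)" by auto
    then show ?thesis using n unfolding H_def by blast
  next
    case False
    have "\<exists>x\<in>h. x \<noteq> 0" using h0 mat_vs.subspace_0[OF sub] by auto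
    then obtain a b c where x: "mat2 a b c (- a) \<in> h" "mat2 a b c (- a) \<noteq> 0"
      using cases hsl by blast
    have D: "a * a + b * c = 0" using False x by blast
    have h_line: "\<exists>t. y = mscale t (mat2 a b c (- a))" if y: "y \<in> h" for y
    proof -
      obtain p q r where pqr: "y = mat2 p q r (- p)" using cases hsl y by blast
      have "mat2 (a + p) (b + q) (c + r) (- (a + p)) \<in> h"
        using mat_vs.subspace_add[OF sub x(1) y] by (simp add: pqr)
      then have "(a + p) * (a + p) + (b + q) * (c + r) = 0" using False by blast
      moreover have D': "p * p + q * r = 0" using False y pqr by blast
      ultimately have "2 * a * p + b * r + c * q = 0" using D by Groebner_Basis.algebra
      then show ?thesis using isotropic_pair[OF D D' _ x(2)] pqr by blast
    qed
    obtain p q r where pqr: "p * p + q * r = 1"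
      "lie (mat2 p q r (- p)) (mat2 a b c (- a)) = mscale 2 (mat2 a b c (- a))"
      using nilpotent_normalizer[OF D x(2)] by blast
    have "mat2 p q r (- p) \<in> h"
    proof (rule norm)
      fix y assume "y \<in> h"
      then obtain t where "y = mscale t (mat2 a b c (- a))" using h_line by blast
      then show "lie (mat2 p q r (- p)) y \<in> h"
        by (simp only: lie_mscale_right pqr(2) mat_vs.subspace_scale[OF sub] x(1))
    qed simp
    then show ?thesis using False pqr(1) by auto
  qed
qed

text \<open>A change of basis; \<open>cj\<close> transports the standard matrices.\<close>

locale frame =
  fixes P Q :: cmat
  assumes PQ: "P ** Q = mat 1" and QP: "Q ** P = mat 1"
begin

definition cj :: "cmat \<Rightarrow> cmat" where "cj x = P ** x ** Q"

lemma cj_add: "cj (x + y) = cj x + cj y"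
  and cj_mscale: "cj (mscale c x) = mscale c (cj x)"
  and cj_minus: "cj (x - y) = cj x - cj y"
  by (simp_all add: cj_def mult_add_left mult_add_right mult_diff_left mult_diff_right
      mscale_mult_left mscale_mult_right)

lemma cj_mult: "cj x ** cj y = cj (x ** y)"
proof -
  have "cj x ** cj y = P ** x ** (Q ** P) ** y ** Q"
    by (simp only: cj_def matrix_mul_assoc)
  then show ?thesis by (simp add: QP cj_def matrix_mul_assoc)
qed

lemma lie_cj: "lie (cj x) (cj y) = cj (lie x y)"
  by (simp add: lie_def cj_mult cj_minus)

lemma cj_inv: "cj (Q ** x ** P) = x"
proof -
  have "cj (Q ** x ** P) = (P ** Q) ** x ** (P ** Q)" by (simp only: cj_def matrix_mul_assoc)
  then show ?thesis by (simp add: PQ)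
qed

lemma inv_cj: "Q ** cj z ** P = z"
proof -
  have "Q ** cj z ** P = (Q ** P) ** z ** (Q ** P)" by (simp only: cj_def matrix_mul_assoc)
  then show ?thesis by (simp add: QP)
qed

lemma cj_eq_iff [simp]: "cj x = cj y \<longleftrightarrow> x = y"
  by (metis inv_cj)

lemma cj_0 [simp]: "cj 0 = 0"
  by (simp add: cj_def)

lemma cj_eq_0 [simp]: "cj x = 0 \<longleftrightarrow> x = 0"
  using cj_eq_iff[of x 0] by (simp del: cj_eq_iff)

lemma cj_sl2 [simp]: "cj x \<in> sl2 \<longleftrightarrow> x \<in> sl2"
proof -
  have "trace (cj x) = trace (Q ** P ** x)"
    unfolding cj_def by (subst trace_mult_commute) (simp add: matrix_mul_assoc)
  then show ?thesis by (simp add: sl2_def QP)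
qed

lemma sl2_cj: "x \<in> sl2 \<longleftrightarrow> (\<exists>a b c. x = cj (mat2 a b c (- a)))"
proof
  assume x: "x \<in> sl2"
  obtain a b c d where abcd: "Q ** x ** P = mat2 a b c d" by (rule mat2_cases)
  then have "x = cj (mat2 a b c d)" using cj_inv[of x] by simp
  moreover from this have "d = - a" using x by simp
  ultimately show "\<exists>a b c. x = cj (mat2 a b c (- a))" by blast
qed auto

definition "hh t = cj (mat2 t 0 0 (- t))"
definition "bb t u = cj (mat2 t u 0 (- t))"

end

lemma solvable_upper:
  assumes "frame P Q"
  shows "lie_subalgebra (range (case_prod (frame.bb P Q)))" "lie_solvable (range (case_prod (frame.bb P Q)))"
    "range (case_prod (frame.bb P Q)) \<subseteq> sl2"
proof -
  interpret frame P Q by fact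
  let ?B = "range (case_prod bb)"
  have mem: "x \<in> ?B \<longleftrightarrow> (\<exists>t u. x = bb t u)" for x by auto
  have add: "bb t u + bb t' u' = bb (t + t') (u + u')" for t u t' u'
    by (simp add: bb_def flip: cj_add)
  have scale: "mscale c (bb t u) = bb (c * t) (c * u)" for t u c
    by (simp add: bb_def flip: cj_mscale)
  have lie: "lie (bb t u) (bb t' u') = bb 0 (2 * (t * u' - t' * u))" for t u t' u'
    by (simp add: bb_def lie_cj algebra_simps)
  have zero: "bb 0 0 = 0" by (simp add: bb_def)
  show "lie_subalgebra ?B"
    unfolding lie_subalgebra_def mat_vs.subspace_def mem
  proof (intro conjI ballI allI)
    show "\<exists>t u. 0 = bb t u" using zero by metis
  next
    fix x y assume "x \<in> ?B" "y \<in> ?B"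
    then obtain t u t' u' where "x = bb t u" "y = bb t' u'" unfolding mem by blast
    then show "\<exists>t u. x + y = bb t u" "\<exists>t u. lie x y = bb t u" using add lie by blast+
  next
    fix c x assume "x \<in> ?B"
    then obtain t u where "x = bb t u" unfolding mem by blast
    then show "\<exists>t u. mscale c x = bb t u" using scale by blast
  qed
  show "?B \<subseteq> sl2" by (auto simp: bb_def)
  let ?N = "range (bb 0)"
  have "lie_comm ?B ?B \<subseteq> ?N"
    unfolding lie_comm_def
  proof (rule mat_vs.span_minimal)
    show "{lie x y |x y. x \<in> ?B \<and> y \<in> ?B} \<subseteq> ?N" by (auto simp: lie)
    show "mat_vs.subspace ?N"
      unfolding mat_vs.subspace_def using zero[symmetric] by (auto simp: add scale)
  qed
  moreover have "lie_comm A A = {0}" if "A \<subseteq> ?N" for A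
  proof
    show "lie_comm A A \<subseteq> {0}"
      unfolding lie_comm_def
    proof (rule mat_vs.span_minimal)
      have "lie x y = 0" if xy: "x \<in> A" "y \<in> A" for x y
      proof -
        obtain u v where "x = bb 0 u" "y = bb 0 v" using \<open>A \<subseteq> ?N\<close> xy by blast
        then show ?thesis by (simp add: lie zero)
      qed
      then show "{lie x y |x y. x \<in> A \<and> y \<in> A} \<subseteq> {0}" by auto
    qed simp
  qed (simp add: lie_comm_def mat_vs.span_zero)
  ultimately show "lie_solvable ?B"
    unfolding lie_solvable_def by (intro exI[of _ 2]) (simp add: numeral_2_eq_2)
qed

lemma sl2_not_solvable: "\<not> lie_solvable sl2"
proof
  assume "lie_solvable sl2"
  then obtain n where n: "((\<lambda>A. lie_comm A A) ^^ n) sl2 = {0}" by (auto simp: lie_solvable_def)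
  have *: "sl2 \<subseteq> lie_comm A A" if A: "sl2 \<subseteq> A" for A
  proof
    fix x assume "x \<in> sl2"
    then obtain a b c where x: "x = mat2 a b c (- a)" by (cases x rule: mat2_cases) auto
    have l: "lie y z \<in> lie_comm A A" if "y \<in> sl2" "z \<in> sl2" for y z
      unfolding lie_comm_def using that A by (intro mat_vs.span_base) blast
    have "x = lie (mat2 0 1 0 0) (mat2 0 0 a 0) + lie (mat2 1 0 0 (-1)) (mat2 0 (b / 2) (- c / 2) 0)"
      by (simp add: x)
    moreover have "\<dots> \<in> lie_comm A A"
      using l[of "mat2 0 1 0 0" "mat2 0 0 a 0"] l[of "mat2 1 0 0 (-1)" "mat2 0 (b / 2) (- c / 2) 0"]
      unfolding lie_comm_def by (intro mat_vs.span_add) simp_all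
    ultimately show "x \<in> lie_comm A A" by simp
  qed
  have "sl2 \<subseteq> ((\<lambda>A. lie_comm A A) ^^ n) sl2"
  proof (induction n)
    case (Suc n)
    then show ?case using * by simp
  qed simp
  moreover have "mat2 1 0 0 (-1) \<in> sl2" by simp
  ultimately show False using n by (metis mat2_ops(7) one_neq_zero singletonD subsetD)
qed

text \<open>The Cartan subalgebra is diagonalised by the eigenvectors of a generator \<open>A\<close> with \<open>A\<^sup>2 = 1\<close>. The Borel subalgebra is
  stable under its adjoint action, hence a sum of root spaces. It cannot contain both root lines, since \<open>sl2\<close> is
  not solvable, and by maximality it contains at least one. If it is the lower one, the two eigenvectors are
  exchanged.\<close>

theorem cartan_borel_frame:
  assumes h: "cartan_subalgebra h" and b: "borel_subalgebra b" and hb: "h \<subseteq> b"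
  shows "\<exists>P Q. frame P Q \<and> h = range (frame.hh P Q) \<and> b = range (case_prod (frame.bb P Q))"
proof -
  obtain a' b' c' where "a' * a' + b' * c' = 1" "h = range (\<lambda>t. mscale t (mat2 a' b' c' (- a')))"
    using cartan_subalgebra_line[OF h] by blast
  moreover have "range (\<lambda>t. mscale t (mat2 a' b' c' (- a'))) = range (\<lambda>t. mscale t (mat2 (-a') (-b') (-c') a'))"
  proof -
    have "range (\<lambda>t. mscale t (mat2 (-a') (-b') (-c') a')) = (\<lambda>t. mscale t (mat2 a' b' c' (- a'))) ` range uminus"
      unfolding image_image by (intro image_cong) simp_all
    then show ?thesis by simp
  qed
  ultimately obtain a b0 c where n: "a * a + b0 * c = 1" "a \<noteq> -1"
    and h_eq: "h = range (\<lambda>t. mscale t (mat2 a b0 c (- a)))"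
    by (cases "a' = -1") (metis add.inverse_inverse minus_mult_minus one_neq_neg_one)+
  \<comment> \<open>The columns of \<open>P\<close> are eigenvectors for \<open>1\<close> and \<open>- 1\<close>; its determinant \<open>2 * (1 + a)\<close> is nonzero because the
    sign of the generator was chosen with \<open>a \<noteq> - 1\<close>.\<close>
  define d where "d = 1 / (2 * (1 + a))"
  have "1 + a \<noteq> 0" using n(2) by (simp add: add_eq_0_iff)
  then have d: "2 * d * (1 + a) = 1" 
    by (metis d_def divide_self mult.commute mult.left_commute mult_eq_0_iff times_divide_eq_left mult_1 zero_neq_numeral)
  define P where "P = mat2 (1 + a) (- b0) c (1 + a)"
  define Q where "Q = mscale d (mat2 (1 + a) b0 (- c) (1 + a))"
  have mat1: "mat 1 = mat2 1 0 0 1" by (simp add: vec_eq_iff forall_2 mat_def)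
  interpret PQ: frame P Q
    unfolding frame_def P_def Q_def mat1 mat2_ops mat2_eq_iff
    by (intro conjI; (use n(1) d in Groebner_Basis.algebra | simp add: algebra_simps))
  have "P ** mat2 t 0 0 (- t) ** Q = mscale t (mat2 a b0 c (- a))" for t
    unfolding P_def Q_def mat2_ops mat2_eq_iff
    by (intro conjI; (use n(1) d in Groebner_Basis.algebra | simp add: algebra_simps))
  then have hh: "PQ.hh t = mscale t (mat2 a b0 c (- a))" for t
    unfolding PQ.hh_def PQ.cj_def .
  have sub: "mat_vs.subspace b" and blie: "\<And>x y. x \<in> b \<Longrightarrow> y \<in> b \<Longrightarrow> lie x y \<in> b"
    and bsl: "b \<subseteq> sl2" and bsol: "lie_solvable b"
    and max: "\<And>b'. lie_subalgebra b' \<and> lie_solvable b' \<and> b' \<subseteq> sl2 \<Longrightarrow> b \<subseteq> b' \<Longrightarrow> b' = b"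
    using b by (auto simp: borel_subalgebra_def lie_subalgebra_def)
  have hb': "PQ.hh t \<in> b" for t using hb h_eq hh by auto
  let ?m = "\<lambda>t u v. PQ.cj (mat2 t u v (- t))"
  have parts: "?m 0 u 0 \<in> b \<and> ?m 0 0 v \<in> b" if "?m t u v \<in> b" for t u v
  proof -
    have 1: "?m 0 (2 * u) (- 2 * v) \<in> b"
      using blie[OF hb'[of 1] that] by (simp add: PQ.hh_def PQ.lie_cj)
    have 2: "?m 0 (4 * u) (4 * v) \<in> b"
      using blie[OF hb'[of 1] 1] by (simp add: PQ.hh_def PQ.lie_cj)
    have "mscale (1/4) (?m 0 (2 * u) (- 2 * v)) + mscale (1/8) (?m 0 (4 * u) (4 * v)) \<in> b"
      "mscale (-1/4) (?m 0 (2 * u) (- 2 * v)) + mscale (1/8) (?m 0 (4 * u) (4 * v)) \<in> b"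
      by (intro mat_vs.subspace_add mat_vs.subspace_scale sub 1 2)+
    then show ?thesis by (simp flip: PQ.cj_mscale PQ.cj_add)
  qed
  have scale: "?m 0 u 0 \<in> b" if "?m 0 u' 0 \<in> b" "u' \<noteq> 0" for u u'
    using mat_vs.subspace_scale[OF sub that(1), of "u / u'"] that(2) by (simp flip: PQ.cj_mscale)
  have scale': "?m 0 0 u \<in> b" if "?m 0 0 u' \<in> b" "u' \<noteq> 0" for u u'
    using mat_vs.subspace_scale[OF sub that(1), of "u / u'"] that(2) by (simp flip: PQ.cj_mscale)
  have comb: "?m t u v \<in> b" if "?m 0 u 0 \<in> b" "?m 0 0 v \<in> b" for t u v
    using mat_vs.subspace_add[OF sub mat_vs.subspace_add[OF sub hb'[of t] that(1)] that(2)]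
    by (simp add: PQ.hh_def flip: PQ.cj_add)
  \<comment> \<open>The Weyl group element, which exchanges the two root lines.\<close>
  define w where "w = mat2 0 1 (-1) 0"
  define w' where "w' = mat2 0 (-1) 1 0"
  have ww: "w ** w' = mat 1" "w' ** w = mat 1" by (simp_all add: w_def w'_def mat1)
  interpret W: frame "P ** w" "w' ** Q"
  proof
    have "(P ** w) ** (w' ** Q) = P ** (w ** w') ** Q" by (simp only: matrix_mul_assoc)
    then show "(P ** w) ** (w' ** Q) = mat 1" by (simp add: ww PQ.PQ)
    have "(w' ** Q) ** (P ** w) = w' ** (Q ** P) ** w" by (simp only: matrix_mul_assoc)
    then show "(w' ** Q) ** (P ** w) = mat 1" by (simp add: ww PQ.QP)
  qed
  have Wcj: "W.cj x = PQ.cj (w ** x ** w')" for x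
    by (simp only: W.cj_def PQ.cj_def matrix_mul_assoc)
  have wm: "w ** mat2 t u 0 (- t) ** w' = mat2 (- t) 0 (- u) t" for t u
    by (simp add: w_def w'_def)
  have Wbb: "W.bb t u = ?m (- t) 0 (- u)" and Whh: "W.hh t = PQ.hh (- t)" for t u
    by (simp_all add: W.bb_def W.hh_def PQ.hh_def Wcj wm)
  have h1: "h = range PQ.hh" using h_eq hh by auto
  have h2: "h = range W.hh"
  proof -
    have "W.hh = (\<lambda>t. PQ.hh (- t))" by (rule ext) (rule Whh)
    then have "range W.hh = PQ.hh ` range uminus" by (simp only: image_image)
    then show ?thesis using h1 by simp
  qed
  consider (both) u v t t' u' v' where "?m t u v \<in> b" "?m t' u' v' \<in> b" "u \<noteq> 0" "v' \<noteq> 0"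
    | (upper) "\<And>t u v. ?m t u v \<in> b \<Longrightarrow> v = 0"
    | (lower) "\<And>t u v. ?m t u v \<in> b \<Longrightarrow> u = 0"
    by metis
  then show ?thesis
  proof cases
    case both
    then have "?m t u v \<in> b" for t u v
      using parts scale scale' comb by meson
    then have "x \<in> b" if "x \<in> sl2" for x using that unfolding PQ.sl2_cj by fastforce
    then have "b = sl2" using bsl by blast
    then show ?thesis using bsol sl2_not_solvable by simp
  next
    case upper
    have "b \<subseteq> range (case_prod PQ.bb)"
    proof
      fix x assume x: "x \<in> b"
      then obtain t u v where "x = ?m t u v" using bsl PQ.sl2_cj by blast
      moreover have "v = 0" using upper x calculation by blast
      ultimately have "x = PQ.bb t u" by (simp add: PQ.bb_def)
      then show "x \<in> range (case_prod PQ.bb)" by auto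
    qed
    then have "range (case_prod PQ.bb) = b"
      using max solvable_upper[OF PQ.frame_axioms] by blast
    then show ?thesis using PQ.frame_axioms h1 by blast
  next
    case lower
    have "b \<subseteq> range (case_prod W.bb)"
    proof
      fix x assume x: "x \<in> b"
      then obtain t u v where "x = ?m t u v" using bsl PQ.sl2_cj by blast
      moreover have "u = 0" using lower x calculation by blast
      ultimately have "x = W.bb (- t) (- v)" by (simp add: Wbb)
      then show "x \<in> range (case_prod W.bb)" by auto
    qed
    then have "range (case_prod W.bb) = b"
      using max solvable_upper[OF W.frame_axioms] by blast
    then show ?thesis using W.frame_axioms h2 by blast
  qed
qed

declare single_one [simp del]

context frame
begin

section \<open>Weights in a frame\<close>

text \<open>The coordinates with respect to the standard triple.\<close>

definition "ca x = (Q ** x ** P) $ 1 $ 1"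
definition "cb x = (Q ** x ** P) $ 1 $ 2"
definition "cc x = (Q ** x ** P) $ 2 $ 1"

abbreviation "\<e> \<equiv> cj (mat2 0 1 0 0)"
abbreviation "\<f> \<equiv> cj (mat2 0 0 1 0)"
abbreviation "\<h> \<equiv> cj (mat2 1 0 0 (-1))"

lemma coords_cj [simp]: "ca (cj z) = z $ 1 $ 1" "cb (cj z) = z $ 1 $ 2" "cc (cj z) = z $ 2 $ 1"
  by (simp_all add: ca_def cb_def cc_def inv_cj)

lemma coords_add: "ca (x + y) = ca x + ca y" "cb (x + y) = cb x + cb y" "cc (x + y) = cc x + cc y"
  by (simp_all add: ca_def cb_def cc_def mult_add_left mult_add_right)

lemma coords_mscale: "ca (mscale k x) = k * ca x" "cb (mscale k x) = k * cb x" "cc (mscale k x) = k * cc x"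
  by (simp_all add: ca_def cb_def cc_def mscale_mult_left mscale_mult_right) (simp_all add: mscale_def)

lemma sl2_expand: "x \<in> sl2 \<Longrightarrow> x = mscale (ca x) \<h> + mscale (cb x) \<e> + mscale (cc x) \<f>"
  by (auto simp: sl2_cj simp flip: cj_mscale cj_add)

lemma coords_lie:
  assumes "x \<in> sl2" "y \<in> sl2"
  shows "ca (lie x y) = cb x * cc y - cc x * cb y"
    "cb (lie x y) = 2 * (ca x * cb y - cb x * ca y)" "cc (lie x y) = 2 * (cc x * ca y - ca x * cc y)"
  using assms by (auto simp: sl2_cj lie_cj algebra_simps)

abbreviation "hset \<equiv> range hh"
abbreviation "bset \<equiv> range (case_prod bb)"

lemma root_space_pos:
  "root_space hset (\<lambda>y\<in>hset. 2 * ca y) = range (\<lambda>u. cj (mat2 0 u 0 0))"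
proof (intro equalityI subsetI)
  fix x assume x: "x \<in> root_space hset (\<lambda>y\<in>hset. 2 * ca y)"
  then obtain a b c where abc: "x = cj (mat2 a b c (- a))" by (auto simp: root_space_def sl2_cj)
  have "lie (hh 1) x = mscale 2 x" using x by (auto simp: root_space_def hh_def)
  then show "x \<in> range (\<lambda>u. cj (mat2 0 u 0 0))"
    by (auto simp: abc hh_def lie_cj simp flip: cj_mscale)
next
  fix x assume "x \<in> range (\<lambda>u. cj (mat2 0 u 0 0))"
  then show "x \<in> root_space hset (\<lambda>y\<in>hset. 2 * ca y)"
    by (auto simp: root_space_def hh_def lie_cj simp flip: cj_mscale)
qed

text \<open>A nonzero vector of the root space determines the values of a positive root on all of the Cartan subalgebra.\<close>

lemma the_positive_root:
  "the_positive_root hset bset = (\<lambda>y\<in>hset. 2 * ca y)"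
  unfolding the_positive_root_def
proof (rule the_equality)
  have "\<e> \<in> root_space hset (\<lambda>y\<in>hset. 2 * ca y)" "\<e> \<noteq> 0"
    by (auto simp: root_space_pos)
  moreover have "cj (mat2 0 u 0 0) \<in> bset" for u
    by (rule range_eqI[of _ _ "(0, u)"]) (simp add: bb_def)
  moreover have "(\<lambda>y\<in>hset. 2 * ca y) (hh 1) \<noteq> 0" by (simp add: hh_def image_iff)
  ultimately show "positive_root hset bset (\<lambda>y\<in>hset. 2 * ca y)"
    unfolding positive_root_def root_space_pos by blast
next
  fix \<alpha> assume "positive_root hset bset \<alpha>"
  then have \<alpha>: "\<alpha> \<in> extensional hset" and t': "\<exists>y\<in>hset. \<alpha> y \<noteq> 0"
    and ne: "root_space hset \<alpha> \<noteq> {0}"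
    and sub: "root_space hset \<alpha> \<subseteq> bset"
    by (simp_all add: positive_root_def)
  obtain t where t: "\<alpha> (hh t) \<noteq> 0" using t' by blast
  have "0 \<in> root_space hset \<alpha>" by (simp add: root_space_def sl2_def trace_def lie_def)
  then obtain e where e: "e \<in> root_space hset \<alpha>" "e \<noteq> 0" using ne by blast
  obtain p q where pq: "e = bb p q" using e(1) sub by auto
  have *: "cj (mat2 0 (2 * r * q) 0 0) = cj (mat2 (\<alpha> (hh r) * p) (\<alpha> (hh r) * q) 0 (- (\<alpha> (hh r) * p)))" for r
    using e(1) by (auto simp: root_space_def pq bb_def hh_def lie_cj algebra_simps simp flip: cj_mscale)
  then have "p = 0" using t *[of t] by simp
  then have "q \<noteq> 0" using e(2) by (auto simp: pq bb_def)
  then have "\<alpha> (hh r) = 2 * r" for r using *[of r] by auto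
  then show "\<alpha> = (\<lambda>y\<in>hset. 2 * ca y)"
    using \<alpha> by (intro extensionalityI[OF \<alpha>]) (auto simp: hh_def)
qed

lemma borel_char_eq:
  assumes "x \<in> bset"
  shows "borel_char hset bset \<mu> x = \<mu> * ca x"
proof -
  obtain t u where x: "x = bb t u" using assms by auto
  show ?thesis
    unfolding borel_char_def the_positive_root root_space_pos weight_def
  proof (rule the_equality)
    show "\<exists>y\<in>hset. x - y \<in> range (\<lambda>u. cj (mat2 0 u 0 0)) \<and> \<mu> * ca x = \<mu> / 2 * (\<lambda>y\<in>hset. 2 * ca y) y"
      by (rule bexI[of _ "hh t"]) (auto simp: x bb_def hh_def simp flip: cj_minus)
  next
    fix c assume "\<exists>y\<in>hset. x - y \<in> range (\<lambda>u. cj (mat2 0 u 0 0)) \<and> c = \<mu> / 2 * (\<lambda>y\<in>hset. 2 * ca y) y"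
    then obtain t' where t': "x - hh t' \<in> range (\<lambda>u. cj (mat2 0 u 0 0))"
      and c: "c = \<mu> / 2 * (\<lambda>y\<in>hset. 2 * ca y) (hh t')" by blast
    have "x - hh t' = cj (mat2 (t - t') u 0 (t' - t))" by (simp add: x bb_def hh_def flip: cj_minus)
    moreover obtain v where "x - hh t' = cj (mat2 0 v 0 0)" using t' by blast
    ultimately have "cj (mat2 (t - t') u 0 (t' - t)) = cj (mat2 0 v 0 0)" by (rule trans[OF sym])
    then have "t - t' = 0" unfolding cj_eq_iff mat2_eq_iff by blast
    then have "t' = t" by simp
    then show "c = \<mu> * ca x" unfolding c x by (simp add: bb_def hh_def)
  qed
qed

section \<open>Representations of sl2 from three operators\<close>

text \<open>Any three operators that satisfy the relations of the standard triple define a representation, by linearity in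
  the matrix.\<close>

definition opact :: "(complex \<Rightarrow> 'v \<Rightarrow> 'v) \<Rightarrow> ('v \<Rightarrow> 'v) \<Rightarrow> ('v \<Rightarrow> 'v) \<Rightarrow> ('v \<Rightarrow> 'v) \<Rightarrow> cmat \<Rightarrow> 'v::ab_group_add \<Rightarrow> 'v" where
  "opact s E F H x v = s (ca x) (H v) + s (cb x) (E v) + s (cc x) (F v)"

lemma opact_rep:
  assumes s: "vector_space s" and lin: "clinear s s E" "clinear s s F" "clinear s s H"
    and EF: "\<And>v. E (F v) = F (E v) + H v" and HE: "\<And>v. H (E v) = E (H v) + s 2 (E v)"
    and HF: "\<And>v. H (F v) = F (H v) - s 2 (F v)"
  shows "lie_rep s sl2 (opact s E F H)"
proof -
  interpret vector_space s by fact
  note L = lin[THEN clinear_add] lin[THEN clinear_scale]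
  have 1: "clinear s s (opact s E F H x)" for x
    by (rule clinearI) (simp_all add: opact_def L vector_space_axioms algebra_simps)
  have 2: "opact s E F H (x + y) v = opact s E F H x v + opact s E F H y v" for x y v
    by (simp add: opact_def coords_add algebra_simps)
  have 3: "opact s E F H (mscale c x) v = s c (opact s E F H x v)" for x c v
    by (simp add: opact_def coords_mscale algebra_simps)
  have 4: "opact s E F H (lie x y) v = opact s E F H x (opact s E F H y v) - opact s E F H y (opact s E F H x v)"
    if "x \<in> sl2" "y \<in> sl2" for x y v
    by (simp add: opact_def coords_lie[OF that] L EF HE HF algebra_simps)
  show ?thesis
    by (intro lie_rep.intro lie_rep_axioms.intro vector_space_axioms lie_subalgebra_sl2 1 2 3 4)
qed

lemma opact_efh [simp]:
  assumes "vector_space s"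
  shows "opact s E F H \<e> v = E v" "opact s E F H \<f> v = F v" "opact s E F H \<h> v = H v"
proof -
  interpret vector_space s by fact
  show "opact s E F H \<e> v = E v" "opact s E F H \<f> v = F v" "opact s E F H \<h> v = H v"
    by (simp_all add: opact_def)
qed

end

section \<open>The concrete Verma module\<close>

text \<open>The basis vector of \<open>k\<close> stands for \<open>f^k v\<close> with \<open>v\<close> of highest weight \<open>\<mu>\<close>. The value \<open>k - 1\<close> for \<open>k = 0\<close> is harmless,
  as the coefficient is zero.\<close>

definition vE :: "complex \<Rightarrow> (nat \<Rightarrow>\<^sub>0 complex) \<Rightarrow> (nat \<Rightarrow>\<^sub>0 complex)" where
  "vE \<mu> = pextend (\<lambda>k. pscale (of_nat k * (\<mu> - of_nat k + 1)) (basis_vec (k - 1)))"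
definition vF :: "(nat \<Rightarrow>\<^sub>0 complex) \<Rightarrow> (nat \<Rightarrow>\<^sub>0 complex)" where
  "vF = pextend (\<lambda>k. basis_vec (Suc k))"
definition vH :: "complex \<Rightarrow> (nat \<Rightarrow>\<^sub>0 complex) \<Rightarrow> (nat \<Rightarrow>\<^sub>0 complex)" where
  "vH \<mu> = pextend (\<lambda>k. pscale (\<mu> - 2 * of_nat k) (basis_vec k))"

lemma v_clinear: "clinear pscale pscale (vE \<mu>)" "clinear pscale pscale vF" "clinear pscale pscale (vH \<mu>)"
  by (simp_all add: vE_def vF_def vH_def pextend_clinear)

lemma v_basis [simp]:
  "vE \<mu> (basis_vec k) = pscale (of_nat k * (\<mu> - of_nat k + 1)) (basis_vec (k - 1))"
  "vF (basis_vec k) = basis_vec (Suc k)"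
  "vH \<mu> (basis_vec k) = pscale (\<mu> - 2 * of_nat k) (basis_vec k)"
  by (simp_all add: vE_def vF_def vH_def)

lemma
  assumes f: "clinear s1 s2 f" and g: "clinear s1 s2 g"
  shows clinear_plus: "clinear s1 s2 (\<lambda>x. f x + g x)"
    and clinear_minus: "clinear s1 s2 (\<lambda>x. f x - g x)"
proof -
  interpret V: vector_space s2 using clinear_vs[OF f] by blast
  note l = clinear_add[OF f] clinear_add[OF g] clinear_scale[OF f] clinear_scale[OF g]
  show "clinear s1 s2 (\<lambda>x. f x + g x)" "clinear s1 s2 (\<lambda>x. f x - g x)"
    using clinear_vs[OF f] by (auto intro!: clinearI simp: l V.scale_right_distrib V.scale_right_diff_distrib)
qed

lemma clinear_smult:
  assumes f: "clinear s1 s2 f"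
  shows "clinear s1 s2 (\<lambda>x. s2 c (f x))"
proof -
  interpret V: vector_space s2 using clinear_vs[OF f] by blast
  show ?thesis
    using clinear_vs[OF f]
    by (auto intro!: clinearI simp: clinear_add[OF f] clinear_scale[OF f] V.scale_right_distrib mult.commute)
qed

lemma v_rel:
  "vE \<mu> (vF v) = vF (vE \<mu> v) + vH \<mu> v" "vH \<mu> (vE \<mu> v) = vE \<mu> (vH \<mu> v) + pscale 2 (vE \<mu> v)"
  "vH \<mu> (vF v) = vF (vH \<mu> v) - pscale 2 (vF v)"
proof -
  note s = v_clinear[THEN clinear_scale] v_clinear[THEN clinear_zero]
  show "vE \<mu> (vF v) = vF (vE \<mu> v) + vH \<mu> v"
  proof (rule clinear_eqI[OF clinear_compose[OF v_clinear(2) v_clinear(1)]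
        clinear_plus[OF clinear_compose[OF v_clinear(1) v_clinear(2)] v_clinear(3)]])
    fix k show "vE \<mu> (vF (basis_vec k)) = vF (vE \<mu> (basis_vec k)) + vH \<mu> (basis_vec k)"
      by (cases k) (simp_all add: s ring_distribs flip: pm.scale_left_distrib)
  qed
  show "vH \<mu> (vE \<mu> v) = vE \<mu> (vH \<mu> v) + pscale 2 (vE \<mu> v)"
  proof (rule clinear_eqI[OF clinear_compose[OF v_clinear(1) v_clinear(3)]
        clinear_plus[OF clinear_compose[OF v_clinear(3) v_clinear(1)] clinear_smult[OF v_clinear(1)]]])
    fix k show "vH \<mu> (vE \<mu> (basis_vec k)) = vE \<mu> (vH \<mu> (basis_vec k)) + pscale 2 (vE \<mu> (basis_vec k))"
      by (cases k) (simp_all add: s ring_distribs flip: pm.scale_left_distrib)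
  qed
  show "vH \<mu> (vF v) = vF (vH \<mu> v) - pscale 2 (vF v)"
  proof (rule clinear_eqI[OF clinear_compose[OF v_clinear(2) v_clinear(3)]
        clinear_minus[OF clinear_compose[OF v_clinear(3) v_clinear(2)] clinear_smult[OF v_clinear(2)]]])
    fix k show "vH \<mu> (vF (basis_vec k)) = vF (vH \<mu> (basis_vec k)) - pscale 2 (vF (basis_vec k))"
      by (simp add: s ring_distribs flip: pm.scale_left_diff_distrib)
  qed
qed

context frame
begin

abbreviation "vact \<mu> \<equiv> opact pscale (vE \<mu>) vF (vH \<mu>)"

lemma vact_rep: "lie_rep pscale sl2 (vact \<mu>)"
proof (rule opact_rep)
  show "vE \<mu> (vF v) = vF (vE \<mu> v) + vH \<mu> v" "vH \<mu> (vE \<mu> v) = vE \<mu> (vH \<mu> v) + pscale 2 (vE \<mu> v)"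
    "vH \<mu> (vF v) = vF (vH \<mu> v) - pscale 2 (vF v)" for v
    by (fact v_rel)+
qed (fact v_clinear pm.vector_space_axioms)+

section \<open>Identification of the Verma module\<close>

abbreviation "vw \<mu> \<equiv> lie_rep.wact pscale (vact \<mu>)"

abbreviation fpow :: "nat \<Rightarrow> cmat list \<Rightarrow>\<^sub>0 complex" where
  "fpow k \<equiv> basis_vec (replicate k \<f>)"

lemma triple_sl2: "\<e> \<in> sl2" "\<f> \<in> sl2" "\<h> \<in> sl2"
  by simp_all

lemma lie_triple: "lie \<h> \<f> = mscale (-2) \<f>" "lie \<h> \<e> = mscale 2 \<e>" "lie \<e> \<f> = \<h>"
  by (simp_all add: lie_cj flip: cj_mscale)

lemma uea_lie: "lie_subalgebra L \<Longrightarrow> x \<in> L \<Longrightarrow> y \<in> L \<Longrightarrow>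
    basis_vec [x, y] - basis_vec [y, x] - basis_vec [lie x y] \<in> uea_ideal L"
  and uea_add: "lie_subalgebra L \<Longrightarrow> x \<in> L \<Longrightarrow> y \<in> L \<Longrightarrow>
    basis_vec [x + y] - basis_vec [x] - basis_vec [y] \<in> uea_ideal L"
  and uea_mscale: "lie_subalgebra L \<Longrightarrow> x \<in> L \<Longrightarrow>
    basis_vec [mscale c x] - pscale c (basis_vec [x]) \<in> uea_ideal L"
  by (rule subsetD[OF uea_ideal_relations], assumption, unfold uea_relations_def, blast)+

lemma uea_expand:
  assumes "x \<in> sl2"
  shows "basis_vec [x] - (pscale (ca x) (basis_vec [\<h>]) + pscale (cb x) (basis_vec [\<e>])
     + pscale (cc x) (basis_vec [\<f>])) \<in> uea_ideal sl2"
proof -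
  note L = lie_subalgebra_sl2
  have c: "mscale k y \<in> sl2" if "y \<in> sl2" for k y
    using L that by (auto simp: lie_subalgebra_def mat_vs.subspace_def)
  have d: "y + z \<in> sl2" if "y \<in> sl2" "z \<in> sl2" for y z
    using L that by (auto simp: lie_subalgebra_def mat_vs.subspace_def)
  let ?H = "mscale (ca x) \<h>" and ?E = "mscale (cb x) \<e>" and ?F = "mscale (cc x) \<f>"
  have in_sl2: "?H \<in> sl2" "?E \<in> sl2" "?F \<in> sl2" "?H + ?E \<in> sl2"
    by (intro c d triple_sl2)+
  have "(basis_vec [(?H + ?E) + ?F] - basis_vec [?H + ?E] - basis_vec [?F])
      + (basis_vec [?H + ?E] - basis_vec [?H] - basis_vec [?E])
      + (basis_vec [?H] - pscale (ca x) (basis_vec [\<h>])) + (basis_vec [?E] - pscale (cb x) (basis_vec [\<e>]))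
      + (basis_vec [?F] - pscale (cc x) (basis_vec [\<f>])) \<in> uea_ideal sl2"
    by (intro uea_ideal_add uea_add uea_mscale L in_sl2 triple_sl2)
  then show ?thesis
    by (subst (1) sl2_expand[OF assms]) (simp add: algebra_simps)
qed

text \<open>The spanning half of the Poincare-Birkhoff-Witt theorem for the quotient by a left ideal: modulo the commutator
  relations, \<open>e\<close> and \<open>h - \<mu>\<close>, every word is congruent to a combination of powers of \<open>f\<close>. The combination is
  read off from the action on the highest weight vector. The
  independence of the powers of \<open>f\<close> is supplied by the concrete Verma module.\<close>

lemma left_ideal_reduction:
  assumes J0: "0 \<in> J" and Jadd: "\<And>p q. p \<in> J \<Longrightarrow> q \<in> J \<Longrightarrow> p + q \<in> J"
    and Jscale: "\<And>c p. p \<in> J \<Longrightarrow> pscale c p \<in> J"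
    and Jleft: "\<And>x p. x \<in> sl2 \<Longrightarrow> p \<in> J \<Longrightarrow> fm (basis_vec [x]) p \<in> J"
    and JI: "uea_ideal sl2 \<subseteq> J"
    and Je: "basis_vec [\<e>] \<in> J" and Jh: "basis_vec [\<h>] - pscale \<mu> (basis_vec []) \<in> J"
    and p: "p \<in> words sl2"
  shows "p - pextend fpow (vw \<mu> p (basis_vec 0)) \<in> J"
proof -
  interpret V: lie_rep pscale sl2 "vact \<mu>" by (rule vact_rep)
  note L = lie_subalgebra_sl2
  have fw: "fpow k \<in> words sl2" for k by (auto simp: triple_sl2)
  have Ifm: "fm r (fpow k) \<in> J" if "r \<in> uea_ideal sl2" for r k
    using JI uea_ideal_fm_right[OF L that fw] by blast
  have hk: "basis_vec (\<h> # replicate k \<f>) - pscale (\<mu> - 2 * of_nat k) (fpow k) \<in> J" for k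
  proof (induction k)
    case 0 then show ?case using Jh by simp
  next
    case (Suc k)
    have "fm (basis_vec [\<h>, \<f>] - basis_vec [\<f>, \<h>] - basis_vec [lie \<h> \<f>]) (fpow k)
      + fm (basis_vec [mscale (-2) \<f>] - pscale (-2) (basis_vec [\<f>])) (fpow k)
      + fm (basis_vec [\<f>]) (basis_vec (\<h> # replicate k \<f>) - pscale (\<mu> - 2 * of_nat k) (fpow k)) \<in> J"
      by (intro Jadd Ifm uea_lie uea_mscale L triple_sl2 Jleft Suc)
    then show ?case by (simp add: fm_linear_simps lie_triple algebra_simps)
  qed
  have ek: "basis_vec (\<e> # replicate k \<f>) - pscale (of_nat k * (\<mu> - of_nat k + 1)) (fpow (k - 1)) \<in> J" for k
  proof (induction k)
    case 0 then show ?case using Je by simp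
  next
    case (Suc k)
    have a: "fm (basis_vec [\<f>]) (pscale (of_nat k * (\<mu> - of_nat k + 1)) (fpow (k - 1)))
        = pscale (of_nat k * (\<mu> - of_nat k + 1)) (fpow k)"
      by (cases k) (simp_all add: fm_linear_simps)
    have "fm (basis_vec [\<e>, \<f>] - basis_vec [\<f>, \<e>] - basis_vec [lie \<e> \<f>]) (fpow k)
      + fm (basis_vec [\<f>]) (basis_vec (\<e> # replicate k \<f>) - pscale (of_nat k * (\<mu> - of_nat k + 1)) (fpow (k - 1)))
      + (basis_vec (\<h> # replicate k \<f>) - pscale (\<mu> - 2 * of_nat k) (fpow k)) \<in> J"
      by (intro Jadd Ifm uea_lie L triple_sl2 Jleft Suc hk)
    then have "basis_vec (\<e> # \<f> # replicate k \<f>) -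
       pscale (of_nat k * (\<mu> - of_nat k + 1) + (\<mu> - 2 * of_nat k)) (fpow k) \<in> J"
      unfolding clinear_diff[OF fm_clinear_right] a
      by (simp add: fm_linear_simps lie_triple pm.scale_left_distrib diff_diff_eq)
    moreover have "of_nat k * (\<mu> - of_nat k + 1) + (\<mu> - 2 * of_nat k) = of_nat (Suc k) * (\<mu> - of_nat (Suc k) + 1)"
      by (simp add: algebra_simps)
    ultimately show ?case by simp
  qed
  have xk: "basis_vec (x # replicate k \<f>) - pextend fpow (vact \<mu> x (basis_vec k)) \<in> J" if "x \<in> sl2" for x k
  proof -
    have "fm (basis_vec [x] - (pscale (ca x) (basis_vec [\<h>]) + pscale (cb x) (basis_vec [\<e>])
     + pscale (cc x) (basis_vec [\<f>]))) (fpow k)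
     + pscale (ca x) (basis_vec (\<h> # replicate k \<f>) - pscale (\<mu> - 2 * of_nat k) (fpow k))
     + pscale (cb x) (basis_vec (\<e> # replicate k \<f>) - pscale (of_nat k * (\<mu> - of_nat k + 1)) (fpow (k - 1))) \<in> J"
      by (intro Jadd Ifm uea_expand that Jscale hk ek)
    then show ?thesis
      by (simp add: fm_linear_simps opact_def pextend_add pextend_diff pextend_scale pm.scale_right_diff_distrib algebra_simps)
  qed
  have xq: "fm (basis_vec [x]) (pextend fpow q) - pextend fpow (vact \<mu> x q) \<in> J" if "x \<in> sl2" for x q
    by (rule clinear_closed_span[OF clinear_minus[OF clinear_compose[OF pextend_clinear fm_clinear_right]
      clinear_compose[OF V.act_clinear[OF that] pextend_clinear]]])
      (use J0 Jadd Jscale xk[OF that] in auto)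
  have w: "basis_vec w - pextend fpow (foldr (vact \<mu>) w (basis_vec 0)) \<in> J" if "w \<in> lists sl2" for w
    using that
  proof (induction w)
    case (Cons x w)
    let ?q = "foldr (vact \<mu>) w (basis_vec 0)"
    have "fm (basis_vec [x]) (basis_vec w - pextend fpow ?q)
      + (fm (basis_vec [x]) (pextend fpow ?q) - pextend fpow (vact \<mu> x ?q)) \<in> J"
      using Cons by (intro Jadd Jleft xq) auto
    then show ?case by (simp add: fm_linear_simps)
  qed (use J0 in simp)
  have w': "basis_vec k - pextend fpow (foldr (vact \<mu>) k (basis_vec 0)) \<in> J" if "k \<in> keys p" for k
    using p that by (intro w) blast
  show ?thesis
    by (rule clinear_closed_span[OF clinear_minus[OF pm_id_clinear clinear_compose[OF V.wact_clinear_left pextend_clinear]]])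
      (simp_all add: J0 Jadd Jscale w')
qed

lemma sub_bb: "bset \<subseteq> sl2" "lie_subalgebra bset"
  using solvable_upper[OF frame_axioms] by auto

text \<open>The extension of a weight to the Borel subalgebra vanishes on commutators, so it is a one-dimensional representation.\<close>

lemma borel_rep:
  "lie_model (*) bset (\<lambda>x z. borel_char hset bset \<mu> x * z)
     (one_dim_module (borel_char hset bset \<mu>)) id"
proof (rule one_dim_model[OF sub_bb(2)])
  fix x y and c :: complex assume x: "x \<in> bset" "y \<in> bset"
  then have "x + y \<in> bset" "mscale c x \<in> bset" "lie x y \<in> bset"
    using sub_bb(2) by (auto simp only: lie_subalgebra_def mat_vs.subspace_def)
  moreover have "ca (lie x y) = 0" using x by (auto simp: bb_def lie_cj)
  ultimately show "borel_char hset bset \<mu> (x + y) =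
      borel_char hset bset \<mu> x + borel_char hset bset \<mu> y"
    "borel_char hset bset \<mu> (mscale c x) = c * borel_char hset bset \<mu> x"
    "borel_char hset bset \<mu> (lie x y) = 0"
    using x by (simp_all only: borel_char_eq coords_add coords_mscale) (simp_all add: algebra_simps)
qed

lemma uea_ideal_mono:
  assumes "lie_subalgebra L" "lie_subalgebra M" "L \<subseteq> M"
  shows "uea_ideal L \<subseteq> uea_ideal M"
proof -
  have LM: "words L \<subseteq> words M" using lists_mono[OF assms(3)] by auto
  have "ideal (uea_ideal M \<inter> words L) (free_algebra L)"
  proof (rule ideal_free_algebraI)
    fix p q assume "p \<in> uea_ideal M \<inter> words L" "q \<in> words L"
    then show "fm q p \<in> uea_ideal M \<inter> words L" "fm p q \<in> uea_ideal M \<inter> words L"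
      using subsetD[OF LM, of q] uea_ideal_fm_left[OF assms(2), of p q] uea_ideal_fm_right[OF assms(2), of p q]
        words_fm[of p L q] words_fm[of q L p] by auto
  next
    fix p q assume "p \<in> uea_ideal M \<inter> words L" "q \<in> uea_ideal M \<inter> words L"
    then show "p + q \<in> uea_ideal M \<inter> words L" 
      using uea_ideal_add[OF assms(2), of p q] words_add[of p L q] by simp
  qed (use uea_ideal_zero[OF assms(2)] in auto)
  moreover have "uea_relations L \<subseteq> uea_relations M"
    unfolding uea_relations_def using assms(3) by (intro Un_mono) blast+
  then have "uea_relations L \<subseteq> uea_ideal M \<inter> words L"
    using uea_relations_subset[OF assms(1)] uea_ideal_relations[OF assms(2)] by blast
  ultimately show ?thesis
    unfolding uea_ideal_def[of L] using ring.genideal_minimal[OF ring_free_algebra] by blast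
qed

lemma uea_map_cls:
  assumes "lie_subalgebra L" "lie_subalgebra M" "L \<subseteq> M"
  shows "uea_map M (cls L p) = cls M p"
  unfolding uea_map_def coset_eq_cls
proof (rule SUP_eq_const)
  show "cls L p \<noteq> {}" using cls_self[OF assms(1)] by blast
  show "cls M q = cls M p" if "q \<in> cls L p" for q
    using that uea_ideal_mono[OF assms] unfolding cls_eq_iff[OF assms(2)] by (auto simp: cls_def)
qed

lemma vact_highest:
  assumes "x \<in> bset"
  shows "vact \<mu> x (basis_vec 0) = pscale (borel_char hset bset \<mu> x) (basis_vec 0)"
  unfolding borel_char_eq[OF assms] using assms by (auto simp: opact_def bb_def mult.commute)

text \<open>The relations of the balanced tensor product are killed by letting the enveloping algebra act on the concrete
  highest weight vector. Conversely the set \<open>J\<close> of words \<open>p\<close> for which \<open>p \<otimes> 1\<close> is a relation satisfies the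
  assumptions of \<open>left_ideal_reduction\<close>, which makes every generator congruent to a combination of powers of \<open>f\<close>.\<close>

theorem verma_model:
  "\<exists>\<phi>. lie_model pscale sl2 (vact \<mu>) (verma hset bset \<mu>) \<phi>"
proof -
  define Bs where "Bs = bset"
  define \<beta> where "\<beta> = borel_char hset Bs \<mu>"
  define C where "C = one_dim_module \<beta>"
  define U where "U = UEA sl2"
  define B0 where "B0 = carrier U \<times> carrier C"
  define a where "a = (\<lambda>x (u, z). basis_vec (uea_gen sl2 x \<otimes>\<^bsub>U\<^esub> u, z) :: uea \<times> complex \<Rightarrow>\<^sub>0 complex)"
  define R where "R = bilinear_relations U C \<union>
     balancing_relations (carrier (UEA Bs)) U C (\<lambda>u a. u \<otimes>\<^bsub>U\<^esub> uea_map sl2 a) (uea_act C)"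
  define N where "N = submodule_span (free_module B0 a) R"
  interpret V: lie_rep pscale sl2 "vact \<mu>" by (rule vact_rep)
  interpret B: lie_model "(*)" Bs "\<lambda>x z. \<beta> x * z" C id
    unfolding \<beta>_def C_def Bs_def by (rule borel_rep)
  note L = lie_subalgebra_sl2
  have BsL: "lie_subalgebra Bs" "Bs \<subseteq> sl2" using sub_bb by (simp_all add: Bs_def)
  have wB: "p \<in> words sl2" if "p \<in> words Bs" for p using that lists_mono[OF BsL(2)] by auto
  have C: "carrier C = UNIV" "x \<oplus>\<^bsub>C\<^esub> y = x + y" "c \<odot>\<^bsub>C\<^esub> y = c * y" for x y c
    by (simp_all add: C_def one_dim_module_def)
  have U: "carrier U = cls sl2 ` words sl2"
    "p \<in> words sl2 \<Longrightarrow> q \<in> words sl2 \<Longrightarrow> cls sl2 p \<otimes>\<^bsub>U\<^esub> cls sl2 q = cls sl2 (fm p q)"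
    "p \<in> words sl2 \<Longrightarrow> q \<in> words sl2 \<Longrightarrow> cls sl2 p \<oplus>\<^bsub>U\<^esub> cls sl2 q = cls sl2 (p + q)"
    "c \<odot>\<^bsub>U\<^esub> cls sl2 p = cls sl2 (pscale c p)" for p q c
    using carrier_uea uea_mult_cls[OF L] uea_add_cls[OF L] uea_smult_cls[OF L] by (simp_all add: U_def)
  have gen: "uea_gen sl2 x \<otimes>\<^bsub>U\<^esub> cls sl2 p = cls sl2 (fm (basis_vec [x]) p)" if "x \<in> sl2" "p \<in> words sl2" for x p
    unfolding uea_gen_eq_cls by (rule U(2)) (use that in simp_all)
  have wx: "fm (basis_vec [x]) p \<in> words sl2" if "x \<in> sl2" "p \<in> words sl2" for x p
    by (rule words_fm) (use that in simp_all)
    have act: "uea_act C (cls Bs q) z = B.wact q z" if "q \<in> words Bs" for q z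
      using B.uea_act(2)[OF that, of z] by (simp add: C)
    have ract: "cls sl2 p \<otimes>\<^bsub>U\<^esub> uea_map sl2 (cls Bs q) = cls sl2 (fm p q)"
      if "p \<in> words sl2" "q \<in> words Bs" for p q
      unfolding uea_map_cls[OF BsL(1) L BsL(2)] by (rule U(2)[OF that(1) wB[OF that(2)]])
  have R_cases: "P r" if r: "r \<in> R"
    and 1: "\<And>p q z. p \<in> words sl2 \<Longrightarrow> q \<in> words sl2 \<Longrightarrow>
      P (basis_vec (cls sl2 (p + q), z) - basis_vec (cls sl2 p, z) - basis_vec (cls sl2 q, z))"
    and 2: "\<And>p y z. p \<in> words sl2 \<Longrightarrow>
      P (basis_vec (cls sl2 p, y + z) - basis_vec (cls sl2 p, y) - basis_vec (cls sl2 p, z))"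
    and 3: "\<And>p c z. p \<in> words sl2 \<Longrightarrow>
      P (basis_vec (cls sl2 (pscale c p), z) - pscale c (basis_vec (cls sl2 p, z)))"
    and 4: "\<And>p c z. p \<in> words sl2 \<Longrightarrow>
      P (basis_vec (cls sl2 p, c * z) - pscale c (basis_vec (cls sl2 p, z)))"
    and 5: "\<And>p q z. p \<in> words sl2 \<Longrightarrow> q \<in> words Bs \<Longrightarrow>
      P (basis_vec (cls sl2 (fm p q), z) - basis_vec (cls sl2 p, B.wact q z))" for r P
    using r unfolding R_def bilinear_relations_def balancing_relations_def U(1) carrier_uea
  proof (elim UnE CollectE exE conjE imageE, goal_cases)
    case (1 x x' y p q) then show ?case using that(2)[of p q y] by (simp add: U)
  next
    case (2 x y y' p) then show ?case using that(3)[of p y y'] by (simp add: C)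
  next
    case (3 c x y p) then show ?case using that(4)[of p c y] by (simp add: U)
  next
    case (4 c x y p) then show ?case using that(5)[of p c y] by (simp add: C)
  next
    case (5 x b y p q) then show ?case using that(6)[of p q y] by (simp add: act ract)
  qed
  have zC: "z \<in> carrier C" for z by (simp add: C(1))
  have R_intros:
    "p \<in> words sl2 \<Longrightarrow> q \<in> words sl2 \<Longrightarrow>
      basis_vec (cls sl2 (p + q), z) - basis_vec (cls sl2 p, z) - basis_vec (cls sl2 q, z) \<in> R"
    "p \<in> words sl2 \<Longrightarrow>
      basis_vec (cls sl2 p, y + z) - basis_vec (cls sl2 p, y) - basis_vec (cls sl2 p, z) \<in> R"
    "p \<in> words sl2 \<Longrightarrow> basis_vec (cls sl2 (pscale c p), z) - pscale c (basis_vec (cls sl2 p, z)) \<in> R"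
    "p \<in> words sl2 \<Longrightarrow> basis_vec (cls sl2 p, c * z) - pscale c (basis_vec (cls sl2 p, z)) \<in> R"
    "p \<in> words sl2 \<Longrightarrow> q' \<in> words Bs \<Longrightarrow>
      basis_vec (cls sl2 (fm p q'), z) - basis_vec (cls sl2 p, B.wact q' z) \<in> R" for p q q' y z c
  proof goal_cases
    case 1
    then have "cls sl2 p \<in> carrier U" "cls sl2 q \<in> carrier U" by (auto simp: U(1))
    then show ?case unfolding R_def bilinear_relations_def U(3)[OF 1, symmetric] using zC by blast
  next
    case 2
    then have "cls sl2 p \<in> carrier U" by (auto simp: U(1))
    then show ?case unfolding R_def bilinear_relations_def C(2)[symmetric] using zC by blast
  next
    case 3
    then have "cls sl2 p \<in> carrier U" by (auto simp: U(1))
    then show ?case unfolding R_def bilinear_relations_def U(4)[symmetric] using zC by blast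
  next
    case 4
    then have "cls sl2 p \<in> carrier U" by (auto simp: U(1))
    then show ?case unfolding R_def bilinear_relations_def C(3)[symmetric] using zC by blast
  next
    case 5
    have "basis_vec (cls sl2 p \<otimes>\<^bsub>U\<^esub> uea_map sl2 (cls Bs q'), z) - basis_vec (cls sl2 p, uea_act C (cls Bs q') z)
        \<in> balancing_relations (carrier (UEA Bs)) U C (\<lambda>u a. u \<otimes>\<^bsub>U\<^esub> uea_map sl2 a) (uea_act C)"
      unfolding balancing_relations_def using 5 by (auto simp: C(1) U(1) carrier_uea)
    then show ?case using 5 by (simp add: act ract R_def)
  qed
  have B0: "B0 = cls sl2 ` words sl2 \<times> UNIV" by (simp add: B0_def U(1) C(1))
  have bB0: "p \<in> words sl2 \<Longrightarrow> basis_vec (cls sl2 p, z) \<in> {r. keys r \<subseteq> B0}" for p z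
    by (auto simp: B0)
  define M where "M = {r :: uea \<times> complex \<Rightarrow>\<^sub>0 complex. keys r \<subseteq> B0}"
  have M_add: "p + q \<in> M" if "p \<in> M" "q \<in> M" for p q using that by (simp add: M_def keys_subset_add)
  have M_scale: "pscale c p \<in> M" if "p \<in> M" for p c
    using that by (simp add: M_def subset_trans[OF keys_pscale_subset])
  have M_diff: "p - q \<in> M" if "p \<in> M" "q \<in> M" for p q using that by (simp add: M_def keys_subset_diff)
  have M_basis: "basis_vec (cls sl2 p, z) \<in> M" if "p \<in> words sl2" for p z
    using bB0[OF that] by (simp add: M_def)
  have RM: "R \<subseteq> M"
  proof
    fix r assume "r \<in> R"
    then show "r \<in> M"
      by (rule R_cases) (intro M_diff M_scale M_basis words_add words_pscale words_fm; (assumption | rule wB, assumption))+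
  qed
  note span = submodule_span_superset[OF RM[unfolded M_def], of a, folded N_def]
    submodule_span_zero[OF RM[unfolded M_def], of a, folded N_def]
    submodule_span_add[OF RM[unfolded M_def], of _ a, folded N_def]
    submodule_span_pscale[OF RM[unfolded M_def], of _ a, folded N_def]
    submodule_span_carrier[OF RM[unfolded M_def], of a, folded N_def M_def]
  have N_diff: "p - q \<in> N" if "p \<in> N" "q \<in> N" for p q
    using span(3)[OF that(1) span(4)[OF that(2), of "-1"]] by (simp add: pm.scale_minus_left)
  note RN = R_intros[THEN subsetD[OF span(1)]]
  let ?T = "\<lambda>p. basis_vec (cls sl2 p, 1 :: complex)"
  \<comment> \<open>The span of the relations is defined as a subspace; that the Lie algebra preserves it has to be shown.\<close>
  have Lx: "pextend (a x) n \<in> N" if x: "x \<in> sl2" and n: "n \<in> N" for x n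
  proof -
    have ab: "a x (cls sl2 p, z) = basis_vec (cls sl2 (fm (basis_vec [x]) p), z)" if "p \<in> words sl2" for p z
      by (simp add: a_def gen[OF x that])
    have "N \<subseteq> {n \<in> M. pextend (a x) n \<in> N}"
      unfolding N_def
    proof (rule submodule_span_minimal, fold N_def)
      fix r assume r: "r \<in> R"
      from r have "pextend (a x) r \<in> N"
      proof (rule R_cases)
        fix p q z assume "p \<in> words sl2" "q \<in> words sl2"
        then show "pextend (a x) (basis_vec (cls sl2 (p + q), z) - basis_vec (cls sl2 p, z) - basis_vec (cls sl2 q, z)) \<in> N"
          using RN(1)[OF wx[OF x] wx[OF x], of p q z] words_add[of p sl2 q]
          by (simp add: pextend_diff ab fm_linear_simps)
      next
        fix p y z assume "p \<in> words sl2"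
        then show "pextend (a x) (basis_vec (cls sl2 p, y + z) - basis_vec (cls sl2 p, y) - basis_vec (cls sl2 p, z)) \<in> N"
          using RN(2)[OF wx[OF x], of p y z] by (simp add: pextend_diff ab)
      next
        fix p c z assume "p \<in> words sl2"
        then show "pextend (a x) (basis_vec (cls sl2 (pscale c p), z) - pscale c (basis_vec (cls sl2 p, z))) \<in> N"
          using RN(3)[OF wx[OF x], of p c z] words_pscale[of p sl2 c]
          by (simp add: pextend_diff pextend_scale ab fm_linear_simps)
      next
        fix p c z assume "p \<in> words sl2"
        then show "pextend (a x) (basis_vec (cls sl2 p, c * z) - pscale c (basis_vec (cls sl2 p, z))) \<in> N"
          using RN(4)[OF wx[OF x], of p c z] by (simp add: pextend_diff pextend_scale ab)
      next
        fix p q z assume "p \<in> words sl2" "q \<in> words Bs"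
        then show "pextend (a x) (basis_vec (cls sl2 (fm p q), z) - basis_vec (cls sl2 p, B.wact q z)) \<in> N"
          using RN(5)[OF wx[OF x], of p q z] words_fm[of p sl2 q] wB[of q]
          by (simp add: pextend_diff ab fm_assoc)
      qed
      then show "r \<in> {n \<in> M. pextend (a x) n \<in> N}" using r RM by blast
    next
      show "{n \<in> M. pextend (a x) n \<in> N} \<subseteq> {p. keys p \<subseteq> B0}" by (auto simp: M_def)
    qed (use span M_add M_scale in \<open>auto simp: pextend_add pextend_scale pextend_zero M_def\<close>)
    then show ?thesis using n by blast
  qed
  have T_eq: "?T p = ?T q" if "p - q \<in> uea_ideal sl2" for p q
    using that unfolding cls_eq_iff[OF L, symmetric] by simp
  define J where "J = {p \<in> words sl2. ?T p \<in> N}"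
  have T_add: "?T (p + q) - ?T p - ?T q \<in> N" if "p \<in> words sl2" "q \<in> words sl2" for p q
    by (rule RN(1)[OF that])
  have T_scale: "?T (pscale c p) - pscale c (?T p) \<in> N" if "p \<in> words sl2" for p c
    by (rule RN(3)[OF that])
  have bal: "?T (basis_vec [x]) - pscale (\<beta> x) (?T (basis_vec [])) \<in> N" if x: "x \<in> Bs" for x
  proof -
    have "basis_vec [x] \<in> words Bs" using x by simp
    from RN(5)[OF _ this, of "basis_vec []" 1]
    have "?T (basis_vec [x]) - basis_vec (cls sl2 (basis_vec []), \<beta> x) \<in> N" by simp
    from span(3)[OF this RN(4)[of "basis_vec []" "\<beta> x" 1]]
    show ?thesis by simp
  qed
  have T0: "?T 0 \<in> N" using T_scale[of 0 0] by simp
  have red: "p - pextend fpow (vw \<mu> p (basis_vec 0)) \<in> J" if p: "p \<in> words sl2" for p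
  proof (rule left_ideal_reduction[OF _ _ _ _ _ _ _ p])
    show "0 \<in> J" using T0 by (simp add: J_def)
    show "p + q \<in> J" if "p \<in> J" "q \<in> J" for p q
      using that span(3)[OF span(3)[OF T_add[of p q], of "?T p"], of "?T q"] words_add[of p sl2 q] by (simp add: J_def)
    show "pscale c p \<in> J" if "p \<in> J" for c p
      using that span(3)[OF T_scale[of p c] span(4)[of "?T p" c]] words_pscale[of p sl2 c] by (simp add: J_def)
    show "fm (basis_vec [x]) p \<in> J" if "x \<in> sl2" "p \<in> J" for x p
      using that Lx[of x "?T p"] wx[of x p] by (simp add: J_def a_def gen)
    show "uea_ideal sl2 \<subseteq> J"
    proof
      fix p assume "p \<in> uea_ideal sl2"
      then show "p \<in> J" using uea_ideal_words[OF L, of p] T_eq[of p 0] T0 by (simp add: J_def)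
    qed
    have eB: "\<e> \<in> Bs" "\<h> \<in> Bs"
      unfolding Bs_def bb_def by (auto intro: range_eqI[of _ _ "(0,1)"] range_eqI[of _ _ "(1,0)"])
    have \<beta>: "\<beta> \<e> = 0" "\<beta> \<h> = \<mu>"
      using eB by (simp_all add: \<beta>_def Bs_def borel_char_eq)
    show "basis_vec [\<e>] \<in> J" using bal[OF eB(1)] \<beta>(1) by (simp add: J_def)
    have "?T (basis_vec [\<h>] + pscale (- \<mu>) (basis_vec [])) - ?T (basis_vec [\<h>]) - ?T (pscale (- \<mu>) (basis_vec []))
        + (?T (basis_vec [\<h>]) - pscale (\<beta> \<h>) (?T (basis_vec [])))
        + (?T (pscale (- \<mu>) (basis_vec [])) - pscale (- \<mu>) (?T (basis_vec []))) \<in> N"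
      by (intro span(3) T_add bal eB T_scale words_pscale) simp_all
    moreover have "basis_vec [\<h>] - pscale \<mu> (basis_vec []) \<in> words sl2"
      by (intro words_diff words_pscale) simp_all
    ultimately show "basis_vec [\<h>] - pscale \<mu> (basis_vec []) \<in> J"
      by (simp add: J_def \<beta>)
  qed
  define \<sigma> :: "(nat \<Rightarrow>\<^sub>0 complex) \<Rightarrow> (uea \<times> complex \<Rightarrow>\<^sub>0 complex)" where
    "\<sigma> = pextend (\<lambda>k. ?T (fpow k))"
  have \<sigma>: "clinear pscale pscale \<sigma>" unfolding \<sigma>_def by (rule pextend_clinear)
  have fw: "fpow k \<in> words sl2" for k by (auto simp: triple_sl2)
  have \<tau>w: "pextend fpow c \<in> words sl2" for c
    unfolding mem_Collect_eq by (rule keys_pextend) (use fw in simp)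
  have T\<tau>: "?T (pextend fpow c) - \<sigma> c \<in> N" for c
  proof -
    have "c \<in> {c. ?T (pextend fpow c) - \<sigma> c \<in> N}"
    proof (rule clinear_closed_span[OF pm_id_clinear])
      fix c d assume "c \<in> {c. ?T (pextend fpow c) - \<sigma> c \<in> N}" "d \<in> {c. ?T (pextend fpow c) - \<sigma> c \<in> N}"
      then have "?T (pextend fpow c + pextend fpow d) - ?T (pextend fpow c) - ?T (pextend fpow d)
        + (?T (pextend fpow c) - \<sigma> c) + (?T (pextend fpow d) - \<sigma> d) \<in> N"
        by (intro span(3) T_add \<tau>w) simp_all
      then show "c + d \<in> {c. ?T (pextend fpow c) - \<sigma> c \<in> N}"
        by (simp add: clinear_add[OF \<sigma>] pextend_add algebra_simps)
    next
      fix k c assume "c \<in> {c. ?T (pextend fpow c) - \<sigma> c \<in> N}"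
      then have "?T (pscale k (pextend fpow c)) - pscale k (?T (pextend fpow c))
        + pscale k (?T (pextend fpow c) - \<sigma> c) \<in> N"
        by (intro span(3) span(4) T_scale \<tau>w) simp_all
      then show "pscale k c \<in> {c. ?T (pextend fpow c) - \<sigma> c \<in> N}"
        by (simp add: clinear_scale[OF \<sigma>] pextend_scale pm.scale_right_diff_distrib)
    next
      show "0 \<in> {c. ?T (pextend fpow c) - \<sigma> c \<in> N}"
        using T0 by (simp add: clinear_zero[OF \<sigma>] pextend_zero)
    next
      fix k show "basis_vec k \<in> {c. ?T (pextend fpow c) - \<sigma> c \<in> N}"
        by (simp add: \<sigma>_def span(2))
    qed
    then show ?thesis by simp
  qed
  define ua where "ua u = vw \<mu> (SOME p. p \<in> words sl2 \<and> u = cls sl2 p) (basis_vec 0)" for u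
  have ua: "ua (cls sl2 p) = vw \<mu> p (basis_vec 0)" if "p \<in> words sl2" for p
  proof -
    have "(SOME q. q \<in> words sl2 \<and> cls sl2 p = cls sl2 q) \<in> cls sl2 p"
      by (rule someI2[of _ p]) (use that cls_self[OF L] in auto)
    then show ?thesis unfolding ua_def by (rule V.wact_cls)
  qed
  define \<Phi> where "\<Phi> = (\<lambda>(u, z). pscale z (ua u))"
  have \<Phi>: "\<Phi> (cls sl2 p, z) = pscale z (vw \<mu> p (basis_vec 0))" if "p \<in> words sl2" for p z
    by (simp add: \<Phi>_def ua[OF that])
  have wB_act: "pscale y (vw \<mu> q (basis_vec 0)) = pscale (B.wact q y) (basis_vec 0)" if q: "q \<in> words Bs" for q y
  proof (rule clinear_eqI[where f = "\<lambda>q. pscale y (vw \<mu> q (basis_vec 0))"])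
    show "clinear pscale pscale (\<lambda>q. pscale y (vw \<mu> q (basis_vec 0)))"
      by (rule clinear_smult[OF V.wact_clinear_left])
    show "clinear pscale pscale (\<lambda>q. pscale (B.wact q y) (basis_vec 0))"
      by (rule clinearI) (simp_all add: B.wact_linear pm.scale_left_distrib pm.vector_space_axioms)
    fix w assume "w \<in> keys q"
    then have "w \<in> lists Bs" using q by auto
    then show "pscale y (vw \<mu> (basis_vec w) (basis_vec 0)) = pscale (B.wact (basis_vec w) y) (basis_vec 0)"
    proof (induction w)
      case (Cons x w)
      let ?v = "foldr (vact \<mu>) w (basis_vec 0)"
      have "pscale y (vact \<mu> x ?v) = vact \<mu> x (pscale y ?v)"
        using Cons.hyps BsL(2) by (simp add: clinear_scale[OF V.act_clinear] subset_iff)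
      also have "\<dots> = pscale (foldr (\<lambda>x z. \<beta> x * z) w y) (vact \<mu> x (basis_vec 0))"
        using Cons BsL(2) by (simp add: clinear_scale[OF V.act_clinear] subset_iff)
      also have "vact \<mu> x (basis_vec 0) = pscale (\<beta> x) (basis_vec 0)"
        unfolding \<beta>_def Bs_def by (rule vact_highest) (use Cons.hyps in \<open>simp add: Bs_def\<close>)
      also have "pscale (foldr (\<lambda>x z. \<beta> x * z) w y) (pscale (\<beta> x) (basis_vec 0)) =
          pscale (B.wact (basis_vec (x # w)) y) (basis_vec 0)"
        unfolding pm.scale_scale B.wact_basis foldr.simps o_apply by (subst mult.commute) (rule refl)
      finally show ?case unfolding V.wact_basis foldr.simps o_apply .
    qed simp
  qed
  have "lie_model pscale sl2 (vact \<mu>) (lie_quot (free_module B0 a) (submodule_span (free_module B0 a) R))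
           (\<lambda>A. the_elem (lin_ext pscale \<Phi> ` A))"
  proof (rule lie_quot_model[OF vact_rep])
    show "R \<subseteq> {p. keys p \<subseteq> B0}" using RM by (simp add: M_def)
    show "lin_ext pscale \<Phi> r = 0" if "r \<in> R" for r
      unfolding pextend_eq_lin_ext[symmetric] using that
    proof (rule R_cases)
      fix p q z assume "p \<in> words sl2" "q \<in> words sl2"
      then show "pextend \<Phi> (basis_vec (cls sl2 (p + q), z) - basis_vec (cls sl2 p, z) - basis_vec (cls sl2 q, z)) = 0"
        using words_add[of p sl2 q] by (simp add: pextend_diff \<Phi> V.wact_linear pm.scale_right_distrib)
    next
      fix p y z assume "p \<in> words sl2"
      then show "pextend \<Phi> (basis_vec (cls sl2 p, y + z) - basis_vec (cls sl2 p, y) - basis_vec (cls sl2 p, z)) = 0"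
        by (simp add: pextend_diff \<Phi> pm.scale_left_distrib)
    next
      fix p c z assume "p \<in> words sl2"
      then show "pextend \<Phi> (basis_vec (cls sl2 (pscale c p), z) - pscale c (basis_vec (cls sl2 p, z))) = 0"
        using words_pscale[of p sl2 c] by (simp add: pextend_diff pextend_scale \<Phi> V.wact_linear mult.commute)
    next
      fix p c z assume "p \<in> words sl2"
      then show "pextend \<Phi> (basis_vec (cls sl2 p, c * z) - pscale c (basis_vec (cls sl2 p, z))) = 0"
        by (simp add: pextend_diff pextend_scale \<Phi>)
    next
      fix p q z assume pq: "p \<in> words sl2" "q \<in> words Bs"
      then have "pscale z (vw \<mu> (fm p q) (basis_vec 0)) = vw \<mu> p (pscale z (vw \<mu> q (basis_vec 0)))"
        using wB[of q] by (simp add: V.wact_fm clinear_scale[OF V.wact_clinear_right])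
      also have "\<dots> = pscale (B.wact q z) (vw \<mu> p (basis_vec 0))"
        using pq wB[of q] by (simp add: wB_act clinear_scale[OF V.wact_clinear_right])
      finally show "pextend \<Phi> (basis_vec (cls sl2 (fm p q), z) - basis_vec (cls sl2 p, B.wact q z)) = 0"
        using pq words_fm[of p sl2 q] wB[of q] by (simp add: pextend_diff \<Phi>)
    qed
  next
    fix x b assume x: "x \<in> sl2" and "b \<in> B0"
    then obtain p z where b: "b = (cls sl2 p, z)" and p: "p \<in> words sl2" by (auto simp: B0)
    show "keys (a x b) \<subseteq> B0"
      using bB0[OF wx[OF x p], of z] by (simp add: b a_def gen[OF x p])
    show "lin_ext pscale \<Phi> (a x b) = vact \<mu> x (\<Phi> b)"
      using x p wx[OF x p]
      by (simp add: b a_def gen pm.vector_space_axioms \<Phi> V.wact_fm clinear_scale[OF V.act_clinear])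
  next
    show "clinear pscale pscale \<sigma>" by (rule \<sigma>)
    show "keys (\<sigma> c) \<subseteq> B0" for c
      unfolding \<sigma>_def by (rule keys_pextend) (use bB0[OF fw] in simp)
    have vF: "(vact \<mu> \<f> ^^ k) (basis_vec 0) = basis_vec k" for k
      by (induction k) (simp_all add: pm.vector_space_axioms del: coords_cj)
    show "lin_ext pscale \<Phi> (\<sigma> c) = c" for c
      unfolding pextend_eq_lin_ext[symmetric]
    proof (rule clinear_eqI[OF clinear_compose[OF \<sigma> pextend_clinear] pm_id_clinear])
      fix k show "pextend \<Phi> (\<sigma> (basis_vec k)) = basis_vec k"
        by (simp add: \<sigma>_def \<Phi>[OF fw] vF)
    qed
  next
    fix b assume "b \<in> B0"
    then obtain p z where b: "b = (cls sl2 p, z)" and p: "p \<in> words sl2" by (auto simp: B0)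
    let ?c = "vw \<mu> p (basis_vec 0)"
    let ?r = "p - pextend fpow ?c"
    have r: "?r \<in> words sl2" "?T ?r \<in> N" using red[OF p] by (simp_all add: J_def)
    have "basis_vec (cls sl2 p, z * 1) - pscale z (?T p)
        + pscale z ((?T (?r + pextend fpow ?c) - ?T ?r - ?T (pextend fpow ?c)) + ?T ?r
           + (?T (pextend fpow ?c) - \<sigma> ?c)) \<in> N"
      by (intro span(3) span(4) RN(4) T_add p r \<tau>w T\<tau>)
    then have "basis_vec (cls sl2 p, z) - \<sigma> (pscale z ?c) \<in> N"
      by (simp add: clinear_scale[OF \<sigma>] pm.scale_right_diff_distrib)
    then show "basis_vec b - \<sigma> (\<Phi> b) \<in> submodule_span (free_module B0 a) R"
      by (simp add: b \<Phi>[OF p] N_def)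
  qed
  moreover have "verma hset Bs \<mu> = lie_quot (free_module B0 a) (submodule_span (free_module B0 a) R)"
    by (simp add: verma_def Let_def C_def U_def B0_def a_def R_def \<beta>_def)
  ultimately show ?thesis unfolding Bs_def by metis
qed

end

section \<open>Tensor products\<close>

definition tens :: "(nat \<Rightarrow>\<^sub>0 complex) \<Rightarrow> (nat \<Rightarrow>\<^sub>0 complex) \<Rightarrow> (nat \<times> nat \<Rightarrow>\<^sub>0 complex)" where
  "tens p q = pextend (\<lambda>i. pextend (\<lambda>j. basis_vec (i, j)) q) p"

lemma tens_clinear_left: "clinear pscale pscale (\<lambda>p. tens p q)"
  unfolding tens_def by (rule pextend_clinear)

lemma tens_clinear_right: "clinear pscale pscale (tens p)"
proof (rule clinearI)
  show "tens p (x + y) = tens p x + tens p y" for x y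
    unfolding tens_def pextend_def[of _ p]
    by (simp add: pextend_add pm.scale_right_distrib sum.distrib)
  show "tens p (pscale c x) = pscale c (tens p x)" for c x
    unfolding tens_def pextend_def[of _ p]
    by (simp add: pextend_scale pm.scale_sum_right mult.commute)
qed unfold_locales

lemma tens_basis [simp]: "tens (basis_vec i) (basis_vec j) = basis_vec (i, j)"
  by (simp add: tens_def)

lemmas tens_linear_simps =
  clinear_add[OF tens_clinear_left] clinear_scale[OF tens_clinear_left] clinear_diff[OF tens_clinear_left]
  clinear_zero[OF tens_clinear_left]
  clinear_add[OF tens_clinear_right] clinear_scale[OF tens_clinear_right] clinear_diff[OF tens_clinear_right]
  clinear_zero[OF tens_clinear_right]

definition tsum :: "((nat \<Rightarrow>\<^sub>0 complex) \<Rightarrow> (nat \<Rightarrow>\<^sub>0 complex)) \<Rightarrow> ((nat \<Rightarrow>\<^sub>0 complex) \<Rightarrow> (nat \<Rightarrow>\<^sub>0 complex)) \<Rightarrow>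
    (nat \<times> nat \<Rightarrow>\<^sub>0 complex) \<Rightarrow> (nat \<times> nat \<Rightarrow>\<^sub>0 complex)" where
  "tsum f g = pextend (\<lambda>(i, j). tens (f (basis_vec i)) (basis_vec j) + tens (basis_vec i) (g (basis_vec j)))"

lemma tsum_clinear: "clinear pscale pscale (tsum f g)"
  unfolding tsum_def by (rule pextend_clinear)

lemma tsum_tens:
  assumes f: "clinear pscale pscale f" and g: "clinear pscale pscale g"
  shows "tsum f g (tens p q) = tens (f p) q + tens p (g q)"
proof -
  have 1: "tsum f g (tens (basis_vec i) q) = tens (f (basis_vec i)) q + tens (basis_vec i) (g q)" for i
    by (rule clinear_eqI[OF clinear_compose[OF tens_clinear_right tsum_clinear]
          clinear_plus[OF tens_clinear_right clinear_compose[OF g tens_clinear_right]]])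
      (simp add: tsum_def)
  show ?thesis
    by (rule clinear_eqI[OF clinear_compose[OF tens_clinear_left tsum_clinear]
          clinear_plus[OF clinear_compose[OF f tens_clinear_left] tens_clinear_left]]) (rule 1)
qed

lemma clinear_tens_eqI:
  assumes "clinear pscale pscale f" "clinear pscale pscale g" "\<And>p q. f (tens p q) = g (tens p q)"
  shows "f v = g v"
  by (rule clinear_eqI[OF assms(1,2)]) (metis assms(3) surj_pair tens_basis)

definition "tE \<mu> \<nu> = tsum (vE \<mu>) (vE \<nu>)"
definition "tF = tsum vF vF"
definition "tH \<mu> \<nu> = tsum (vH \<mu>) (vH \<nu>)"

lemma t_clinear: "clinear pscale pscale (tE \<mu> \<nu>)" "clinear pscale pscale tF" "clinear pscale pscale (tH \<mu> \<nu>)"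
  by (simp_all add: tE_def tF_def tH_def tsum_clinear)

lemma t_tens:
  "tE \<mu> \<nu> (tens p q) = tens (vE \<mu> p) q + tens p (vE \<nu> q)"
  "tF (tens p q) = tens (vF p) q + tens p (vF q)"
  "tH \<mu> \<nu> (tens p q) = tens (vH \<mu> p) q + tens p (vH \<nu> q)"
  by (simp_all add: tE_def tF_def tH_def tsum_tens v_clinear)

lemmas t_add = t_clinear[THEN clinear_add]
lemmas t_scale = t_clinear[THEN clinear_scale]

lemma t_rel:
  "tE \<mu> \<nu> (tF v) = tF (tE \<mu> \<nu> v) + tH \<mu> \<nu> v"
  "tH \<mu> \<nu> (tE \<mu> \<nu> v) = tE \<mu> \<nu> (tH \<mu> \<nu> v) + pscale 2 (tE \<mu> \<nu> v)"
  "tH \<mu> \<nu> (tF v) = tF (tH \<mu> \<nu> v) - pscale 2 (tF v)"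
proof -
  show "tE \<mu> \<nu> (tF v) = tF (tE \<mu> \<nu> v) + tH \<mu> \<nu> v"
    by (rule clinear_tens_eqI[OF clinear_compose[OF t_clinear(2) t_clinear(1)]
        clinear_plus[OF clinear_compose[OF t_clinear(1) t_clinear(2)] t_clinear(3)]])
      (simp add: t_tens t_add v_rel tens_linear_simps)
  show "tH \<mu> \<nu> (tE \<mu> \<nu> v) = tE \<mu> \<nu> (tH \<mu> \<nu> v) + pscale 2 (tE \<mu> \<nu> v)"
    by (rule clinear_tens_eqI[OF clinear_compose[OF t_clinear(1) t_clinear(3)]
        clinear_plus[OF clinear_compose[OF t_clinear(3) t_clinear(1)] clinear_smult[OF t_clinear(1)]]])
      (simp add: t_tens t_add v_rel tens_linear_simps pm.scale_right_distrib)
  show "tH \<mu> \<nu> (tF v) = tF (tH \<mu> \<nu> v) - pscale 2 (tF v)"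
    by (rule clinear_tens_eqI[OF clinear_compose[OF t_clinear(2) t_clinear(3)]
        clinear_minus[OF clinear_compose[OF t_clinear(3) t_clinear(2)] clinear_smult[OF t_clinear(2)]]])
      (simp add: t_tens t_add v_rel tens_linear_simps pm.scale_right_distrib)
qed

lemma lookup_vH: "lk (vH \<mu> p) k = (\<mu> - 2 * of_nat k) * lk p k"
proof -
  have "clinear pscale (*) (\<lambda>p. lk (vH \<mu> p) k)"
    "clinear pscale (*) (\<lambda>p. (\<mu> - 2 * of_nat k) * lk p k)"
    by (rule clinearI; simp add: v_clinear[THEN clinear_add] v_clinear[THEN clinear_scale] lookup_add
        pm.vector_space_axioms vector_space_complex algebra_simps)+
  then show ?thesis by (rule clinear_eqI) (simp add: lookup_single when_def)
qed

lemma single_zero_iff: "Poly_Mapping.single k (c :: complex) = 0 \<longleftrightarrow> c = 0"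
  by (metis lookup_single_eq lookup_zero single_zero)

context frame
begin

abbreviation "tact \<mu> \<nu> \<equiv> opact pscale (tE \<mu> \<nu>) tF (tH \<mu> \<nu>)"

lemma tact_rep: "lie_rep pscale sl2 (tact \<mu> \<nu>)"
proof (rule opact_rep)
  show "tE \<mu> \<nu> (tF v) = tF (tE \<mu> \<nu> v) + tH \<mu> \<nu> v"
    "tH \<mu> \<nu> (tE \<mu> \<nu> v) = tE \<mu> \<nu> (tH \<mu> \<nu> v) + pscale 2 (tE \<mu> \<nu> v)"
    "tH \<mu> \<nu> (tF v) = tF (tH \<mu> \<nu> v) - pscale 2 (tF v)" for v
    by (fact t_rel)+
qed (fact t_clinear pm.vector_space_axioms)+

lemma tact_tens: "tact \<mu> \<nu> x (tens p q) = tens (vact \<mu> x p) q + tens p (vact \<nu> x q)"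
  by (simp add: opact_def t_tens tens_linear_simps pm.scale_right_distrib add_ac)

text \<open>Modulo the bilinear relations, a generator is congruent to the expansion of both factors in their bases. This is
  shown for one factor at a time.\<close>

theorem tensor_model:
  fixes V :: "'v lie_module" and W :: "'w lie_module"
  assumes V: "lie_model pscale sl2 (vact \<mu>) V \<phi>" and W: "lie_model pscale sl2 (vact \<nu>) W \<omega>"
  shows "\<exists>\<theta>. lie_model pscale sl2 (tact \<mu> \<nu>) (lie_tensor V W) \<theta>"
proof -
  interpret V: lie_model pscale sl2 "vact \<mu>" V \<phi> by (rule V)
  interpret W: lie_model pscale sl2 "vact \<nu>" W \<omega> by (rule W)
  define B0 where "B0 = carrier V \<times> carrier W"
  define a where "a = (\<lambda>x (v, w). basis_vec (lact V x v, w) + basis_vec (v, lact W x w) :: 'v \<times> 'w \<Rightarrow>\<^sub>0 complex)"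
  define R where "R = bilinear_relations V W"
  define N where "N = submodule_span (free_module B0 a) R"
  define \<Phi> where "\<Phi> = (\<lambda>(v, w). tens (\<phi> v) (\<omega> w))"
  define \<sigma> :: "(nat \<times> nat \<Rightarrow>\<^sub>0 complex) \<Rightarrow> ('v \<times> 'w \<Rightarrow>\<^sub>0 complex)" where "\<sigma> = pextend (\<lambda>(i, j). basis_vec (V.\<psi> (basis_vec i), W.\<psi> (basis_vec j)))"
  have \<sigma>: "clinear pscale pscale \<sigma>" unfolding \<sigma>_def by (rule pextend_clinear)
  have B0: "v \<in> carrier V \<Longrightarrow> w \<in> carrier W \<Longrightarrow> basis_vec (v, w) \<in> {p :: 'v \<times> 'w \<Rightarrow>\<^sub>0 complex. keys p \<subseteq> B0}" for v w
    by (simp add: B0_def)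
  define M where "M = {r :: 'v \<times> 'w \<Rightarrow>\<^sub>0 complex. keys r \<subseteq> B0}"
  have M_add: "p + q \<in> M" if "p \<in> M" "q \<in> M" for p q using that by (simp add: M_def keys_subset_add)
  have M_scale: "pscale c p \<in> M" if "p \<in> M" for p c
    using that by (simp add: M_def subset_trans[OF keys_pscale_subset])
  have M_diff: "p - q \<in> M" if "p \<in> M" "q \<in> M" for p q using that by (simp add: M_def keys_subset_diff)
  have M_basis: "basis_vec (v, w) \<in> M" if "v \<in> carrier V" "w \<in> carrier W" for v w
    using B0[OF that] by (simp add: M_def)
  have RM: "R \<subseteq> M"
    unfolding R_def bilinear_relations_def
    by (intro Un_least subsetI; elim CollectE exE conjE; hypsubst)
      (intro M_diff M_scale M_basis V.add_closed W.add_closed V.smult_closed W.smult_closed; assumption)+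
  note span = submodule_span_superset[OF RM[unfolded M_def], of a, folded N_def]
    submodule_span_zero[OF RM[unfolded M_def], of a, folded N_def]
    submodule_span_add[OF RM[unfolded M_def], of _ a, folded N_def]
    submodule_span_pscale[OF RM[unfolded M_def], of _ a, folded N_def]
  let ?t = "\<lambda>p q. basis_vec (V.\<psi> p, W.\<psi> q) :: 'v \<times> 'w \<Rightarrow>\<^sub>0 complex"
  have RN: "?t (p + p') q - ?t p q - ?t p' q \<in> N" "?t p (q + q') - ?t p q - ?t p q' \<in> N"
    "?t (pscale c p) q - pscale c (?t p q) \<in> N" "?t p (pscale c q) - pscale c (?t p q) \<in> N" for p p' q q' c
    unfolding V.psi_add V.psi_smult W.psi_add W.psi_smult
    by (rule subsetD[OF span(1)], unfold R_def bilinear_relations_def, use V.psi_closed W.psi_closed in blast)+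
  have t0: "?t 0 q \<in> N" "?t p 0 \<in> N" for p q
    using RN(3)[of 0 p q] RN(4)[of p 0 q] by simp_all
  have 1: "?t (basis_vec i) q - \<sigma> (tens (basis_vec i) q) \<in> N" for i q
  proof -
    have "q \<in> {q. ?t (basis_vec i) q - \<sigma> (tens (basis_vec i) q) \<in> N}" (is "_ \<in> ?S")
    proof (rule clinear_closed_span[OF pm_id_clinear])
      fix c d assume "c \<in> ?S" "d \<in> ?S"
      then have "?t (basis_vec i) (c + d) - ?t (basis_vec i) c - ?t (basis_vec i) d
        + (?t (basis_vec i) c - \<sigma> (tens (basis_vec i) c)) + (?t (basis_vec i) d - \<sigma> (tens (basis_vec i) d)) \<in> N"
        by (intro span(3) RN) simp_all
      then show "c + d \<in> ?S" by (simp add: clinear_add[OF \<sigma>] tens_linear_simps algebra_simps)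
    next
      fix k c assume "c \<in> ?S"
      then have "?t (basis_vec i) (pscale k c) - pscale k (?t (basis_vec i) c)
        + pscale k (?t (basis_vec i) c - \<sigma> (tens (basis_vec i) c)) \<in> N"
        by (intro span(3,4) RN) simp_all
      then show "pscale k c \<in> ?S"
        by (simp add: clinear_scale[OF \<sigma>] tens_linear_simps pm.scale_right_diff_distrib)
    qed (simp_all add: t0 clinear_zero[OF \<sigma>] tens_linear_simps \<sigma>_def span(2) pextend_zero)
    then show ?thesis by simp
  qed
  have 2: "?t p q - \<sigma> (tens p q) \<in> N" for p q
  proof -
    have "p \<in> {p. ?t p q - \<sigma> (tens p q) \<in> N}" (is "_ \<in> ?S")
    proof (rule clinear_closed_span[OF pm_id_clinear])
      fix c d assume "c \<in> ?S" "d \<in> ?S"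
      then have "?t (c + d) q - ?t c q - ?t d q
        + (?t c q - \<sigma> (tens c q)) + (?t d q - \<sigma> (tens d q)) \<in> N"
        by (intro span(3) RN) simp_all
      then show "c + d \<in> ?S" by (simp add: clinear_add[OF \<sigma>] tens_linear_simps algebra_simps)
    next
      fix k c assume "c \<in> ?S"
      then have "?t (pscale k c) q - pscale k (?t c q) + pscale k (?t c q - \<sigma> (tens c q)) \<in> N"
        by (intro span(3,4) RN) simp_all
      then show "pscale k c \<in> ?S"
        by (simp add: clinear_scale[OF \<sigma>] tens_linear_simps pm.scale_right_diff_distrib)
    qed (simp_all add: t0 clinear_zero[OF \<sigma>] tens_linear_simps 1)
    then show ?thesis by simp
  qed
  have "lie_model pscale sl2 (tact \<mu> \<nu>) (lie_quot (free_module B0 a) (submodule_span (free_module B0 a) R))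
           (\<lambda>A. the_elem (lin_ext pscale \<Phi> ` A))"
  proof (rule lie_quot_model[OF tact_rep])
    show "R \<subseteq> {p. keys p \<subseteq> B0}" using RM by (simp add: M_def)
    show "lin_ext pscale \<Phi> r = 0" if "r \<in> R" for r
      unfolding pextend_eq_lin_ext[symmetric] using that unfolding R_def bilinear_relations_def
      by (elim UnE CollectE exE conjE; hypsubst)
        (simp_all add: pextend_diff pextend_scale \<Phi>_def V.add W.add V.smult W.smult tens_linear_simps)
    show "keys (a x b) \<subseteq> B0" if x: "x \<in> sl2" and "b \<in> B0" for x b
      using that M_add[OF M_basis M_basis, of "lact V x (fst b)" "snd b" "fst b" "lact W x (snd b)"]
      by (auto simp: a_def B0_def V.lact_closed W.lact_closed M_def split: prod.splits)
    show "lin_ext pscale \<Phi> (a x b) = tact \<mu> \<nu> x (\<Phi> b)" if x: "x \<in> sl2" and "b \<in> B0" for x b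
      unfolding pextend_eq_lin_ext[symmetric] using that
      by (auto simp: a_def B0_def V.lact W.lact \<Phi>_def tact_tens pextend_add split: prod.splits)
    show "clinear pscale pscale \<sigma>" by (rule \<sigma>)
    show "keys (\<sigma> c) \<subseteq> B0" for c
      unfolding \<sigma>_def by (rule keys_pextend) (auto simp: B0_def)
    show "lin_ext pscale \<Phi> (\<sigma> c) = c" for c
      unfolding pextend_eq_lin_ext[symmetric]
      by (rule clinear_eqI[OF clinear_compose[OF \<sigma> pextend_clinear] pm_id_clinear]) (auto simp: \<sigma>_def \<Phi>_def)
    show "basis_vec b - \<sigma> (\<Phi> b) \<in> submodule_span (free_module B0 a) R" if "b \<in> B0" for b
      using that 2[of "\<phi> (fst b)" "\<omega> (snd b)"] by (auto simp: B0_def \<Phi>_def N_def)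
  qed
  moreover have "lie_tensor V W = lie_quot (free_module B0 a) (submodule_span (free_module B0 a) R)"
    by (simp add: lie_tensor_def Let_def B0_def a_def R_def)
  ultimately show ?thesis by metis
qed

section \<open>The Casimir element and infinitesimal characters\<close>

text \<open>The Casimir element shifted by the constant \<open>c\<close>, written as a combination of words.\<close>

definition cas :: "complex \<Rightarrow> cmat list \<Rightarrow>\<^sub>0 complex" where
  "cas c = pscale 4 (basis_vec [\<f>, \<e>]) + basis_vec [\<h>, \<h>] + pscale 2 (basis_vec [\<h>]) - pscale c (basis_vec [])"

lemma cas_words: "cas c \<in> words sl2"
  unfolding cas_def by (intro words_diff words_add words_pscale) simp_all

lemma wact_cas:
  assumes "lie_rep s sl2 (opact s E F H)"
  shows "lie_rep.wact s (opact s E F H) (cas c) v = s 4 (F (E v)) + H (H v) + s 2 (H v) - s c v"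
proof -
  interpret lie_rep s sl2 "opact s E F H" by fact
  show ?thesis by (simp add: cas_def wact_linear vector_space_axioms del: coords_cj)
qed

text \<open>The commutators with the generators are explicit combinations of the three defining relations \<open>r1\<close>, \<open>r2\<close> and \<open>r3\<close>
  of the standard triple.\<close>

lemma cas_commutes_gen:
  assumes "x \<in> sl2"
  shows "fm (cas c) (basis_vec [x]) - fm (basis_vec [x]) (cas c) \<in> uea_ideal sl2"
proof -
  note L = lie_subalgebra_sl2
  have two: "pscale 2 p = p + p" "pscale 4 p = p + p + p + p" for p :: "cmat list \<Rightarrow>\<^sub>0 complex"
    using pm.scale_left_distrib[of 1 1 p] pm.scale_left_distrib[of 2 2 p] by (simp_all add: add_ac)
  have r1: "basis_vec [\<h>, \<e>] - basis_vec [\<e>, \<h>] - pscale 2 (basis_vec [\<e>]) \<in> uea_ideal sl2" (is "?r1 \<in> _")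
    using uea_ideal_add[OF L uea_lie[OF L triple_sl2(3,1)] uea_mscale[OF L triple_sl2(1), of 2]]
    by (simp add: lie_triple)
  have r2: "basis_vec [\<h>, \<f>] - basis_vec [\<f>, \<h>] + pscale 2 (basis_vec [\<f>]) \<in> uea_ideal sl2" (is "?r2 \<in> _")
    using uea_ideal_add[OF L uea_lie[OF L triple_sl2(3,2)] uea_mscale[OF L triple_sl2(2), of "-2"]]
    by (simp add: lie_triple pm.scale_minus_left)
  have r3: "basis_vec [\<e>, \<f>] - basis_vec [\<f>, \<e>] - basis_vec [\<h>] \<in> uea_ideal sl2" (is "?r3 \<in> _")
    using uea_lie[OF L triple_sl2(1,2)] by (simp add: lie_triple)
  let ?e = "basis_vec [\<e>]" and ?f = "basis_vec [\<f>]" and ?h = "basis_vec [\<h>]"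
  have w: "?e \<in> words sl2" "?f \<in> words sl2" "?h \<in> words sl2" by simp_all
  note I = uea_ideal_add[OF L] uea_ideal_diff[OF L] uea_ideal_pscale[OF L] uea_ideal_fm_left[OF L] uea_ideal_fm_right[OF L]
  have ce: "fm (cas c) ?e - fm ?e (cas c) \<in> uea_ideal sl2"
  proof -
    have "fm ?h ?r1 + fm ?r1 ?h - pscale 4 (fm ?r3 ?e) \<in> uea_ideal sl2"
      by (intro I r1 r3 w)
    then show ?thesis by (simp add: cas_def fm_linear_simps two algebra_simps)
  qed
  have cf: "fm (cas c) ?f - fm ?f (cas c) \<in> uea_ideal sl2"
  proof -
    have "fm ?h ?r2 + fm ?r2 ?h + pscale 4 (fm ?f ?r3) \<in> uea_ideal sl2"
      by (intro I r2 r3 w)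
    then show ?thesis by (simp add: cas_def fm_linear_simps two algebra_simps)
  qed
  have ch: "fm (cas c) ?h - fm ?h (cas c) \<in> uea_ideal sl2"
  proof -
    have "pscale (-4) (fm ?f ?r1 + fm ?r2 ?e) \<in> uea_ideal sl2"
      by (intro I r1 r2 w)
    then show ?thesis by (simp add: cas_def fm_linear_simps two pm.scale_minus_left algebra_simps)
  qed
  let ?x = "pscale (ca x) ?h + pscale (cb x) ?e + pscale (cc x) ?f"
  have "fm (cas c) (basis_vec [x] - ?x) - fm (basis_vec [x] - ?x) (cas c)
     + (pscale (ca x) (fm (cas c) ?h - fm ?h (cas c)) + pscale (cb x) (fm (cas c) ?e - fm ?e (cas c))
     + pscale (cc x) (fm (cas c) ?f - fm ?f (cas c))) \<in> uea_ideal sl2"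
    by (intro I uea_expand assms ce cf ch cas_words)
  then show ?thesis by (simp add: fm_linear_simps pm.scale_right_diff_distrib algebra_simps)
qed

lemma cas_commutes:
  assumes p: "p \<in> words sl2"
  shows "fm (cas c) p - fm p (cas c) \<in> uea_ideal sl2"
proof -
  note L = lie_subalgebra_sl2
  have w: "fm (cas c) (basis_vec w) - fm (basis_vec w) (cas c) \<in> uea_ideal sl2" if "w \<in> lists sl2" for w
    using that
  proof (induction w)
    case Nil then show ?case by (simp add: uea_ideal_zero[OF L])
  next
    case (Cons x w)
    have "fm (fm (cas c) (basis_vec [x]) - fm (basis_vec [x]) (cas c)) (basis_vec w)
      + fm (basis_vec [x]) (fm (cas c) (basis_vec w) - fm (basis_vec w) (cas c)) \<in> uea_ideal sl2"
      using Cons by (intro uea_ideal_add[OF L] uea_ideal_fm_left[OF L] uea_ideal_fm_right[OF L] cas_commutes_gen) auto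
    moreover have "fm (basis_vec [x]) (basis_vec w) = basis_vec (x # w)" by simp
    ultimately show ?case by (simp add: fm_linear_simps fm_assoc flip: fm_assoc[of "basis_vec [x]" "basis_vec w"])
  qed
  show ?thesis
    by (rule clinear_closed_span[OF clinear_minus[OF fm_clinear_right fm_clinear_left]])
      (use p in \<open>auto intro: uea_ideal_zero[OF L] uea_ideal_add[OF L] uea_ideal_pscale[OF L] w\<close>)
qed

text \<open>Representatives of central elements of the enveloping algebra.\<close>

definition central :: "(cmat list \<Rightarrow>\<^sub>0 complex) \<Rightarrow> bool" where
  "central p \<longleftrightarrow> p \<in> words sl2 \<and> (\<forall>q\<in>words sl2. fm p q - fm q p \<in> uea_ideal sl2)"

lemma central_cas: "central (cas c)"
  using cas_words cas_commutes by (simp add: central_def)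

lemma central_carrier: "z \<in> carrier (uea_center sl2) \<longleftrightarrow> (\<exists>p. central p \<and> z = cls sl2 p)"
proof -
  note L = lie_subalgebra_sl2
  have "cls sl2 p \<otimes>\<^bsub>UEA sl2\<^esub> cls sl2 q = cls sl2 q \<otimes>\<^bsub>UEA sl2\<^esub> cls sl2 p \<longleftrightarrow> fm p q - fm q p \<in> uea_ideal sl2"
    if "p \<in> words sl2" "q \<in> words sl2" for p q
    unfolding uea_mult_cls[OF L that] uea_mult_cls[OF L that(2,1)] cls_eq_iff[OF L] ..
  then show ?thesis
    unfolding uea_center_def central_def by (simp add: carrier_uea) blast
qed

lemma uea_center_simps:
  "x \<otimes>\<^bsub>uea_center L\<^esub> y = x \<otimes>\<^bsub>UEA L\<^esub> y" "x \<oplus>\<^bsub>uea_center L\<^esub> y = x \<oplus>\<^bsub>UEA L\<^esub> y"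
  by (simp_all add: uea_center_def)

text \<open>A central element preserves the highest weight line, which generates the module.\<close>

lemma central_acts_as_scalar:
  assumes p: "central p"
  shows "\<exists>c. \<forall>v. vw \<mu> p v = pscale c v"
proof -
  interpret V: lie_rep pscale sl2 "vact \<mu>" by (rule vact_rep)
  have pw: "p \<in> words sl2" using p by (simp add: central_def)
  have comm: "vact \<mu> x (vw \<mu> p v) = vw \<mu> p (vact \<mu> x v)" if x: "x \<in> sl2" for x v
  proof -
    have xw: "basis_vec [x] \<in> words sl2" using x by simp
    then have "vw \<mu> (fm p (basis_vec [x]) - fm (basis_vec [x]) p) v = 0"
      using p by (intro V.wact_uea_ideal) (simp add: central_def)
    then show ?thesis by (simp add: V.wact_linear V.wact_fm[OF pw xw] V.wact_fm[OF xw pw])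
  qed
  have pF: "vF (vw \<mu> p v) = vw \<mu> p (vF v)" and pH: "vH \<mu> (vw \<mu> p v) = vw \<mu> p (vH \<mu> v)" for v
    using comm[OF triple_sl2(2), of v] comm[OF triple_sl2(3), of v]
    by (simp_all add: pm.vector_space_axioms del: coords_cj)
  note lin = V.wact_clinear_right[OF pw]
  let ?u = "vw \<mu> p (basis_vec 0)"
  have "vH \<mu> ?u = pscale \<mu> ?u"
    using pH[of "basis_vec 0"] by (simp add: clinear_scale[OF lin])
  then have uk: "(\<mu> - 2 * of_nat k) * lk ?u k = \<mu> * lk ?u k" for k
    by (metis lookup_vH lookup_pscale)
  then have z: "lk ?u k = 0" if "k \<noteq> 0" for k
    using that uk[of k] by (simp add: algebra_simps)
  define c where "c = lk ?u 0"
  have "vw \<mu> p (basis_vec k) = pscale c (basis_vec k)" for k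
  proof (induction k)
    case 0 show ?case
      by (rule poly_mapping_eqI) (use z in \<open>auto simp: c_def lookup_single when_def\<close>)
  next
    case (Suc k)
    then show ?case using pF[of "basis_vec k"] by (simp add: clinear_scale[OF v_clinear(2)])
  qed
  then have "vw \<mu> p v = pscale c v" for v
    by (rule clinear_eqI[OF lin clinear_smult[OF pm_id_clinear]])
  then show ?thesis by blast
qed

lemma inf_char_cls:
  assumes p: "central p" and c: "\<And>v. vw (\<nu> - 1) p v = pscale c v"
  shows "inf_char hset bset \<nu> (cls sl2 p) = c"
proof -
  obtain \<phi> where "lie_model pscale sl2 (vact (\<nu> - 1)) (verma hset bset (\<nu> - 1)) \<phi>"
    using verma_model by blast
  then interpret M: lie_model pscale sl2 "vact (\<nu> - 1)" "verma hset bset (\<nu> - 1)" \<phi> .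
  have pw: "p \<in> words sl2" using p by (simp add: central_def)
  have eq: "uea_act (verma hset bset (\<nu> - 1)) (cls sl2 p) v
      = c' \<odot>\<^bsub>verma hset bset (\<nu> - 1)\<^esub> v \<longleftrightarrow> pscale c (\<phi> v) = pscale c' (\<phi> v)"
    if "v \<in> carrier (verma hset bset (\<nu> - 1))" for v c'
    unfolding M.phi_eq_iff[OF M.uea_act(1)[OF pw that] M.smult_closed[OF that], symmetric]
      M.uea_act(2)[OF pw that] M.smult[OF that] c ..
  show ?thesis
    unfolding inf_char_def Let_def
  proof (rule the_equality)
    fix c' assume "\<forall>v\<in>carrier (verma hset bset (\<nu> - 1)).
      uea_act (verma hset bset (\<nu> - 1)) (cls sl2 p) v
      = c' \<odot>\<^bsub>verma hset bset (\<nu> - 1)\<^esub> v"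
    then have "pscale c (\<phi> (M.\<psi> (basis_vec 0))) = pscale c' (\<phi> (M.\<psi> (basis_vec 0)))"
      using eq M.psi_closed by blast
    then show "c' = c" by (simp add: single_zero_iff)
  qed (use eq in blast)
qed

lemma inf_char_ker_cls:
  assumes p: "central p"
  shows "cls sl2 p \<in> inf_char_ker hset bset \<nu> \<longleftrightarrow> (\<forall>v. vw (\<nu> - 1) p v = 0)"
proof -
  obtain c where c: "\<And>v. vw (\<nu> - 1) p v = pscale c v" using central_acts_as_scalar[OF p] by blast
  have "(\<forall>v :: nat \<Rightarrow>\<^sub>0 complex. pscale c v = 0) \<longleftrightarrow> c = 0"
  proof
    assume "\<forall>v :: nat \<Rightarrow>\<^sub>0 complex. pscale c v = 0"
    then have "pscale c (basis_vec (0 :: nat)) = 0" ..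
    then show "c = 0" unfolding pm.scale_eq_0_iff single_zero_iff by simp
  qed simp
  then show ?thesis
    using p central_carrier by (auto simp: inf_char_ker_def inf_char_cls[OF p c] c)
qed

text \<open>The Casimir element acts on the Verma module of highest weight \<open>\<mu>\<close> by \<open>\<mu> * (\<mu> + 2)\<close>.\<close>

lemma vw_cas: "vw \<mu> (cas (\<mu>\<^sup>2 + 2 * \<mu>)) v = 0"
proof -
  have z: "clinear pscale pscale (\<lambda>v :: nat \<Rightarrow>\<^sub>0 complex. 0 :: nat \<Rightarrow>\<^sub>0 complex)"
    by (rule clinearI) (simp_all add: pm.vector_space_axioms)
  interpret V: lie_rep pscale sl2 "vact \<mu>" by (rule vact_rep)
  show ?thesis
  proof (rule clinear_eqI[OF V.wact_clinear_right[OF cas_words] z])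
    fix k
    have "vw \<mu> (cas (\<mu>\<^sup>2 + 2 * \<mu>)) (basis_vec k) = pscale (4 * (of_nat k * (\<mu> - of_nat k + 1))
        + (\<mu> - 2 * of_nat k) * (\<mu> - 2 * of_nat k) + 2 * (\<mu> - 2 * of_nat k) - (\<mu>\<^sup>2 + 2 * \<mu>)) (basis_vec k)"
      unfolding wact_cas[OF vact_rep] pm.scale_left_distrib pm.scale_left_diff_distrib[of _ "\<mu>\<^sup>2 + 2 * \<mu>"]
      by (cases k) (simp_all add: v_clinear[THEN clinear_scale] v_clinear[THEN clinear_zero] pm.scale_left_distrib)
    also have "4 * (of_nat k * (\<mu> - of_nat k + 1))
        + (\<mu> - 2 * of_nat k) * (\<mu> - 2 * of_nat k) + 2 * (\<mu> - 2 * of_nat k) - (\<mu>\<^sup>2 + 2 * \<mu>) = 0"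
      by (simp add: algebra_simps power2_eq_square)
    finally show "vw \<mu> (cas (\<mu>\<^sup>2 + 2 * \<mu>)) (basis_vec k) = 0" by simp
  qed
qed

primrec caspow :: "complex \<Rightarrow> nat \<Rightarrow> cmat list \<Rightarrow>\<^sub>0 complex" where
  "caspow c 0 = basis_vec []"
| "caspow c (Suc n) = fm (caspow c n) (cas c)"

lemma caspow_words: "caspow c n \<in> words sl2"
  by (induction n) (simp, simp only: caspow.simps, rule words_fm[OF _ cas_words])

lemma ideals_pow:
  "I [^]\<^bsub>ideals_set R\<^esub> (0::nat) = carrier R" "I [^]\<^bsub>ideals_set R\<^esub> (Suc n) = ideal_prod R (I [^]\<^bsub>ideals_set R\<^esub> n) I"
  by (simp_all add: nat_pow_def ideals_set_def)

text \<open>The shifted Casimir element lies in the kernel of the character, so its powers lie in the powers of the kernel.\<close>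

lemma inf_char_part_casimir:
  assumes V: "lie_model s sl2 act V \<phi>"
    and v: "v \<in> carrier (inf_char_part hset bset V (\<mu> + 1))"
  shows "\<exists>n. (lie_rep.wact s act (cas (\<mu>\<^sup>2 + 2 * \<mu>)) ^^ n) (\<phi> v) = 0"
proof -
  interpret V: lie_model s sl2 act V \<phi> by (rule V)
  let ?c = "\<mu>\<^sup>2 + 2 * \<mu>" and ?K = "inf_char_ker hset bset (\<mu> + 1)"
  note L = lie_subalgebra_sl2
  have K: "cls sl2 (cas ?c) \<in> ?K"
    unfolding inf_char_ker_cls[OF central_cas] using vw_cas by simp
  have pow: "cls sl2 (caspow ?c n) \<in> ?K [^]\<^bsub>ideals_set (uea_center sl2)\<^esub> n" for n
  proof (induction n)
    case 0
    have "central (basis_vec [])" by (simp add: central_def uea_ideal_zero[OF L])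
    then show ?case unfolding ideals_pow central_carrier by auto
  next
    case (Suc n)
    show ?case
      unfolding ideals_pow caspow.simps uea_mult_cls[OF L caspow_words cas_words, symmetric]
        uea_center_simps(1)[symmetric]
      by (rule ideal_prod.prod[OF Suc K])
  qed
  have act: "V.wact (caspow ?c n) u = (V.wact (cas ?c) ^^ n) u" for n u
    by (induction n arbitrary: u) (simp_all add: V.wact_fm caspow_words cas_words funpow_swap1 del: mem_Collect_eq)
  have vV: "v \<in> carrier V" and "\<exists>n::nat. \<forall>z \<in> ?K [^]\<^bsub>ideals_set (uea_center sl2)\<^esub> n. uea_act V z v = \<zero>\<^bsub>V\<^esub>"
    using v unfolding inf_char_part_def by simp_all
  then obtain n :: nat where n: "\<forall>z \<in> ?K [^]\<^bsub>ideals_set (uea_center sl2)\<^esub> n. uea_act V z v = \<zero>\<^bsub>V\<^esub>" by blast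
  have "V.wact (caspow ?c n) (\<phi> v) = 0"
    using V.uea_act(2)[OF caspow_words vV, of ?c n] bspec[OF n pow] V.zero by simp
  then show ?thesis unfolding act by blast
qed

text \<open>Already the first power of the kernel suffices for the vectors that are needed.\<close>

lemma inf_char_partI:
  assumes V: "lie_model s sl2 act V \<phi>" and v: "v \<in> carrier V"
    and kill: "\<And>p. central p \<Longrightarrow> (\<And>u. vw \<mu> p u = 0) \<Longrightarrow> lie_rep.wact s act p (\<phi> v) = 0"
  shows "v \<in> carrier (inf_char_part hset bset V (\<mu> + 1))"
proof -
  interpret V: lie_model s sl2 act V \<phi> by (rule V)
  note L = lie_subalgebra_sl2
  let ?K = "inf_char_ker hset bset (\<mu> + 1)"
  let ?S = "{z. \<exists>p\<in>words sl2. z = cls sl2 p \<and> V.wact p (\<phi> v) = 0}"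
  have "z \<in> ?S" if "z \<in> ideal_prod (uea_center sl2) (carrier (uea_center sl2)) ?K" for z
    using that
  proof (induction z rule: ideal_prod.induct)
    case (prod i j)
    obtain p where p: "central p" "i = cls sl2 p" using prod(1) central_carrier by blast
    have "j \<in> carrier (uea_center sl2)" using prod(2) by (simp add: inf_char_ker_def)
    then obtain q where q: "central q" "j = cls sl2 q" using central_carrier by blast
    have w: "p \<in> words sl2" "q \<in> words sl2" using p q by (auto simp: central_def)
    have "V.wact q (\<phi> v) = 0"
      using kill[OF q(1)] prod(2) inf_char_ker_cls[OF q(1), of "\<mu> + 1"] q(2) by simp
    then have "V.wact (fm p q) (\<phi> v) = 0"
      using V.wact_fm[OF w] clinear_zero[OF V.wact_clinear_right[OF w(1)]] by simp
    then show ?case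
      using words_fm[OF w] uea_mult_cls[OF L w] by (auto simp: uea_center_simps p q)
  next
    case (sum s1 s2)
    then obtain p q where pq: "p \<in> words sl2" "q \<in> words sl2" "s1 = cls sl2 p" "s2 = cls sl2 q"
      "V.wact p (\<phi> v) = 0" "V.wact q (\<phi> v) = 0" by blast
    then show ?case
      using words_add[OF pq(1,2)] uea_add_cls[OF L pq(1,2)]
      unfolding uea_center_simps pq(3,4)
      by (intro CollectI bexI[of _ "p + q"]) (simp_all add: V.wact_linear)
  qed
  then have "uea_act V z v = \<zero>\<^bsub>V\<^esub>" if "z \<in> ?K [^]\<^bsub>ideals_set (uea_center sl2)\<^esub> (Suc 0)" for z
    using that V.uea_act[OF _ v] V.phi_eq_iff[OF _ V.zero_closed] V.zero unfolding ideals_pow by fastforce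
  then have "\<exists>n::nat. \<forall>z \<in> ?K [^]\<^bsub>ideals_set (uea_center sl2)\<^esub> n. uea_act V z v = \<zero>\<^bsub>V\<^esub>" by blast
  then show ?thesis using v unfolding inf_char_part_def by simp
qed

lemma central_add: "central p \<Longrightarrow> central q \<Longrightarrow> central (p + q)"
  using words_add[of p sl2 q] uea_ideal_add[OF lie_subalgebra_sl2]
  unfolding central_def fm_linear_simps by (metis (no_types, lifting) add_diff_add)

lemma central_fm:
  assumes p: "central p" and q: "central q"
  shows "central (fm p q)"
proof -
  have w: "p \<in> words sl2" "q \<in> words sl2" using p q by (auto simp: central_def)
  have "fm (fm p q) r - fm r (fm p q) \<in> uea_ideal sl2" if r: "r \<in> words sl2" for r
  proof -
    have "fm p (fm q r - fm r q) + fm (fm p r - fm r p) q \<in> uea_ideal sl2"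
      using p q r w
      by (intro uea_ideal_add uea_ideal_fm_left uea_ideal_fm_right lie_subalgebra_sl2) (auto simp: central_def)
    then show ?thesis by (simp add: fm_linear_simps fm_assoc)
  qed
  then show ?thesis using words_fm[OF w] by (simp add: central_def)
qed

lemma central_wact_commute:
  assumes rep: "lie_rep s sl2 act" and p: "central p" and x: "x \<in> sl2"
  shows "lie_rep.wact s act p (act x v) = act x (lie_rep.wact s act p v)"
proof -
  interpret lie_rep s sl2 act by (rule rep)
  have w: "p \<in> words sl2" "basis_vec [x] \<in> words sl2" using p x by (auto simp: central_def)
  have "wact (fm p (basis_vec [x]) - fm (basis_vec [x]) p) v = 0"
    using p w by (intro wact_uea_ideal) (simp add: central_def)
  then show ?thesis by (simp add: wact_linear wact_fm[OF w] wact_fm[OF w(2,1)])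
qed

lemma inf_char_ker_pow_central:
  assumes "z \<in> inf_char_ker h b \<nu> [^]\<^bsub>ideals_set (uea_center sl2)\<^esub> (n :: nat)"
  shows "\<exists>p. central p \<and> z = cls sl2 p"
  using assms
proof (induction n arbitrary: z)
  case 0
  then show ?case unfolding ideals_pow central_carrier .
next
  case (Suc n)
  have ker: "\<exists>p. central p \<and> z = cls sl2 p" if "z \<in> inf_char_ker h b \<nu>" for z
    using that by (simp add: inf_char_ker_def central_carrier)
  from Suc.prems show ?case
    unfolding ideals_pow
  proof (induction z rule: ideal_prod.induct)
    case (prod i j)
    obtain p q where pq: "central p" "i = cls sl2 p" "central q" "j = cls sl2 q"
      using Suc.IH[OF prod(1)] ker[OF prod(2)] by blast
    then have "i \<otimes>\<^bsub>uea_center sl2\<^esub> j = cls sl2 (fm p q)"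
      using uea_mult_cls[OF lie_subalgebra_sl2] by (simp add: uea_center_simps central_def)
    then show ?case using central_fm pq by blast
  next
    case (sum s1 s2)
    then obtain p q where pq: "central p" "s1 = cls sl2 p" "central q" "s2 = cls sl2 q" by blast
    then have "s1 \<oplus>\<^bsub>uea_center sl2\<^esub> s2 = cls sl2 (p + q)"
      using uea_add_cls[OF lie_subalgebra_sl2] by (simp add: uea_center_simps central_def)
    then show ?case using central_add pq by blast
  qed
qed

text \<open>All elements of the powers of the kernel are central and hence commute with the Lie algebra.\<close>

lemma inf_char_part_closed:
  assumes V: "lie_model s sl2 act V \<phi>" and v: "v \<in> carrier (inf_char_part h b V \<nu>)"
  shows "x \<in> sl2 \<Longrightarrow> lact V x v \<in> carrier (inf_char_part h b V \<nu>)"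
    and "c \<odot>\<^bsub>V\<^esub> v \<in> carrier (inf_char_part h b V \<nu>)"
proof -
  interpret V: lie_model s sl2 act V \<phi> by (rule V)
  let ?K = "inf_char_ker h b \<nu>"
  have vV: "v \<in> carrier V" and "\<exists>n::nat. \<forall>z \<in> ?K [^]\<^bsub>ideals_set (uea_center sl2)\<^esub> n. uea_act V z v = \<zero>\<^bsub>V\<^esub>"
    using v unfolding inf_char_part_def by simp_all
  then obtain n :: nat where n: "\<forall>z \<in> ?K [^]\<^bsub>ideals_set (uea_center sl2)\<^esub> n. uea_act V z v = \<zero>\<^bsub>V\<^esub>" by blast
  have part: "w \<in> carrier (inf_char_part h b V \<nu>)"
    if w: "w \<in> carrier V" and kill: "\<And>p. central p \<Longrightarrow> V.wact p (\<phi> v) = 0 \<Longrightarrow> V.wact p (\<phi> w) = 0" for w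
  proof -
    have "uea_act V z w = \<zero>\<^bsub>V\<^esub>" if z: "z \<in> ?K [^]\<^bsub>ideals_set (uea_center sl2)\<^esub> n" for z
    proof -
      obtain p where p: "central p" "z = cls sl2 p" using inf_char_ker_pow_central[OF z] by blast
      have pw: "p \<in> words sl2" using p(1) by (simp add: central_def)
      have "V.wact p (\<phi> v) = 0" using bspec[OF n z] V.uea_act(2)[OF pw vV] V.zero p(2) by simp
      from kill[OF p(1) this] show ?thesis
        using V.uea_act[OF pw w] V.phi_eq_iff[OF _ V.zero_closed] V.zero p(2) by metis
    qed
    then have "\<exists>n::nat. \<forall>z \<in> ?K [^]\<^bsub>ideals_set (uea_center sl2)\<^esub> n. uea_act V z w = \<zero>\<^bsub>V\<^esub>" by blast
    then show ?thesis using w unfolding inf_char_part_def by simp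
  qed
  show "lact V x v \<in> carrier (inf_char_part h b V \<nu>)" if x: "x \<in> sl2"
    by (rule part[OF V.lact_closed[OF x vV]])
      (simp add: V.lact[OF x vV] central_wact_commute[OF V.lie_rep_axioms _ x] clinear_zero[OF V.act_clinear[OF x]])
  show "c \<odot>\<^bsub>V\<^esub> v \<in> carrier (inf_char_part h b V \<nu>)"
  proof (rule part[OF V.smult_closed[OF vV]])
    fix p assume "central p" "V.wact p (\<phi> v) = 0"
    then show "V.wact p (\<phi> (c \<odot>\<^bsub>V\<^esub> v)) = 0"
      by (simp add: V.smult[OF vV] clinear_scale[OF V.wact_clinear_right] central_def)
  qed
qed

end

section \<open>Singular vectors in the tensor product\<close>

lemma t_basis:
  "tE \<mu> \<nu> (basis_vec (i, j)) = pscale (of_nat i * (\<mu> - of_nat i + 1)) (basis_vec (i - 1, j))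
     + pscale (of_nat j * (\<nu> - of_nat j + 1)) (basis_vec (i, j - 1))"
  "tF (basis_vec (i, j)) = basis_vec (Suc i, j) + basis_vec (i, Suc j)"
  "tH \<mu> \<nu> (basis_vec (i, j)) = pscale (\<mu> + \<nu> - 2 * of_nat (i + j)) (basis_vec (i, j))"
proof -
  have "tH \<mu> \<nu> (basis_vec (i, j)) = pscale ((\<mu> - 2 * of_nat i) + (\<nu> - 2 * of_nat j)) (basis_vec (i, j))"
    using t_tens(3)[of \<mu> \<nu> "basis_vec i" "basis_vec j"]
    by (simp only: tens_basis v_basis tens_linear_simps pm.scale_left_distrib)
  then show "tH \<mu> \<nu> (basis_vec (i, j)) = pscale (\<mu> + \<nu> - 2 * of_nat (i + j)) (basis_vec (i, j))"
    by (simp add: algebra_simps)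
qed (use t_tens(1)[of \<mu> \<nu> "basis_vec i" "basis_vec j"] t_tens(2)[of "basis_vec i" "basis_vec j"]
    in \<open>simp_all add: tens_linear_simps\<close>)

lemma lookup_clinear: "clinear pscale pscale f \<Longrightarrow> clinear pscale (*) (\<lambda>p. lk (f p) k)"
  by (rule clinearI) (simp_all add: clinear_add clinear_scale lookup_add pm.vector_space_axioms vector_space_complex)

lemma lookup_tE: "lk (tE \<mu> \<nu> p) (i, j) =
    of_nat (Suc i) * (\<mu> - of_nat i) * lk p (Suc i, j) + of_nat (Suc j) * (\<nu> - of_nat j) * lk p (i, Suc j)"
proof -
  have 2: "clinear pscale (*) (\<lambda>p. of_nat (Suc i) * (\<mu> - of_nat i) * lk p (Suc i, j) + of_nat (Suc j) * (\<nu> - of_nat j) * lk p (i, Suc j))"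
    by (rule clinearI) (simp_all add: lookup_add pm.vector_space_axioms vector_space_complex algebra_simps)
  show ?thesis
  proof (rule clinear_eqI[OF lookup_clinear[OF t_clinear(1)] 2])
    fix k :: "nat \<times> nat"
    obtain a b where k: "k = (a, b)" by fastforce
    show "lk (tE \<mu> \<nu> (basis_vec k)) (i, j) = of_nat (Suc i) * (\<mu> - of_nat i) * lk (basis_vec k) (Suc i, j)
      + of_nat (Suc j) * (\<nu> - of_nat j) * lk (basis_vec k) (i, Suc j)"
      unfolding k t_basis by (cases a; cases b) (auto simp: lookup_add lookup_single when_def)
  qed
qed

lemma lookup_tF: "lk (tF p) (i, j) =
    (case i of 0 \<Rightarrow> 0 | Suc i' \<Rightarrow> lk p (i', j)) + (case j of 0 \<Rightarrow> 0 | Suc j' \<Rightarrow> lk p (i, j'))"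
proof -
  have 2: "clinear pscale (*) (\<lambda>p. (case i of 0 \<Rightarrow> 0 | Suc i' \<Rightarrow> lk p (i', j)) + (case j of 0 \<Rightarrow> 0 | Suc j' \<Rightarrow> lk p (i, j')))"
    by (rule clinearI) (auto simp: lookup_add pm.vector_space_axioms vector_space_complex algebra_simps split: nat.splits)
  show ?thesis
  proof (rule clinear_eqI[OF lookup_clinear[OF t_clinear(2)] 2])
    fix k :: "nat \<times> nat"
    obtain a b where k: "k = (a, b)" by fastforce
    show "lk (tF (basis_vec k)) (i, j) = (case i of 0 \<Rightarrow> 0 | Suc i' \<Rightarrow> lk (basis_vec k) (i', j))
      + (case j of 0 \<Rightarrow> 0 | Suc j' \<Rightarrow> lk (basis_vec k) (i, j'))"
      unfolding k t_basis by (auto simp: lookup_add lookup_single when_def split: nat.splits)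
  qed
qed

lemma lookup_tH: "lk (tH \<mu> \<nu> p) (i, j) = (\<mu> + \<nu> - 2 * of_nat (i + j)) * lk p (i, j)"
proof -
  have 2: "clinear pscale (*) (\<lambda>p. (\<mu> + \<nu> - 2 * of_nat (i + j)) * lk p (i, j))"
    by (rule clinearI) (simp_all add: lookup_add pm.vector_space_axioms vector_space_complex algebra_simps)
  show ?thesis
  proof (rule clinear_eqI[OF lookup_clinear[OF t_clinear(3)] 2])
    fix k :: "nat \<times> nat"
    obtain a b where k: "k = (a, b)" by fastforce
    show "lk (tH \<mu> \<nu> (basis_vec k)) (i, j) = (\<mu> + \<nu> - 2 * of_nat (i + j)) * lk (basis_vec k) (i, j)"
      unfolding k t_basis by (auto simp: lookup_single when_def)
  qed
qed

definition lvl :: "nat \<Rightarrow> (nat \<times> nat \<Rightarrow>\<^sub>0 complex) set" where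
  "lvl m = {p. \<forall>i j. i + j \<noteq> m \<longrightarrow> lk p (i, j) = 0}"

lemma lvlD: "p \<in> lvl m \<Longrightarrow> i + j \<noteq> m \<Longrightarrow> lk p (i, j) = 0"
  by (simp add: lvl_def)

lemma lvl_iff: "p \<in> lvl m \<longleftrightarrow> tH \<mu> \<nu> p = pscale (\<mu> + \<nu> - 2 * of_nat m) p"
proof
  assume p: "p \<in> lvl m"
  show "tH \<mu> \<nu> p = pscale (\<mu> + \<nu> - 2 * of_nat m) p"
  proof (rule poly_mapping_eqI)
    fix k :: "nat \<times> nat"
    obtain i j where k: "k = (i, j)" by fastforce
    show "lk (tH \<mu> \<nu> p) k = lk (pscale (\<mu> + \<nu> - 2 * of_nat m) p) k"
      using lvlD[OF p, of i j] unfolding k lookup_tH lookup_pscale by (cases "i + j = m") auto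
  qed
next
  assume *: "tH \<mu> \<nu> p = pscale (\<mu> + \<nu> - 2 * of_nat m) p"
  have "lk p (i, j) = 0" if "i + j \<noteq> m" for i j
  proof -
    have "(\<mu> + \<nu> - 2 * of_nat (i + j)) * lk p (i, j) = (\<mu> + \<nu> - 2 * of_nat m) * lk p (i, j)"
      using * lookup_tH[of \<mu> \<nu> p i j] lookup_pscale by metis
    then have "2 * ((of_nat (i + j) - of_nat m) * lk p (i, j)) = 0" by (simp add: algebra_simps)
    then have "(of_nat (i + j) - of_nat m) * lk p (i, j) = 0" by (metis mult_eq_0_iff zero_neq_numeral)
    then show ?thesis using that unfolding mult_eq_0_iff right_minus_eq of_nat_eq_iff by blast
  qed
  then show "p \<in> lvl m" by (simp add: lvl_def)
qed

definition sing :: "complex \<Rightarrow> complex \<Rightarrow> nat \<Rightarrow> (nat \<times> nat \<Rightarrow>\<^sub>0 complex) set" where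
  "sing \<mu> \<nu> l = {p \<in> lvl l. tE \<mu> \<nu> p = 0}"

lemma sing_eq:
  assumes "p \<in> sing \<mu> \<nu> l"
  shows "of_nat (Suc i) * (\<mu> - of_nat i) * lk p (Suc i, j) + of_nat (Suc j) * (\<nu> - of_nat j) * lk p (i, Suc j) = 0"
  using assms lookup_tE[of \<mu> \<nu> p i j] by (simp add: sing_def)

definition swp :: "(nat \<times> nat \<Rightarrow>\<^sub>0 complex) \<Rightarrow> (nat \<times> nat \<Rightarrow>\<^sub>0 complex)" where
  "swp = pextend (\<lambda>(i, j). basis_vec (j, i))"

lemma swp_clinear: "clinear pscale pscale swp"
  unfolding swp_def by (rule pextend_clinear)

lemma lookup_swp [simp]: "lk (swp p) (i, j) = lk p (j, i)"
proof -
  have 2: "clinear pscale (*) (\<lambda>p. lk p (j, i))" by (rule lookup_clinear[OF pm_id_clinear])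
  show ?thesis
    by (rule clinear_eqI[OF lookup_clinear[OF swp_clinear] 2]) (auto simp: swp_def lookup_single when_def split: if_splits)
qed

lemma swp_sing: "p \<in> sing \<mu> \<nu> l \<Longrightarrow> swp p \<in> sing \<nu> \<mu> l"
proof -
  assume p: "p \<in> sing \<mu> \<nu> l"
  have "tE \<nu> \<mu> (swp p) = 0"
  proof (rule poly_mapping_eqI)
    fix k :: "nat \<times> nat"
    obtain i j where k: "k = (i, j)" by fastforce
    show "lk (tE \<nu> \<mu> (swp p)) k = lk 0 k"
      using sing_eq[OF p, of j i] unfolding k lookup_tE lookup_swp by (simp add: add.commute)
  qed
  then show ?thesis using p by (auto simp: sing_def lvl_def)
qed

lemma swp_eq_0: "swp p = 0 \<longleftrightarrow> p = 0"
  by (metis clinear_zero[OF swp_clinear] lookup_swp poly_mapping_eqI surj_pair)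

lemma lvl_sub: "p \<in> lvl m \<Longrightarrow> q \<in> lvl m \<Longrightarrow> p - q \<in> lvl m"
  and lvl_add: "p \<in> lvl m \<Longrightarrow> q \<in> lvl m \<Longrightarrow> p + q \<in> lvl m"
  and lvl_scale: "p \<in> lvl m \<Longrightarrow> pscale c p \<in> lvl m"
  and lvl_zero: "0 \<in> lvl m"
  by (simp_all add: lvl_def lookup_minus lookup_add)

lemma sing_sub: "p \<in> sing \<mu> \<nu> l \<Longrightarrow> q \<in> sing \<mu> \<nu> l \<Longrightarrow> p - q \<in> sing \<mu> \<nu> l"
  and sing_add: "p \<in> sing \<mu> \<nu> l \<Longrightarrow> q \<in> sing \<mu> \<nu> l \<Longrightarrow> p + q \<in> sing \<mu> \<nu> l"
  and sing_scale: "p \<in> sing \<mu> \<nu> l \<Longrightarrow> pscale c p \<in> sing \<mu> \<nu> l"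
  and sing_zero: "0 \<in> sing \<mu> \<nu> l"
  by (simp_all add: sing_def lvl_sub lvl_add lvl_scale lvl_zero clinear_diff[OF t_clinear(1)]
      clinear_add[OF t_clinear(1)] clinear_scale[OF t_clinear(1)] clinear_zero[OF t_clinear(1)])

lemma lvl_first:
  assumes "p \<in> lvl l" "p \<noteq> 0"
  obtains i where "i \<le> l" "lk p (i, l - i) \<noteq> 0" "\<And>i'. i' < i \<Longrightarrow> lk p (i', l - i') = 0"
proof -
  have "\<exists>i\<le>l. lk p (i, l - i) \<noteq> 0"
  proof (rule ccontr)
    assume *: "\<not> (\<exists>i\<le>l. lk p (i, l - i) \<noteq> 0)"
    have "lk p (i, j) = 0" for i j
    proof (cases "i + j = l")
      case True
      then have "j = l - i" "i \<le> l" by auto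
      then show ?thesis using * by blast
    qed (rule lvlD[OF assms(1)])
    then have "p = 0" by (intro poly_mapping_eqI) (auto)
    then show False using assms(2) by simp
  qed
  then obtain i0 where "i0 \<le> l" "lk p (i0, l - i0) \<noteq> 0" by blast
  then show ?thesis
    using that[of "LEAST i. lk p (i, l - i) \<noteq> 0"] LeastI[of "\<lambda>i. lk p (i, l - i) \<noteq> 0" i0]
      Least_le[of "\<lambda>i. lk p (i, l - i) \<noteq> 0" i0] not_less_Least[of _ "\<lambda>i. lk p (i, l - i) \<noteq> 0"]
    by fastforce
qed

text \<open>The recurrence at the first nonzero coefficient: the preceding coefficient is zero, so the factor \<open>\<mu> - a\<close> must vanish.\<close>

lemma sing_corner_zero:
  assumes p: "p \<in> sing \<mu> \<nu> l" "p \<noteq> 0" and 0: "lk p (0, l) = 0"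
  shows "\<exists>a<l. \<mu> = of_nat a \<and> lk p (Suc a, l - Suc a) \<noteq> 0"
proof -
  obtain i where i: "i \<le> l" "lk p (i, l - i) \<noteq> 0" "\<And>i'. i' < i \<Longrightarrow> lk p (i', l - i') = 0"
    using lvl_first[of p l] p by (auto simp: sing_def)
  obtain a where a: "i = Suc a" using i(2) 0 by (cases i) auto
  have "of_nat (Suc a) * (\<mu> - of_nat a) * lk p (Suc a, l - Suc a) = 0"
    using sing_eq[OF p(1), of a "l - Suc a"] i(1) i(3)[of a] by (simp add: a Suc_diff_Suc)
  then have "\<mu> = of_nat a" using i(2) by (simp add: a del: of_nat_Suc)
  then show ?thesis using i a by auto
qed

text \<open>The case in which the recurrence for singular vectors on level \<open>l\<close> has two independent solutions.\<close>

definition exceptional :: "complex \<Rightarrow> complex \<Rightarrow> nat \<Rightarrow> bool" where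
  "exceptional \<mu> \<nu> l \<longleftrightarrow> (\<exists>a b :: nat. \<mu> = of_nat a \<and> \<nu> = of_nat b \<and> a < l \<and> b < l \<and> l \<le> a + b + 1)"

text \<open>From two independent solutions a nonzero one with any prescribed zero coefficient can be formed. A zero at the
  corner \<open>(0, l)\<close> forces \<open>\<mu> = a\<close>, and by symmetry a zero at \<open>(l, 0)\<close> forces \<open>\<nu> = b\<close>. If the breaks came in the wrong
  order, a zero directly after the first break would propagate to the corner and make the solution vanish.\<close>

lemma independent_sing_exceptional:
  assumes p: "p \<in> sing \<mu> \<nu> l" "q \<in> sing \<mu> \<nu> l" and p0: "p \<noteq> 0" and ind: "\<And>c. q \<noteq> pscale c p"
  shows "exceptional \<mu> \<nu> l"
proof -
  have ex: "\<exists>s\<in>sing \<mu> \<nu> l. s \<noteq> 0 \<and> lk s k = 0" for k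
  proof (cases "lk p k = 0")
    case False
    let ?s = "q - pscale (lk q k / lk p k) p"
    have "?s \<noteq> 0" using ind by simp
    moreover have "lk ?s k = 0" using False by (simp add: lookup_minus)
    moreover have "?s \<in> sing \<mu> \<nu> l" by (intro sing_sub sing_scale p)
    ultimately show ?thesis by blast
  qed (use p p0 in blast)
  obtain s where "s \<in> sing \<mu> \<nu> l" "s \<noteq> 0" "lk s (0, l) = 0" using ex by blast
  then obtain a where a: "\<mu> = of_nat a" "a < l" using sing_corner_zero by blast
  obtain s' where "s' \<in> sing \<mu> \<nu> l" "s' \<noteq> 0" "lk s' (l, 0) = 0" using ex by blast
  then obtain b where b: "\<nu> = of_nat b" "b < l"
    using sing_corner_zero[of "swp s'" \<nu> \<mu> l] swp_sing swp_eq_0 lookup_swp by metis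
  have "l \<le> a + b + 1"
  proof (rule ccontr)
    assume *: "\<not> l \<le> a + b + 1"
    obtain s where s: "s \<in> sing \<mu> \<nu> l" "s \<noteq> 0" "lk s (Suc a, l - Suc a) = 0" using ex by blast
    have step: "lk s (i, l - i) = 0"
      if i: "i \<le> a" and e: "(\<mu> - of_nat i) * lk s (Suc i, l - Suc i) = 0" for i
    proof -
      have "of_nat (Suc (l - Suc i)) * (\<nu> - of_nat (l - Suc i)) * lk s (i, Suc (l - Suc i)) = 0"
        using sing_eq[OF s(1), of i "l - Suc i"] e by (simp only: mult.assoc mult_zero_right add_0_left)
      moreover have "b \<noteq> l - Suc i" "Suc (l - Suc i) = l - i" "i < l" using * i a(2) by auto
      ultimately show ?thesis unfolding b(1) mult_eq_0_iff right_minus_eq of_nat_eq_iff of_nat_eq_0_iff by fastforce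
    qed
    have "lk s (a - d, l - (a - d)) = 0" for d
    proof (induction d)
      case 0 show ?case using step[of a] a by simp
    next
      case (Suc d)
      show ?case
      proof (cases "d < a")
        case True
        then have "Suc (a - Suc d) = a - d" by simp
        then show ?thesis using step[of "a - Suc d"] Suc by simp
      qed (use Suc in simp)
    qed
    from this[of a] have "lk s (0, l) = 0" by simp
    from sing_corner_zero[OF s(1,2) this] s(3) a(1) show False by auto
  qed
  then show ?thesis using a b by (auto simp: exceptional_def)
qed

text \<open>The solution of the recurrence that starts with \<open>1\<close>. In a position where the denominator vanishes the quotient is
  zero by convention, which continues the solution by zero.\<close>

definition xc :: "complex \<Rightarrow> complex \<Rightarrow> nat \<Rightarrow> nat \<Rightarrow> complex" where
  "xc \<mu> \<nu> m i = (\<Prod>k<i. - (of_nat (m - k) * (\<nu> - of_nat (m - Suc k)) / (of_nat (Suc k) * (\<mu> - of_nat k))))"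

definition svec :: "complex \<Rightarrow> complex \<Rightarrow> nat \<Rightarrow> (nat \<times> nat \<Rightarrow>\<^sub>0 complex)" where
  "svec \<mu> \<nu> m = (\<Sum>i\<le>m. pscale (xc \<mu> \<nu> m i) (basis_vec (i, m - i)))"

lemma lookup_level_sum:
  fixes i j m :: nat
  shows "lk (\<Sum>i\<le>m. pscale (x i) (basis_vec (i, m - i))) (i, j) = (if i + j = m then x i else 0)"
proof -
  have "lk (\<Sum>i\<le>m. pscale (x i) (basis_vec (i, m - i))) (i, j)
      = (\<Sum>i'\<le>m. lk (pscale (x i') (basis_vec (i', m - i'))) (i, j))"
    by (rule lookup_sum)
  also have "\<dots> = (\<Sum>i'\<le>m. if i' = i then (if i + j = m then x i else 0) else 0)"
    by (rule sum.cong[OF refl]) (auto simp: lookup_single when_def)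
  also have "\<dots> = (if i + j = m then x i else 0)" by auto
  finally show ?thesis .
qed

text \<open>Where \<open>\<mu> = i\<close>, the equation of the recurrence has only the term with \<open>x\<^sub>i\<close>, and it holds if that coefficient or its factor vanishes.\<close>

lemma svec_sing:
  assumes "\<And>i. i < m \<Longrightarrow> \<mu> = of_nat i \<Longrightarrow> xc \<mu> \<nu> m i = 0 \<or> \<nu> = of_nat (m - Suc i)"
  shows "svec \<mu> \<nu> m \<in> sing \<mu> \<nu> m"
proof -
  have "tE \<mu> \<nu> (svec \<mu> \<nu> m) = 0"
  proof (rule poly_mapping_eqI)
    fix k :: "nat \<times> nat"
    obtain i j where k: "k = (i, j)" by fastforce
    show "lk (tE \<mu> \<nu> (svec \<mu> \<nu> m)) k = lk 0 k"
    proof (cases "Suc i + j = m")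
      case True
      then have j: "j = m - Suc i" "Suc j = m - i" "i < m" by auto
      have "of_nat (Suc i) * (\<mu> - of_nat i) * xc \<mu> \<nu> m (Suc i) = - (of_nat (Suc j) * (\<nu> - of_nat j) * xc \<mu> \<nu> m i)"
      proof (cases "\<mu> = of_nat i")
        case False
        have "xc \<mu> \<nu> m (Suc i) = xc \<mu> \<nu> m i * - (of_nat (Suc j) * (\<nu> - of_nat j) / (of_nat (Suc i) * (\<mu> - of_nat i)))"
          by (simp add: xc_def flip: j(1,2))
        then show ?thesis using False by (simp add: field_simps del: of_nat_Suc)
      next
        case True
        then show ?thesis using assms[of i] j by auto
      qed
      then show ?thesis using True unfolding k lookup_tE svec_def lookup_level_sum by (simp del: of_nat_Suc)
    next
      case False
      then show ?thesis unfolding k lookup_tE svec_def lookup_level_sum by simp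
    qed
  qed
  then show ?thesis by (auto simp: sing_def lvl_def svec_def lookup_level_sum)
qed

lemma svec_corner: "lk (svec \<mu> \<nu> m) (0, m) = 1"
  by (simp add: svec_def lookup_level_sum xc_def)

lemma exceptional_swap: "exceptional \<mu> \<nu> l \<Longrightarrow> exceptional \<nu> \<mu> l"
  unfolding exceptional_def by (metis add.commute)

text \<open>The factor with \<open>\<nu> = b\<close> truncates the solution after position \<open>l - 1 - b\<close>, which is at most \<open>a\<close>. Hence at the
  break \<open>\<mu> = a\<close> either the coefficient or the other factor is already zero.\<close>

lemma exceptional_corner_vector:
  assumes "exceptional \<mu> \<nu> l"
  shows "\<exists>s\<in>sing \<mu> \<nu> l. lk s (0, l) = 1 \<and> lk s (l, 0) = 0"
proof -
  obtain a b where ab: "\<mu> = of_nat a" "\<nu> = of_nat b" "a < l" "b < l" "l \<le> a + b + 1"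
    using assms by (auto simp: exceptional_def)
  have z: "xc \<mu> \<nu> l i = 0" if "l - Suc b < i" for i
    unfolding xc_def by (rule prod_zero) (use that ab in \<open>auto intro!: bexI[of _ "l - Suc b"]\<close>)
  have "svec \<mu> \<nu> l \<in> sing \<mu> \<nu> l"
  proof (rule svec_sing)
    fix i assume i: "i < l" "\<mu> = of_nat i"
    then have "i = a" using ab by simp
    then show "xc \<mu> \<nu> l i = 0 \<or> \<nu> = of_nat (l - Suc i)"
    proof (cases "l - Suc b < i")
      case False
      then have "b = l - Suc i" using ab \<open>i = a\<close> by auto
      then show ?thesis using ab(2) by blast
    qed (use z in blast)
  qed
  moreover have "lk (svec \<mu> \<nu> l) (l, 0) = 0"
    using z[of l] ab by (simp add: svec_def lookup_level_sum)
  ultimately show ?thesis using svec_corner by blast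
qed

lemma exceptional_corners:
  assumes ex: "exceptional \<mu> \<nu> l"
  obtains s1 s2 where "s1 \<in> sing \<mu> \<nu> l" "lk s1 (0, l) = 1" "lk s1 (l, 0) = 0"
    "s2 \<in> sing \<mu> \<nu> l" "lk s2 (0, l) = 0" "lk s2 (l, 0) = 1"
proof -
  obtain s1 where "s1 \<in> sing \<mu> \<nu> l" "lk s1 (0, l) = 1" "lk s1 (l, 0) = 0"
    using exceptional_corner_vector[OF ex] by blast
  moreover obtain s2 where "s2 \<in> sing \<nu> \<mu> l" "lk s2 (0, l) = 1" "lk s2 (l, 0) = 0"
    using exceptional_corner_vector[OF exceptional_swap[OF ex]] by blast
  ultimately show ?thesis using that[of s1 "swp s2"] swp_sing[of s2 \<nu> \<mu> l] by simp
qed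

text \<open>Together with \<open>exceptional_corners\<close>: the two corner coefficients are coordinates on the space of singular vectors.\<close>

lemma exceptional_corners_zero:
  assumes ex: "exceptional \<mu> \<nu> l" and p: "p \<in> sing \<mu> \<nu> l" and 0: "lk p (0, l) = 0" "lk p (l, 0) = 0"
  shows "p = 0"
proof (rule ccontr)
  assume p0: "p \<noteq> 0"
  obtain a b where ab: "\<mu> = of_nat a" "\<nu> = of_nat b" "a < l" "b < l" "l \<le> a + b + 1"
    using ex by (auto simp: exceptional_def)
  have na: "lk p (Suc a, l - Suc a) \<noteq> 0" using sing_corner_zero[OF p p0 0(1)] ab(1) by auto
  have "lk p (i, l - i) = 0" if "a < i" "i \<le> l" for i
    using that(2,1)
  proof (induction rule: inc_induct)
    case base then show ?case using 0 by simp
  next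
    case (step i)
    then have IH: "lk p (Suc i, l - Suc i) = 0" by simp
    have "of_nat (Suc (l - Suc i)) * (\<nu> - of_nat (l - Suc i)) * lk p (i, Suc (l - Suc i)) = 0"
      using sing_eq[OF p, of i "l - Suc i"] IH by simp
    moreover have "b \<noteq> l - Suc i" "Suc (l - Suc i) = l - i" "i < l" using step ab by auto
    ultimately show ?case unfolding ab(2) mult_eq_0_iff right_minus_eq of_nat_eq_iff of_nat_eq_0_iff by fastforce
  qed
  then show False using na ab by simp
qed

section \<open>Submodules generated by singular vectors\<close>

text \<open>The linear map that sends \<open>f^i v\<close> to \<open>F^i u\<close>. It is the homomorphism from a Verma module determined by a singular vector \<open>u\<close>.\<close>

definition orbit_map :: "(('b \<Rightarrow>\<^sub>0 complex) \<Rightarrow> ('b \<Rightarrow>\<^sub>0 complex)) \<Rightarrow> ('b \<Rightarrow>\<^sub>0 complex) \<Rightarrow> (nat \<Rightarrow>\<^sub>0 complex) \<Rightarrow> ('b \<Rightarrow>\<^sub>0 complex)" where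
  "orbit_map F u = pextend (\<lambda>i. (F ^^ i) u)"

lemma orbit_map_clinear: "clinear pscale pscale (orbit_map F u)"
  unfolding orbit_map_def by (rule pextend_clinear)

lemma orbit_map_basis [simp]: "orbit_map F u (basis_vec i) = (F ^^ i) u"
  by (simp add: orbit_map_def)

lemma orbit_map_intertwines:
  fixes E F H :: "('b \<Rightarrow>\<^sub>0 complex) \<Rightarrow> ('b \<Rightarrow>\<^sub>0 complex)"
  assumes lin: "clinear pscale pscale E" "clinear pscale pscale F" "clinear pscale pscale H"
    and EF: "\<And>v. E (F v) = F (E v) + H v" and HF: "\<And>v. H (F v) = F (H v) - pscale 2 (F v)"
    and u: "E u = 0" "H u = pscale \<kappa> u"
  shows "orbit_map F u (vF p) = F (orbit_map F u p)"
    "orbit_map F u (vH \<kappa> p) = H (orbit_map F u p)"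
    "orbit_map F u (vE \<kappa> p) = E (orbit_map F u p)"
proof -
  note sc = lin[THEN clinear_scale] and o = orbit_map_clinear
  have Hi: "H ((F ^^ i) u) = pscale (\<kappa> - 2 * of_nat i) ((F ^^ i) u)" for i
  proof (induction i)
    case (Suc i)
    have "H ((F ^^ Suc i) u) = pscale (\<kappa> - 2 * of_nat i) ((F ^^ Suc i) u) - pscale 2 ((F ^^ Suc i) u)"
      by (simp add: HF Suc sc)
    also have "\<dots> = pscale (\<kappa> - 2 * of_nat i - 2) ((F ^^ Suc i) u)" by (rule pm.scale_left_diff_distrib[symmetric])
    finally show ?case by (simp add: algebra_simps)
  qed (simp add: u)
  have Ei: "E ((F ^^ i) u) = pscale (of_nat i * (\<kappa> - of_nat i + 1)) ((F ^^ (i - 1)) u)" for i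
  proof (induction i)
    case (Suc i)
    have "F (pscale (of_nat i * (\<kappa> - of_nat i + 1)) ((F ^^ (i - 1)) u)) = pscale (of_nat i * (\<kappa> - of_nat i + 1)) ((F ^^ i) u)"
      by (cases i) (simp_all add: sc clinear_zero[OF lin(2)])
    then have "E ((F ^^ Suc i) u) = pscale (of_nat i * (\<kappa> - of_nat i + 1)) ((F ^^ i) u) + pscale (\<kappa> - 2 * of_nat i) ((F ^^ i) u)"
      by (simp add: EF Suc Hi)
    also have "\<dots> = pscale (of_nat i * (\<kappa> - of_nat i + 1) + (\<kappa> - 2 * of_nat i)) ((F ^^ i) u)"
      by (rule pm.scale_left_distrib[symmetric])
    also have "of_nat i * (\<kappa> - of_nat i + 1) + (\<kappa> - 2 * of_nat i) = of_nat (Suc i) * (\<kappa> - of_nat (Suc i) + 1)"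
      by (simp add: algebra_simps)
    finally show ?case by simp
  qed (simp add: u)
  show "orbit_map F u (vF p) = F (orbit_map F u p)"
    by (rule clinear_eqI[OF clinear_compose[OF v_clinear(2) o] clinear_compose[OF o lin(2)]]) simp
  show "orbit_map F u (vH \<kappa> p) = H (orbit_map F u p)"
    by (rule clinear_eqI[OF clinear_compose[OF v_clinear(3) o] clinear_compose[OF o lin(3)]])
      (simp add: Hi clinear_scale[OF o])
  show "orbit_map F u (vE \<kappa> p) = E (orbit_map F u p)"
    by (rule clinear_eqI[OF clinear_compose[OF v_clinear(1) o] clinear_compose[OF o lin(1)]])
      (simp add: Ei clinear_scale[OF o])
qed

lemma sing_iff: "u \<in> sing \<mu> \<nu> l \<longleftrightarrow> tE \<mu> \<nu> u = 0 \<and> tH \<mu> \<nu> u = pscale (\<mu> + \<nu> - 2 * of_nat l) u"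
  unfolding sing_def using lvl_iff by auto

lemma sing_orbit:
  assumes "u \<in> sing \<mu> \<nu> l"
  shows "orbit_map tF u (vF p) = tF (orbit_map tF u p)"
    "orbit_map tF u (vH (\<mu> + \<nu> - 2 * of_nat l) p) = tH \<mu> \<nu> (orbit_map tF u p)"
    "orbit_map tF u (vE (\<mu> + \<nu> - 2 * of_nat l) p) = tE \<mu> \<nu> (orbit_map tF u p)"
proof -
  have u: "tE \<mu> \<nu> u = 0" "tH \<mu> \<nu> u = pscale (\<mu> + \<nu> - 2 * of_nat l) u" using assms by (simp_all add: sing_iff)
  note r = orbit_map_intertwines[where E = "tE \<mu> \<nu>" and F = tF and H = "tH \<mu> \<nu>",
      OF t_clinear(1) t_clinear(2) t_clinear(3) t_rel(1) t_rel(3) u]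
  show "orbit_map tF u (vF p) = tF (orbit_map tF u p)"
    "orbit_map tF u (vH (\<mu> + \<nu> - 2 * of_nat l) p) = tH \<mu> \<nu> (orbit_map tF u p)"
    "orbit_map tF u (vE (\<mu> + \<nu> - 2 * of_nat l) p) = tE \<mu> \<nu> (orbit_map tF u p)"
    by (rule r)+
qed

section \<open>Generalised Casimir eigenvectors in the tensor product\<close>

lemma tF_eq_0: "tF v = 0 \<longleftrightarrow> v = 0"
proof
  assume *: "tF v = 0"
  have "lk v (i, j) = 0" for i j
  proof (induction i arbitrary: j)
    case 0
    show ?case using lookup_tF[of v 0 "Suc j"] * by simp
  next
    case (Suc i)
    show ?case using lookup_tF[of v "Suc i" "Suc j"] * Suc by simp
  qed
  then show "v = 0" by (intro poly_mapping_eqI) auto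
qed (simp add: clinear_zero[OF t_clinear(2)])

lemma tF_pow_eq_0: "(tF ^^ k) v = 0 \<longleftrightarrow> v = 0"
  by (induction k) (simp_all add: tF_eq_0)

lemma tF_lvl: "v \<in> lvl m \<Longrightarrow> tF v \<in> lvl (Suc m)"
  unfolding lvl_iff[of v m 0 0] lvl_iff[of "tF v" "Suc m" 0 0]
  by (simp add: t_rel t_scale clinear_neg[OF t_clinear(2)] algebra_simps)

lemma tF_pow_lvl: "v \<in> lvl m \<Longrightarrow> (tF ^^ k) v \<in> lvl (m + k)"
  by (induction k) (simp_all add: tF_lvl)

text \<open>Identify level \<open>m\<close> with homogeneous polynomials of degree \<open>m\<close> in \<open>x\<close> and \<open>y\<close>, so that \<open>tF\<close> is multiplication by \<open>x + y\<close>. This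
  functional is evaluation at \<open>(- 1, 1)\<close>, whose kernel is the image of \<open>tF\<close>.\<close>

definition dl :: "nat \<Rightarrow> (nat \<times> nat \<Rightarrow>\<^sub>0 complex) \<Rightarrow> complex" where
  "dl m v = (\<Sum>i\<le>m. (- 1) ^ i * lk v (i, m - i))"

lemma dl_clinear: "clinear pscale (*) (dl m)"
  by (rule clinearI) (simp_all add: dl_def lookup_add pm.vector_space_axioms vector_space_complex
      algebra_simps sum.distrib sum_distrib_left)

lemma dl_tF: "dl m (tF v) = 0"
proof (cases m)
  case 0 then show ?thesis by (simp add: dl_def lookup_tF)
next
  case (Suc m')
  have "dl m (tF v) = (\<Sum>i\<le>m. (- 1) ^ i * (case i of 0 \<Rightarrow> 0 | Suc i' \<Rightarrow> lk v (i', m - i)))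
      + (\<Sum>i\<le>m. (- 1) ^ i * (case m - i of 0 \<Rightarrow> 0 | Suc j' \<Rightarrow> lk v (i, j')))"
    by (simp add: dl_def lookup_tF algebra_simps sum.distrib)
  also have "(\<Sum>i\<le>m. (- 1) ^ i * (case i of 0 \<Rightarrow> 0 | Suc i' \<Rightarrow> lk v (i', m - i))) = - (\<Sum>i\<le>m'. (- 1) ^ i * lk v (i, m' - i))"
    unfolding Suc sum.atMost_Suc_shift by (simp add: sum_negf)
  also have "(\<Sum>i\<le>m. (- 1) ^ i * (case m - i of 0 \<Rightarrow> 0 | Suc j' \<Rightarrow> lk v (i, j'))) = (\<Sum>i\<le>m'. (- 1) ^ i * lk v (i, m' - i))"
    unfolding Suc sum.atMost_Suc by (auto intro!: sum.cong simp: Suc_diff_le)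
  finally show ?thesis by simp
qed

text \<open>Division of a polynomial by \<open>x + y\<close>; the remainder is \<^const>\<open>dl\<close>.\<close>

lemma tF_image:
  assumes v: "v \<in> lvl (Suc m)" and d: "dl (Suc m) v = 0"
  shows "\<exists>v'\<in>lvl m. v = tF v'"
proof -
  define x where "x k = lk v (k, Suc m - k)" for k
  define y where "y i = (- 1) ^ i * (\<Sum>k\<le>i. (- 1) ^ k * x k)" for i
  have pm1: "(- 1 :: complex) ^ k * ((- 1) ^ k * z) = z" for k z
    by (simp flip: mult.assoc power_mult_distrib)
  have yS: "y i + y (Suc i) = x (Suc i)" for i
    using pm1[of i "x (Suc i)"] by (simp add: y_def algebra_simps)
  have "(\<Sum>k\<le>m. (- 1) ^ k * x k) = (- 1) ^ m * x (Suc m)"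
    using d by (simp add: dl_def x_def)
  then have ym: "y m = x (Suc m)" using pm1[of m] by (simp add: y_def)
  define v' where "v' = (\<Sum>i\<le>m. pscale (y i) (basis_vec (i, m - i)))"
  have v': "lk v' (i, j) = (if i + j = m then y i else 0)" for i j
    unfolding v'_def by (rule lookup_level_sum)
  have "v = tF v'"
  proof (rule poly_mapping_eqI)
    fix k :: "nat \<times> nat"
    obtain i j where k: "k = (i, j)" by fastforce
    show "lk v k = lk (tF v') k"
    proof (cases "i + j = Suc m")
      case False
      then show ?thesis using lvlD[OF v, of i j] unfolding k lookup_tF v' by (auto split: nat.splits)
    next
      case ij: True
      then have vx: "lk v (i, j) = x i" by (auto simp: x_def simp flip: ij)
      show ?thesis
      proof (cases i)
        case 0
        then show ?thesis using ij vx unfolding k lookup_tF v' by (simp add: y_def)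
      next
        case (Suc i')
        then show ?thesis using ij vx ym yS[of i'] unfolding k lookup_tF v' by (cases j) auto
      qed
    qed
  qed
  moreover have "v' \<in> lvl m" by (simp add: lvl_def v')
  ultimately show ?thesis by blast
qed

lemma lvl_0_dl: "v \<in> lvl 0 \<Longrightarrow> dl 0 v = 0 \<Longrightarrow> v = 0"
  using lvl_first[of v 0] by (auto simp: dl_def)

text \<open>The action of the shifted Casimir element \<open>cas c\<close>.\<close>

definition tC :: "complex \<Rightarrow> complex \<Rightarrow> complex \<Rightarrow> (nat \<times> nat \<Rightarrow>\<^sub>0 complex) \<Rightarrow> (nat \<times> nat \<Rightarrow>\<^sub>0 complex)" where
  "tC \<mu> \<nu> c v = pscale 4 (tF (tE \<mu> \<nu> v)) + tH \<mu> \<nu> (tH \<mu> \<nu> v) + pscale 2 (tH \<mu> \<nu> v) - pscale c v"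

lemma tC_clinear: "clinear pscale pscale (tC \<mu> \<nu> c)"
  by (rule clinearI) (simp_all add: tC_def t_add t_scale pm.vector_space_axioms pm.scale_right_distrib
      pm.scale_right_diff_distrib mult.commute)

lemmas tCN_clinear = clinear_funpow[OF tC_clinear]

lemma tC_tF: "tC \<mu> \<nu> c (tF v) = tF (tC \<mu> \<nu> c v)"
proof -
  have 4: "pscale 4 (tF (tH \<mu> \<nu> v)) = pscale 2 (tF (tH \<mu> \<nu> v)) + pscale 2 (tF (tH \<mu> \<nu> v))"
    by (simp flip: pm.scale_left_distrib)
  show ?thesis
    by (simp add: tC_def t_rel t_add t_scale clinear_diff[OF t_clinear(2)] clinear_diff[OF t_clinear(3)]
        pm.scale_right_distrib pm.scale_right_diff_distrib 4)
qed

lemma tC_pow_tF: "(tC \<mu> \<nu> c ^^ N) (tF v) = tF ((tC \<mu> \<nu> c ^^ N) v)"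
  by (induction N) (simp_all add: tC_tF)

lemma tC_lvl_eq:
  assumes "v \<in> lvl m" and "\<omega> = \<mu> + \<nu> - 2 * of_nat m"
  shows "tC \<mu> \<nu> c v = pscale 4 (tF (tE \<mu> \<nu> v)) + pscale (\<omega> * \<omega> + 2 * \<omega> - c) v"
proof -
  have "tH \<mu> \<nu> v = pscale \<omega> v" using assms lvl_iff by blast
  then show ?thesis by (simp add: tC_def t_scale pm.scale_left_distrib pm.scale_left_diff_distrib)
qed

lemma tC_lvl: "v \<in> lvl m \<Longrightarrow> tC \<mu> \<nu> c v \<in> lvl m"
proof -
  assume v: "v \<in> lvl m"
  have "tH \<mu> \<nu> (tF (tE \<mu> \<nu> v)) = pscale (\<mu> + \<nu> - 2 * of_nat m) (tF (tE \<mu> \<nu> v))"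
    using v unfolding lvl_iff[of v m \<mu> \<nu>] by (simp add: t_rel t_add t_scale)
  then have "tF (tE \<mu> \<nu> v) \<in> lvl m" unfolding lvl_iff[of _ m \<mu> \<nu>] .
  then show ?thesis unfolding tC_lvl_eq[OF v refl] by (intro lvl_add lvl_scale v)
qed

lemma tC_pow_lvl: "v \<in> lvl m \<Longrightarrow> (tC \<mu> \<nu> c ^^ N) v \<in> lvl m"
  by (induction N) (simp_all add: tC_lvl)

lemma dl_tC_pow:
  assumes "v \<in> lvl m" and "\<omega> = \<mu> + \<nu> - 2 * of_nat m"
  shows "dl m ((tC \<mu> \<nu> c ^^ N) v) = (\<omega> * \<omega> + 2 * \<omega> - c) ^ N * dl m v"
proof (induction N)
  case (Suc N)
  then show ?case
    by (simp add: tC_lvl_eq[OF tC_pow_lvl[OF assms(1)] assms(2)] clinear_add[OF dl_clinear]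
        clinear_scale[OF dl_clinear] dl_tF)
qed simp

text \<open>On level \<open>m\<close> modulo the image of \<open>tF\<close> the Casimir element acts by a scalar. Unless that scalar is the central value,
  a generalised eigenvector lies in the image, and its preimage is a generalised eigenvector as well.\<close>

lemma casimir_descent:
  assumes v: "v \<in> lvl m" and N: "(tC \<mu> \<nu> c ^^ N) v = 0" and \<omega>: "\<omega> = \<mu> + \<nu> - 2 * of_nat m"
    and d: "\<omega> * \<omega> + 2 * \<omega> = c \<Longrightarrow> dl m v = 0"
  shows "v = 0 \<or> (\<exists>m' v'. m = Suc m' \<and> v' \<in> lvl m' \<and> v = tF v' \<and> (tC \<mu> \<nu> c ^^ N) v' = 0)"
proof -
  have d0: "dl m v = 0"
    using dl_tC_pow[OF v \<omega>, where c = c and N = N] N d by (auto simp: clinear_zero[OF dl_clinear])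
  show ?thesis
  proof (cases m)
    case 0
    then show ?thesis using lvl_0_dl v d0 by simp
  next
    case (Suc m')
    then obtain v' where v': "v' \<in> lvl m'" "v = tF v'" using tF_image[of v m'] v d0 by auto
    then have "(tC \<mu> \<nu> c ^^ N) v' = 0" using N by (simp add: tC_pow_tF tF_eq_0)
    then show ?thesis using v' Suc by blast
  qed
qed

definition proj :: "nat \<Rightarrow> (nat \<times> nat \<Rightarrow>\<^sub>0 complex) \<Rightarrow> (nat \<times> nat \<Rightarrow>\<^sub>0 complex)" where
  "proj m = pextend (\<lambda>(i, j). if i + j = m then basis_vec (i, j) else 0)"

lemma proj_clinear: "clinear pscale pscale (proj m)"
  unfolding proj_def by (rule pextend_clinear)

lemma lookup_proj: "lk (proj m v) (i, j) = (if i + j = m then lk v (i, j) else 0)"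
proof -
  have 2: "clinear pscale (*) (\<lambda>v. if i + j = m then lk v (i, j) else 0)"
    by (rule clinearI) (simp_all add: lookup_add pm.vector_space_axioms vector_space_complex)
  show ?thesis
    by (rule clinear_eqI[OF lookup_clinear[OF proj_clinear] 2]) (auto simp: proj_def lookup_single when_def split: if_splits)
qed

lemma proj_lvl: "proj m v \<in> lvl m"
  by (simp add: lvl_def lookup_proj)

lemma proj_of_lvl: "v \<in> lvl m' \<Longrightarrow> proj m v = (if m' = m then v else 0)"
  by (rule poly_mapping_eqI) (auto simp: lookup_proj lvl_def)

lemma basis_lvl: "basis_vec (i, j) \<in> lvl (i + j)"
  by (auto simp: lvl_def lookup_single when_def)

lemma proj_tC: "proj m (tC \<mu> \<nu> c v) = tC \<mu> \<nu> c (proj m v)"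
proof (rule clinear_eqI[OF clinear_compose[OF tC_clinear proj_clinear] clinear_compose[OF proj_clinear tC_clinear]])
  fix k :: "nat \<times> nat"
  obtain i j where k: "k = (i, j)" by fastforce
  show "proj m (tC \<mu> \<nu> c (basis_vec k)) = tC \<mu> \<nu> c (proj m (basis_vec k))"
    unfolding k proj_of_lvl[OF basis_lvl] proj_of_lvl[OF tC_lvl[OF basis_lvl]]
    by (simp add: clinear_zero[OF tC_clinear])
qed

lemma proj_tC_pow: "proj m ((tC \<mu> \<nu> c ^^ N) v) = (tC \<mu> \<nu> c ^^ N) (proj m v)"
  by (induction N) (simp_all add: proj_tC)

text \<open>Reduces generalised eigenvectors to homogeneous ones, since the projections commute with the Casimir element.\<close>

lemma sum_proj: "\<exists>M. v = (\<Sum>m\<le>M. proj m v)"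
proof -
  define M where "M = Max (insert 0 ((\<lambda>(i, j). i + j) ` keys v))"
  have M: "i + j \<le> M" if "(i, j) \<in> keys v" for i j
    unfolding M_def by (rule Max_ge) (use that in force)+
  have "v = (\<Sum>m\<le>M. proj m v)"
  proof (rule poly_mapping_eqI)
    fix k :: "nat \<times> nat"
    obtain i j where k: "k = (i, j)" by fastforce
    show "lk v k = lk (\<Sum>m\<le>M. proj m v) k"
      using M[of i j] by (auto simp: k lookup_sum lookup_proj in_keys_iff)
  qed
  then show ?thesis ..
qed

text \<open>The situation of the exceptional case: \<open>w\<close> generates the larger Verma module, and \<open>u\<close> is a second singular
  vector on the level of the embedded one. The assumption on \<open>\<mu> + \<nu>\<close> says that the two weights are linked.\<close>

context
  fixes \<mu> \<nu> c :: complex and n l :: nat and w u :: "nat \<times> nat \<Rightarrow>\<^sub>0 complex"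
  assumes \<mu>\<nu>: "\<mu> + \<nu> = of_nat n + of_nat l - 1" and nl: "n < l"
    and c: "c = (\<mu> + \<nu> - 2 * of_nat l)\<^sup>2 + 2 * (\<mu> + \<nu> - 2 * of_nat l)"
    and w: "w \<in> sing \<mu> \<nu> n" "w \<noteq> 0" and u: "u \<in> sing \<mu> \<nu> l" and ind: "\<And>a. u \<noteq> pscale a ((tF ^^ (l - n)) w)"
begin

lemma casimir_value_iff:
  "(\<mu> + \<nu> - 2 * of_nat m) * (\<mu> + \<nu> - 2 * of_nat m) + 2 * (\<mu> + \<nu> - 2 * of_nat m) = c \<longleftrightarrow> m = n \<or> m = l"
proof -
  have "(\<mu> + \<nu> - 2 * of_nat m) * (\<mu> + \<nu> - 2 * of_nat m) + 2 * (\<mu> + \<nu> - 2 * of_nat m) - c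
      = 4 * (of_nat m - of_nat n) * (of_nat m - of_nat l)"
    unfolding c \<mu>\<nu> by (simp add: power2_eq_square algebra_simps)
  then have "(\<mu> + \<nu> - 2 * of_nat m) * (\<mu> + \<nu> - 2 * of_nat m) + 2 * (\<mu> + \<nu> - 2 * of_nat m) = c
      \<longleftrightarrow> 4 * (of_nat m - of_nat n) * (of_nat m - of_nat l :: complex) = 0"
    using right_minus_eq by metis
  then show ?thesis unfolding mult_eq_0_iff right_minus_eq of_nat_eq_iff by simp
qed

lemma tC_sing: "s \<in> sing \<mu> \<nu> m \<Longrightarrow> m = n \<or> m = l \<Longrightarrow> tC \<mu> \<nu> c s = 0"
  using tC_lvl_eq[of s m _ \<mu> \<nu> c, OF _ refl] casimir_value_iff[of m]
  by (simp add: sing_def clinear_zero[OF t_clinear(2)])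

lemma tC_pow_sing:
  assumes "s \<in> sing \<mu> \<nu> m" "m = n \<or> m = l" "(tC \<mu> \<nu> c ^^ N) v = 0"
  shows "(tC \<mu> \<nu> c ^^ Suc N) (v - pscale a s) = 0"
proof -
  have "(tC \<mu> \<nu> c ^^ Suc N) v = 0"
    using assms(3) by (simp add: clinear_zero[OF tC_clinear])
  moreover have "(tC \<mu> \<nu> c ^^ Suc N) s = 0"
    unfolding funpow_Suc_right o_apply tC_sing[OF assms(1,2)] by (rule clinear_zero[OF tCN_clinear])
  ultimately show ?thesis by (simp only: clinear_diff[OF tCN_clinear] clinear_scale[OF tCN_clinear] pm.scale_zero_right diff_self)
qed

lemma below: "m < n \<Longrightarrow> v \<in> lvl m \<Longrightarrow> (tC \<mu> \<nu> c ^^ N) v = 0 \<Longrightarrow> v = 0"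
proof (induction m arbitrary: v)
  case 0
  then show ?case using casimir_descent[OF 0(2,3) refl] casimir_value_iff[of 0] nl by auto
next
  case (Suc m)
  from casimir_descent[OF Suc.prems(2,3) refl] casimir_value_iff[of "Suc m"] Suc.prems(1) nl
  consider "v = 0" | v' where "v' \<in> lvl m" "v = tF v'" "(tC \<mu> \<nu> c ^^ N) v' = 0" by auto
  then show ?case using Suc.IH Suc.prems(1) by cases (auto simp: tF_eq_0)
qed

text \<open>If \<open>w\<close> were in the image of \<open>tF\<close>, its preimage would be a generalised eigenvector below the first linked level,
  where there are none.\<close>

lemma dl_w: "dl n w \<noteq> 0"
proof
  assume d: "dl n w = 0"
  have "w \<in> lvl n" "(tC \<mu> \<nu> c ^^ 1) w = 0" using w tC_sing[OF w(1)] by (simp_all add: sing_def)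
  from casimir_descent[OF this refl d] w(2)
  obtain m' v' where "n = Suc m'" "v' \<in> lvl m'" "w = tF v'" "(tC \<mu> \<nu> c ^^ 1) v' = 0" by blast
  then show False using below[of m' v' 1] w(2) by (simp add: tF_eq_0)
qed

lemma dl_reduce:
  assumes "s \<in> sing \<mu> \<nu> m" "m = n \<or> m = l" "dl m s \<noteq> 0" and v: "v \<in> lvl m" "(tC \<mu> \<nu> c ^^ N) v = 0"
  obtains a where "v = pscale a s"
  | a m' v' N where "m = Suc m'" "v' \<in> lvl m'" "v = pscale a s + tF v'" "(tC \<mu> \<nu> c ^^ N) v' = 0"
proof -
  define a where "a = dl m v / dl m s"
  have "v - pscale a s \<in> lvl m" using v assms(1) by (intro lvl_sub lvl_scale) (auto simp: sing_def)
  moreover have "dl m (v - pscale a s) = 0"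
    using assms(3) by (simp add: clinear_diff[OF dl_clinear] clinear_scale[OF dl_clinear] a_def)
  ultimately have "v - pscale a s = 0 \<or> (\<exists>m' v'. m = Suc m' \<and> v' \<in> lvl m' \<and> v - pscale a s = tF v' \<and> (tC \<mu> \<nu> c ^^ Suc N) v' = 0)"
    using casimir_descent[OF _ tC_pow_sing[OF assms(1,2) v(2)] refl] by blast
  then show ?thesis
  proof (elim disjE exE conjE)
    assume "v - pscale a s = 0" then show ?thesis using that(1)[of a] by simp
  next
    fix m' v' assume *: "m = Suc m'" "v' \<in> lvl m'" "v - pscale a s = tF v'" "(tC \<mu> \<nu> c ^^ Suc N) v' = 0"
    then have "v = pscale a s + tF v'" by (simp add: algebra_simps)
    then show ?thesis using that(2)[of m' v' a "Suc N"] * by blast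
  qed
qed

text \<open>Up to level \<open>l\<close> the only generalised eigenvectors are those generated by \<open>w\<close>.\<close>

lemma between: "m < l \<Longrightarrow> n \<le> m \<Longrightarrow> v \<in> lvl m \<Longrightarrow> (tC \<mu> \<nu> c ^^ N) v = 0 \<Longrightarrow> \<exists>a. v = pscale a ((tF ^^ (m - n)) w)"
proof (induction m arbitrary: v N rule: less_induct)
  case (less m)
  show ?case
  proof (cases "m = n")
    case True
    have "v \<in> lvl n" using less.prems True by simp
    from dl_reduce[OF w(1) disjI1[OF refl] dl_w this less.prems(4)]
    show ?thesis
    proof cases
      case (1 a) then show ?thesis using True by auto
    next
      case (2 a m' v' N')
      then have "v' = 0" using below[of m' v' N'] by simp
      then show ?thesis using 2 True by (auto simp: clinear_zero[OF t_clinear(2)])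
    qed
  next
    case False
    with less.prems casimir_descent[OF less.prems(3,4) refl] casimir_value_iff[of m]
    consider "v = 0" | m' v' where "m = Suc m'" "v' \<in> lvl m'" "v = tF v'" "(tC \<mu> \<nu> c ^^ N) v' = 0" by auto
    then show ?thesis
    proof cases
      case 1 then show ?thesis by (auto intro!: exI[of _ 0])
    next
      case 2
      then obtain a where "v' = pscale a ((tF ^^ (m' - n)) w)"
        using less.IH[of m' v' N] less.prems False by auto
      moreover have "m - n = Suc (m' - n)" using 2(1) less.prems False by auto
      ultimately show ?thesis using 2 by (auto simp: t_scale)
    qed
  qed
qed

text \<open>If \<open>u\<close> were in the image of \<open>tF\<close>, then by \<open>between\<close> it would be a multiple of \<open>f^(l - n) w\<close>.\<close>

lemma dl_u: "dl l u \<noteq> 0"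
proof
  assume d: "dl l u = 0"
  have "u \<in> lvl l" "(tC \<mu> \<nu> c ^^ 1) u = 0" using u tC_sing[OF u] by (simp_all add: sing_def)
  moreover have "u \<noteq> 0" using ind[of 0] by simp
  ultimately obtain m' v' where *: "l = Suc m'" "v' \<in> lvl m'" "u = tF v'" "(tC \<mu> \<nu> c ^^ 1) v' = 0"
    using casimir_descent[where v = u and m = l and N = 1 and c = c, OF _ _ refl d] by blast
  then obtain a where "v' = pscale a ((tF ^^ (m' - n)) w)" using between[of m' v' 1] nl by auto
  moreover have "l - n = Suc (m' - n)" using * nl by auto
  ultimately show False using ind[of a] * by (simp add: t_scale)
qed

definition blk :: "(nat \<times> nat \<Rightarrow>\<^sub>0 complex) set" where
  "blk = range (\<lambda>(p, q). orbit_map tF u p + orbit_map tF w q)"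

lemma blkI: "orbit_map tF u p + orbit_map tF w q \<in> blk"
  by (auto simp: blk_def)

lemma blk_add: "a \<in> blk \<Longrightarrow> b \<in> blk \<Longrightarrow> a + b \<in> blk"
proof -
  assume "a \<in> blk" "b \<in> blk"
  then obtain p q p' q' where "a = orbit_map tF u p + orbit_map tF w q" "b = orbit_map tF u p' + orbit_map tF w q'"
    unfolding blk_def by auto
  then have "a + b = orbit_map tF u (p + p') + orbit_map tF w (q + q')"
    by (simp add: clinear_add[OF orbit_map_clinear])
  then show ?thesis using blkI by simp
qed

lemma blk_zero: "0 \<in> blk"
  using blkI[of 0 0] by (simp add: clinear_zero[OF orbit_map_clinear])

lemma blk_tF: "a \<in> blk \<Longrightarrow> tF a \<in> blk"
proof -
  assume "a \<in> blk"
  then obtain p q where "a = orbit_map tF u p + orbit_map tF w q" unfolding blk_def by auto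
  then have "tF a = orbit_map tF u (vF p) + orbit_map tF w (vF q)"
    by (simp add: t_add sing_orbit[OF u] sing_orbit[OF w(1)])
  then show ?thesis using blkI by simp
qed

lemma blk_u: "pscale a u \<in> blk" and blk_w: "pscale a w \<in> blk"
  using blkI[of "pscale a (basis_vec 0)" 0] blkI[of 0 "pscale a (basis_vec 0)"]
  by (simp_all add: clinear_zero[OF orbit_map_clinear] clinear_scale[OF orbit_map_clinear])

text \<open>The descent never leaves the submodule generated by \<open>u\<close> and \<open>w\<close>: on the levels \<open>n\<close> and \<open>l\<close> a multiple of the
  generator is subtracted first, which makes \<^const>\<open>dl\<close> vanish.\<close>

lemma level_in_blk: "v \<in> lvl m \<Longrightarrow> (tC \<mu> \<nu> c ^^ N) v = 0 \<Longrightarrow> v \<in> blk"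
proof (induction m arbitrary: v N rule: less_induct)
  case (less m)
  consider "m = n" | "m = l" | "m \<noteq> n" "m \<noteq> l" by blast
  then show ?case
  proof cases
    case 1
    from dl_reduce[OF w(1) disjI1[OF refl] dl_w less.prems(1)[unfolded 1] less.prems(2)]
    show ?thesis
    proof cases
      case (2 a m' v' N)
      then show ?thesis using less.IH[of m' v' N] 1 by (auto intro!: blk_add blk_w blk_tF)
    qed (simp add: blk_w)
  next
    case m: 2
    from dl_reduce[OF u disjI2[OF refl] dl_u less.prems(1)[unfolded m] less.prems(2)]
    show ?thesis
    proof cases
      case (2 a m' v' N)
      then show ?thesis using less.IH[of m' v' N] m by (auto intro!: blk_add blk_u blk_tF)
    qed (simp add: blk_u)
  next
    case 3
    from 3 casimir_descent[OF less.prems refl] casimir_value_iff[of m]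
    consider "v = 0" | m' v' where "m = Suc m'" "v' \<in> lvl m'" "v = tF v'" "(tC \<mu> \<nu> c ^^ N) v' = 0" by auto
    then show ?thesis using less.IH by cases (auto intro!: blk_zero blk_tF)
  qed
qed

lemma generalised_eigenvector_in_blk:
  assumes "(tC \<mu> \<nu> c ^^ N) v = 0"
  shows "v \<in> blk"
proof -
  obtain M where M: "v = (\<Sum>m\<le>M. proj m v)" using sum_proj by blast
  have p: "proj m v \<in> blk" for m
    using level_in_blk[OF proj_lvl] proj_tC_pow[where m = m and N = N and c = c and v = v and \<mu> = \<mu> and \<nu> = \<nu>] assms by (simp add: clinear_zero[OF proj_clinear])
  have "(\<Sum>m\<in>A. proj m v) \<in> blk" if "finite A" for A
    using that by (induction A) (auto intro: blk_zero blk_add p)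
  then show ?thesis using M by (metis finite_atMost)
qed

lemma proj_orbit:
  assumes "s \<in> sing \<mu> \<nu> m"
  shows "proj (m + i) (orbit_map tF s p) = pscale (lk p i) ((tF ^^ i) s)"
    "d < m \<Longrightarrow> proj d (orbit_map tF s p) = 0"
proof -
  have s: "(tF ^^ k) s \<in> lvl (m + k)" for k using assms by (intro tF_pow_lvl) (simp add: sing_def)
  have 1: "clinear pscale pscale (\<lambda>p. pscale (lk p i) ((tF ^^ i) s))"
    by (rule clinearI) (simp_all add: lookup_add pm.scale_left_distrib pm.vector_space_axioms)
  show "proj (m + i) (orbit_map tF s p) = pscale (lk p i) ((tF ^^ i) s)"
    by (rule clinear_eqI[OF clinear_compose[OF orbit_map_clinear proj_clinear] 1])
      (simp add: proj_of_lvl[OF s] lookup_single when_def)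
  have 0: "clinear pscale pscale (\<lambda>p :: nat \<Rightarrow>\<^sub>0 complex. 0 :: nat \<times> nat \<Rightarrow>\<^sub>0 complex)"
    by (rule clinearI) (simp_all add: pm.vector_space_axioms)
  show "proj d (orbit_map tF s p) = 0" if "d < m"
    by (rule clinear_eqI[OF clinear_compose[OF orbit_map_clinear proj_clinear] 0])
      (use that in \<open>simp add: proj_of_lvl[OF s]\<close>)
qed

text \<open>The sum is direct. Projecting to level \<open>l + i\<close> and cancelling \<open>tF ^^ i\<close> leaves a linear relation between \<open>u\<close> and
  \<open>f^(l - n) w\<close>; below level \<open>l\<close> only multiples of \<open>f^i w\<close> occur.\<close>

lemma orbit_sum_eq_0:
  assumes eq: "orbit_map tF u p + orbit_map tF w q = 0"
  shows "p = 0 \<and> q = 0"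
proof -
  have pr: "proj d (orbit_map tF u p) + proj d (orbit_map tF w q) = 0" for d
    using eq by (metis clinear_add[OF proj_clinear] clinear_zero[OF proj_clinear])
  have u0: "u \<noteq> 0" using ind[of 0] by simp
  have top: "lk p i = 0 \<and> lk q (l - n + i) = 0" for i
  proof -
    let ?x = "pscale (lk p i) u + pscale (lk q (l - n + i)) ((tF ^^ (l - n)) w)"
    have li: "n + (l - n + i) = l + i" using nl by simp
    have "(tF ^^ i) ?x = pscale (lk p i) ((tF ^^ i) u) + pscale (lk q (l - n + i)) ((tF ^^ (l - n + i)) w)"
      unfolding clinear_add[OF clinear_funpow[OF t_clinear(2)]] clinear_scale[OF clinear_funpow[OF t_clinear(2)]]
        add.commute[of "l - n" i] funpow_add o_apply ..
    also have "\<dots> = 0"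
      using pr[of "l + i"] proj_orbit(1)[OF u, of i p] proj_orbit(1)[OF w(1), of "l - n + i" q] li by simp
    finally have x: "?x = 0" by (simp add: tF_pow_eq_0)
    have p0: "lk p i = 0"
    proof (rule ccontr)
      assume p0: "lk p i \<noteq> 0"
      have "pscale (lk p i) u = pscale (- lk q (l - n + i)) ((tF ^^ (l - n)) w)"
        using x by (simp add: eq_neg_iff_add_eq_0 pm.scale_minus_left)
      then have "pscale (1 / lk p i) (pscale (lk p i) u) = pscale (1 / lk p i) (pscale (- lk q (l - n + i)) ((tF ^^ (l - n)) w))"
        by simp
      then have "u = pscale (1 / lk p i * - lk q (l - n + i)) ((tF ^^ (l - n)) w)"
        using p0 unfolding pm.scale_scale by simp
      then show False using ind by blast
    qed
    then have "pscale (lk q (l - n + i)) ((tF ^^ (l - n)) w) = 0" using x by simp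
    then show ?thesis using p0 w(2) by (simp add: tF_pow_eq_0)
  qed
  have low: "lk q i = 0" if "i < l - n" for i
    using pr[of "n + i"] proj_orbit(1)[OF w(1), of i q] proj_orbit(2)[OF u, of "n + i" p] that w(2)
    by (simp add: tF_pow_eq_0)
  have "lk q i = 0" for i
    using low[of i] top[of "i - (l - n)"] by (cases "i < l - n") auto
  then show ?thesis using top by (auto intro!: poly_mapping_eqI)
qed

end

section \<open>Rankin-Cohen brackets\<close>

lemma desc_factorial_eq_0: "desc_factorial x n = 0 \<longleftrightarrow> (\<exists>i<n. x = of_nat i)"
  by (auto simp: desc_factorial_def)

lemma deriv_pow_exp: "(deriv ^^ n) (\<lambda>w. c * exp (a + t * w)) = (\<lambda>w :: complex. t ^ n * (c * exp (a + t * w)))"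
proof (induction n)
  case (Suc n)
  have "deriv (\<lambda>w. t ^ n * (c * exp (a + t * w))) x = t ^ Suc n * (c * exp (a + t * x))" for x
    by (rule DERIV_imp_deriv) (auto intro!: derivative_eq_intros)
  then show ?case unfolding funpow.simps o_apply Suc by (rule ext)
qed simp

lemma mixed_deriv_exp: "mixed_deriv m n (\<lambda>(z1, z2). exp (z1 + t * z2)) (0, 0) = t ^ n"
proof -
  have "(deriv ^^ n) (\<lambda>w2. exp (w1 + t * w2)) = (\<lambda>w2. t ^ n * exp (w1 + t * w2))" for w1
    using deriv_pow_exp[of n 1 w1 t] by simp
  then have "mixed_deriv m n (\<lambda>(z1, z2). exp (z1 + t * z2)) (0, 0) = (deriv ^^ m) (\<lambda>w1. t ^ n * exp w1) 0"
    by (simp add: mixed_deriv_def)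
  also have "\<dots> = t ^ n" using deriv_pow_exp[of m "t ^ n" 0 1] by simp
  finally show ?thesis .
qed

lemma holomorphic2_exp: "holomorphic2 (\<lambda>(z1, z2). exp (z1 + t * z2)) UNIV"
  unfolding holomorphic2_def
proof
  fix p :: "complex \<times> complex"
  let ?g = "\<lambda>q :: complex \<times> complex. fst q + t * snd q"
  have g: "(?g has_derivative ?g) (at p)" by (auto intro!: derivative_eq_intros)
  have "(exp has_derivative (*) (exp (?g p))) (at (?g p))"
    using DERIV_exp[of "?g p"] by (simp add: has_field_derivative_def)
  from has_derivative_compose[OF g this]
  have "((\<lambda>(z1, z2). exp (z1 + t * z2)) has_derivative (\<lambda>(w1, w2). exp (?g p) * w1 + (exp (?g p) * t) * w2)) (at p)"
    by (simp add: case_prod_unfold algebra_simps)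
  then show "\<exists>a b. ((\<lambda>(z1, z2). exp (z1 + t * z2)) has_derivative (\<lambda>(w1, w2). a * w1 + b * w2)) (at p)"
    by blast
qed

lemma rc_order_eq: "lam3 - lam1 - lam2 = 2 * of_nat l \<Longrightarrow> rc_order lam1 lam2 lam3 = l"
  unfolding rc_order_def by (rule the_equality) auto

text \<open>The symbol of the bracket is obtained by applying it to \<open>exp (z\<^sub>1 + t z\<^sub>2)\<close> at the origin, and a polynomial in \<open>t\<close> that
  vanishes identically has zero coefficients. The two falling factorials in the coefficient of \<open>j\<close> vanish for
  \<open>j \<ge> l - a\<close> and for \<open>j \<le> b\<close> respectively, and these ranges cover all \<open>j \<le> l\<close> iff \<open>l \<le> a + b + 1\<close>.\<close>

lemma rankin_cohen_vanishes_iff: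
  assumes l: "lam3 - lam1 - lam2 = 2 * of_nat l"
  shows "rankin_cohen_vanishes lam1 lam2 lam3 \<longleftrightarrow> exceptional (- lam1) (- lam2) l"
proof -
  define C where "C j = (- 1) ^ j * (desc_factorial (lam1 + of_nat l - 1) j * desc_factorial (lam2 + of_nat l - 1) (l - j))
       / (fact j * fact (l - j))" for j
  have rc: "rankin_cohen lam1 lam2 lam3 f z = (\<Sum>j\<le>l. C j * mixed_deriv (l - j) j f (z, z))" for f z
    by (simp add: rankin_cohen_def rc_order_eq[OF l] C_def Let_def)
  have 1: "rankin_cohen_vanishes lam1 lam2 lam3 \<longleftrightarrow> (\<forall>j\<le>l. C j = 0)"
  proof
    assume v: "rankin_cohen_vanishes lam1 lam2 lam3"
    have "(\<Sum>j\<le>l. C j * t ^ j) = 0" for t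
      using v[unfolded rankin_cohen_vanishes_def, rule_format, OF open_UNIV holomorphic2_exp[of t], of 0]
      by (simp add: rc mixed_deriv_exp)
    then show "\<forall>j\<le>l. C j = 0" using polyfun_eq_0[of C l] by blast
  qed (simp add: rankin_cohen_vanishes_def rc)
  have C0: "C j = 0 \<longleftrightarrow> (\<exists>i<j. lam1 + of_nat l - 1 = of_nat i) \<or> (\<exists>i<l - j. lam2 + of_nat l - 1 = of_nat i)" for j
    by (simp add: C_def desc_factorial_eq_0)
  have 2: "(\<forall>j\<le>l. C j = 0) \<longleftrightarrow> exceptional (- lam1) (- lam2) l"
  proof
    assume *: "\<forall>j\<le>l. C j = 0"
    obtain i where i: "i < l" "lam1 + of_nat l - 1 = of_nat i" using * C0[of l] by auto
    obtain j where j: "j < l" "lam2 + of_nat l - 1 = of_nat j" using * C0[of 0] by auto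
    have a: "- lam1 = of_nat (l - Suc i)" and b: "- lam2 = of_nat (l - Suc j)"
      using i j by (simp_all add: of_nat_diff algebra_simps)
    have "i + j < l"
    proof (rule ccontr)
      assume "\<not> i + j < l"
      then have "l - j \<le> i" "l - j \<le> l" by auto
      then have "C (l - j) = 0" using * by blast
      then have "(\<exists>i'<l - j. of_nat i = (of_nat i' :: complex)) \<or> (\<exists>j'<j. of_nat j = (of_nat j' :: complex))"
        using C0[of "l - j"] i j by simp
      then show False using \<open>l - j \<le> i\<close> by auto
    qed
    then show "exceptional (- lam1) (- lam2) l"
      unfolding exceptional_def using a b i(1) j(1) by (intro exI[of _ "l - Suc i"] exI[of _ "l - Suc j"]) auto
  next
    assume "exceptional (- lam1) (- lam2) l"
    then obtain a b where ab: "- lam1 = of_nat a" "- lam2 = of_nat b" "a < l" "b < l" "l \<le> a + b + 1"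
      by (auto simp: exceptional_def)
    have "lam1 = - of_nat a" "lam2 = - of_nat b" using ab by (metis minus_minus)+
    then have i: "lam1 + of_nat l - 1 = of_nat (l - Suc a)" and j: "lam2 + of_nat l - 1 = of_nat (l - Suc b)"
      using ab by (simp_all add: of_nat_diff)
    show "\<forall>j\<le>l. C j = 0"
    proof (intro allI impI)
      fix k assume "k \<le> l"
      then have "l - Suc a < k \<or> l - Suc b < l - k" using ab by auto
      then show "C k = 0" unfolding C0 i j by blast
    qed
  qed
  show ?thesis using 1 2 by simp
qed

lemma exceptional_iff_integral:
  fixes lam1 lam2 lam3 :: complex
  assumes l: "lam3 - lam1 - lam2 = 2 * of_nat l"
  shows "exceptional (- lam1) (- lam2) l \<longleftrightarrow>
    (\<exists>n1 n2 n3 :: int. lam1 = of_int n1 \<and> lam2 = of_int n2 \<and> lam3 = of_int n3 \<and>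
                2 \<ge> n1 + n2 + n3 \<and> n3 \<ge> \<bar>n1 - n2\<bar> + 2)"
proof
  assume "exceptional (- lam1) (- lam2) l"
  then obtain a b where ab: "- lam1 = of_nat a" "- lam2 = of_nat b" "a < l" "b < l" "l \<le> a + b + 1"
    by (auto simp: exceptional_def)
  have e: "lam1 = - of_nat a" "lam2 = - of_nat b" using ab by (metis minus_minus)+
  show "\<exists>n1 n2 n3 :: int. lam1 = of_int n1 \<and> lam2 = of_int n2 \<and> lam3 = of_int n3 \<and>
                2 \<ge> n1 + n2 + n3 \<and> n3 \<ge> \<bar>n1 - n2\<bar> + 2"
  proof (intro exI conjI)
    show "lam1 = of_int (- int a)" "lam2 = of_int (- int b)" using e by simp_all
    show "lam3 = of_int (2 * int l - int a - int b)" using l e by (simp add: algebra_simps)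
  qed (use ab in auto)
next
  assume "\<exists>n1 n2 n3 :: int. lam1 = of_int n1 \<and> lam2 = of_int n2 \<and> lam3 = of_int n3 \<and>
                2 \<ge> n1 + n2 + n3 \<and> n3 \<ge> \<bar>n1 - n2\<bar> + 2"
  then obtain n1 n2 n3 :: int where n: "lam1 = of_int n1" "lam2 = of_int n2" "lam3 = of_int n3"
    "2 \<ge> n1 + n2 + n3" "n3 \<ge> \<bar>n1 - n2\<bar> + 2" by blast
  have "(of_int (n3 - n1 - n2) :: complex) = of_int (2 * int l)" using l n by simp
  then have n3: "n3 - n1 - n2 = 2 * int l" unfolding of_int_eq_iff .
  have "n1 \<le> 0" "n2 \<le> 0" using n n3 by auto
  then have "- lam1 = of_nat (nat (- n1))" "- lam2 = of_nat (nat (- n2))" using n by simp_all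
  moreover have "nat (- n1) < l" "nat (- n2) < l" "l \<le> nat (- n1) + nat (- n2) + 1"
    using n n3 \<open>n1 \<le> 0\<close> \<open>n2 \<le> 0\<close> by auto
  ultimately show "exceptional (- lam1) (- lam2) l" unfolding exceptional_def by blast
qed

section \<open>Dimension two\<close>

text \<open>The evaluation map \<open>ev\<close> identifies the module with a subspace \<open>S\<close> of a vector space, where a basis of two vectors
  can be described without sums over sets.\<close>

lemma has_dimension_two_iff:
  fixes Mo :: "(complex, 'm) module" and s :: "complex \<Rightarrow> 'c::ab_group_add \<Rightarrow> 'c" and ev :: "'m \<Rightarrow> 'c"
  assumes vs: "vector_space s" and bij: "bij_betw ev (carrier Mo) S"
    and S: "0 \<in> S" "\<And>a b. a \<in> S \<Longrightarrow> b \<in> S \<Longrightarrow> a + b \<in> S" "\<And>c a. a \<in> S \<Longrightarrow> s c a \<in> S"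
    and zero: "\<zero>\<^bsub>Mo\<^esub> \<in> carrier Mo" "ev \<zero>\<^bsub>Mo\<^esub> = 0"
    and add: "\<And>f g. f \<in> carrier Mo \<Longrightarrow> g \<in> carrier Mo \<Longrightarrow> f \<oplus>\<^bsub>Mo\<^esub> g \<in> carrier Mo"
      "\<And>f g. f \<in> carrier Mo \<Longrightarrow> g \<in> carrier Mo \<Longrightarrow> ev (f \<oplus>\<^bsub>Mo\<^esub> g) = ev f + ev g"
    and smult: "\<And>c f. f \<in> carrier Mo \<Longrightarrow> c \<odot>\<^bsub>Mo\<^esub> f \<in> carrier Mo"
      "\<And>c f. f \<in> carrier Mo \<Longrightarrow> ev (c \<odot>\<^bsub>Mo\<^esub> f) = s c (ev f)"
  shows "has_dimension Mo 2 \<longleftrightarrow> (\<exists>s1\<in>S. \<exists>s2\<in>S. (\<forall>x y. s x s1 + s y s2 = 0 \<longrightarrow> x = 0 \<and> y = 0)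
    \<and> (\<forall>v\<in>S. \<exists>x y. v = s x s1 + s y s2))"
proof -
  interpret vector_space s by (rule vs)
  have inj: "f = g" if "f \<in> carrier Mo" "g \<in> carrier Mo" "ev f = ev g" for f g
    using bij that by (auto simp: bij_betw_def inj_on_def)
  have "abelian_monoid Mo"
    by (rule abelian_monoidI; (rule inj)?; simp add: add zero add_ac)
  then interpret Mo: abelian_monoid Mo .
  have pair: "ev (\<Oplus>\<^bsub>Mo\<^esub>b\<in>{f, g}. c b \<odot>\<^bsub>Mo\<^esub> b) = s (c f) (ev f) + s (c g) (ev g)"
    "(\<Oplus>\<^bsub>Mo\<^esub>b\<in>{f, g}. c b \<odot>\<^bsub>Mo\<^esub> b) \<in> carrier Mo"
    if "f \<in> carrier Mo" "g \<in> carrier Mo" "f \<noteq> g" for f g c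
    using that by (simp_all add: add smult zero Mo.finsum_insert[of "{g}" f] Mo.finsum_insert[of "{}" g])
  show ?thesis
  proof
    assume "has_dimension Mo 2"
    then obtain B where B: "finite_basis Mo B" "card B = 2" by (auto simp: has_dimension_def)
    then obtain f g where fg: "B = {f, g}" "f \<noteq> g" by (meson card_2_iff)
    have car: "f \<in> carrier Mo" "g \<in> carrier Mo"
      and ex1: "\<And>v. v \<in> carrier Mo \<Longrightarrow> \<exists>!c. c \<in> B \<rightarrow>\<^sub>E UNIV \<and> v = (\<Oplus>\<^bsub>Mo\<^esub>b\<in>B. c b \<odot>\<^bsub>Mo\<^esub> b)"
      using B by (auto simp: finite_basis_def fg)
    have uniq: "c = d" if "c \<in> B \<rightarrow>\<^sub>E UNIV" "d \<in> B \<rightarrow>\<^sub>E UNIV"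
      "s (c f) (ev f) + s (c g) (ev g) = s (d f) (ev f) + s (d g) (ev g)" for c d
    proof -
      have "(\<Oplus>\<^bsub>Mo\<^esub>b\<in>B. c b \<odot>\<^bsub>Mo\<^esub> b) = (\<Oplus>\<^bsub>Mo\<^esub>b\<in>B. d b \<odot>\<^bsub>Mo\<^esub> b)"
        unfolding fg by (rule inj) (use car fg(2) that(3) in \<open>simp_all only: pair not_False_eq_True\<close>)
      then show ?thesis using ex1[of "\<Oplus>\<^bsub>Mo\<^esub>b\<in>B. c b \<odot>\<^bsub>Mo\<^esub> b"] that(1,2) pair(2)[OF car fg(2)] fg(1) by blast
    qed
    have "x = 0 \<and> y = 0" if "s x (ev f) + s y (ev g) = 0" for x y
    proof -
      have "(\<lambda>b\<in>B. if b = f then x else y) = (\<lambda>b\<in>B. 0)"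
        by (rule uniq) (use that fg in auto)
      then have "(\<lambda>b\<in>B. if b = f then x else y) f = (\<lambda>b\<in>B. 0) f" "(\<lambda>b\<in>B. if b = f then x else y) g = (\<lambda>b\<in>B. 0) g"
        by simp_all
      then show ?thesis using fg by simp
    qed
    moreover have "\<exists>x y. v = s x (ev f) + s y (ev g)" if "v \<in> S" for v
    proof -
      obtain m where m: "m \<in> carrier Mo" "v = ev m" using bij \<open>v \<in> S\<close> by (auto simp: bij_betw_def)
      then obtain c where "m = (\<Oplus>\<^bsub>Mo\<^esub>b\<in>B. c b \<odot>\<^bsub>Mo\<^esub> b)" using ex1 by blast
      then show ?thesis using pair(1)[OF car fg(2), of c] m(2) fg(1) by blast
    qed
    moreover have "ev f \<in> S" "ev g \<in> S" using car bij by (auto simp: bij_betw_def)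
    ultimately show "\<exists>s1\<in>S. \<exists>s2\<in>S. (\<forall>x y. s x s1 + s y s2 = 0 \<longrightarrow> x = 0 \<and> y = 0)
      \<and> (\<forall>v\<in>S. \<exists>x y. v = s x s1 + s y s2)" by blast
  next
    assume "\<exists>s1\<in>S. \<exists>s2\<in>S. (\<forall>x y. s x s1 + s y s2 = 0 \<longrightarrow> x = 0 \<and> y = 0)
      \<and> (\<forall>v\<in>S. \<exists>x y. v = s x s1 + s y s2)"
    then obtain s1 s2 where s12: "s1 \<in> S" "s2 \<in> S"
      and ind: "\<And>x y. s x s1 + s y s2 = 0 \<Longrightarrow> x = 0 \<and> y = 0"
      and gen: "\<And>v. v \<in> S \<Longrightarrow> \<exists>x y. v = s x s1 + s y s2" by blast
    obtain f g where fg: "f \<in> carrier Mo" "ev f = s1" "g \<in> carrier Mo" "ev g = s2"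
      using s12 bij by (auto simp: bij_betw_def image_iff)
    have ne: "f \<noteq> g" using ind[of 1 "-1"] fg by auto
    have "\<exists>!c. c \<in> {f, g} \<rightarrow>\<^sub>E UNIV \<and> v = (\<Oplus>\<^bsub>Mo\<^esub>b\<in>{f, g}. c b \<odot>\<^bsub>Mo\<^esub> b)" if v: "v \<in> carrier Mo" for v
    proof -
      have ev: "v = (\<Oplus>\<^bsub>Mo\<^esub>b\<in>{f, g}. c b \<odot>\<^bsub>Mo\<^esub> b) \<longleftrightarrow> ev v = s (c f) s1 + s (c g) s2" for c
        using inj[OF v pair(2)[OF fg(1,3) ne, of c]] pair(1)[OF fg(1,3) ne, of c] fg by auto
      have "ev v \<in> S" using v bij by (auto simp: bij_betw_def)
      then obtain x y where xy: "ev v = s x s1 + s y s2" using gen by blast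
      show ?thesis
        unfolding ev
      proof (rule ex1I[of _ "\<lambda>b\<in>{f, g}. if b = f then x else y"])
        fix c assume c: "c \<in> {f, g} \<rightarrow>\<^sub>E UNIV \<and> ev v = s (c f) s1 + s (c g) s2"
        then have "s (c f - x) s1 + s (c g - y) s2 = 0"
          using xy by (simp add: scale_left_diff_distrib algebra_simps)
        then have "c f = x" "c g = y" using ind[of "c f - x" "c g - y"] by simp_all
        then show "c = (\<lambda>b\<in>{f, g}. if b = f then x else y)"
          using c ne by (intro extensionalityI[of _ "{f, g}"]) (auto simp: PiE_def)
      qed (use xy ne in auto)
    qed
    then have "finite_basis Mo {f, g}" using fg by (simp add: finite_basis_def)
    then show "has_dimension Mo 2" using ne by (auto simp: has_dimension_def)
  qed
qed

section \<open>The multiplicity space\<close>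

context frame
begin

text \<open>Evaluation at the highest weight vector is a linear bijection from homomorphisms to singular vectors, with inverse
  given by \<^const>\<open>orbit_map\<close>.\<close>

lemma hom_space_dimension:
  assumes M: "lie_model pscale sl2 (vact (\<mu> + \<nu> - 2 * of_nat l)) M \<phi>"
    and T: "lie_model pscale sl2 (tact \<mu> \<nu>) T \<theta>"
  shows "has_dimension (lie_hom_space sl2 M T) 2 \<longleftrightarrow> exceptional \<mu> \<nu> l"
proof -
  define \<kappa> where "\<kappa> = \<mu> + \<nu> - 2 * of_nat l"
  interpret M: lie_model pscale sl2 "vact \<kappa>" M \<phi> unfolding \<kappa>_def by (rule M)
  interpret T: lie_model pscale sl2 "tact \<mu> \<nu>" T \<theta> by (rule T)
  define ev where "ev f = \<theta> (f (M.\<psi> (basis_vec 0)))" for f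
  define mk where "mk u = (\<lambda>v\<in>carrier M. T.\<psi> (orbit_map tF u (\<phi> v)))" for u
  have efh: "vact \<kappa> \<e> v = vE \<kappa> v" "vact \<kappa> \<f> v = vF v" "vact \<kappa> \<h> v = vH \<kappa> v"
    "tact \<mu> \<nu> \<e> t = tE \<mu> \<nu> t" "tact \<mu> \<nu> \<f> t = tF t" "tact \<mu> \<nu> \<h> t = tH \<mu> \<nu> t" for v t
    by (rule opact_efh[OF pm.vector_space_axioms])+
  have hom_orbit: "\<theta> (f v) = orbit_map tF (ev f) (\<phi> v)" "ev f \<in> sing \<mu> \<nu> l" if f: "f \<in> lie_hom sl2 M T" "v \<in> carrier M" for f v
  proof -
    define g where "g p = \<theta> (f (M.\<psi> p))" for p
    have fc: "f v \<in> carrier T" if "v \<in> carrier M" for v using f that by (auto simp: lie_hom_def)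
    have g: "clinear pscale pscale g"
      by (rule clinearI) (use f(1) in \<open>simp_all add: g_def M.psi_add M.psi_smult lie_hom_def T.add T.smult fc pm.vector_space_axioms\<close>)
    have gx: "g (vact \<kappa> x p) = tact \<mu> \<nu> x (g p)" if "x \<in> sl2" for x p
      using f(1) that fc[of "M.\<psi> p"] by (simp add: g_def M.psi_lact lie_hom_def T.lact)
    have gF: "g (vF p) = tF (g p)" and gE: "g (vE \<kappa> p) = tE \<mu> \<nu> (g p)" and gH: "g (vH \<kappa> p) = tH \<mu> \<nu> (g p)" for p
      using gx[OF triple_sl2(2), of p] gx[OF triple_sl2(1), of p] gx[OF triple_sl2(3), of p] by (simp_all only: efh)
    have u: "ev f = g (basis_vec 0)" by (simp add: ev_def g_def)
    show "ev f \<in> sing \<mu> \<nu> l"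
      unfolding u sing_iff using gE[of "basis_vec 0"] gH[of "basis_vec 0"]
      by (simp add: clinear_zero[OF g] clinear_scale[OF g] \<kappa>_def)
    have "g (basis_vec k) = orbit_map tF (ev f) (basis_vec k)" for k
    proof (induction k)
      case (Suc k)
      then show ?case using gF[of "basis_vec k"] by simp
    qed (simp add: u)
    then have "g p = orbit_map tF (ev f) p" for p by (rule clinear_eqI[OF g orbit_map_clinear])
    from this[of "\<phi> v"] show "\<theta> (f v) = orbit_map tF (ev f) (\<phi> v)" using f(2) by (simp add: g_def)
  qed
  have mk_hom: "mk u \<in> lie_hom sl2 M T" if u: "u \<in> sing \<mu> \<nu> l" for u
  proof -
    note o = clinear_add[OF orbit_map_clinear] clinear_scale[OF orbit_map_clinear]
    have ox: "orbit_map tF u (vact \<kappa> x p) = tact \<mu> \<nu> x (orbit_map tF u p)" for x p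
      unfolding opact_def \<kappa>_def by (simp add: o sing_orbit[OF u])
    show ?thesis
      unfolding lie_hom_def mk_def
      by (auto simp: M.add M.add_closed M.smult M.smult_closed M.lact M.lact_closed o T.psi_add T.psi_smult ox T.psi_lact)
  qed
  have ev_mk: "ev (mk u) = u" for u by (simp add: ev_def mk_def)
  have bij: "bij_betw ev (carrier (lie_hom_space sl2 M T)) (sing \<mu> \<nu> l)"
  proof (rule bij_betwI[of _ _ _ mk])
    show "ev \<in> carrier (lie_hom_space sl2 M T) \<rightarrow> sing \<mu> \<nu> l"
      using hom_orbit(2)[OF _ M.zero_closed] by (auto simp: lie_hom_space_def)
    show "mk \<in> sing \<mu> \<nu> l \<rightarrow> carrier (lie_hom_space sl2 M T)"
      using mk_hom by (auto simp: lie_hom_space_def)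
    show "mk (ev f) = f" if "f \<in> carrier (lie_hom_space sl2 M T)" for f
    proof -
      have f: "f \<in> lie_hom sl2 M T" using that by (simp add: lie_hom_space_def)
      have "f v = T.\<psi> (orbit_map tF (ev f) (\<phi> v))" if "v \<in> carrier M" for v
      proof -
        have "f v \<in> carrier T" using f that by (auto simp: lie_hom_def)
        then show ?thesis using hom_orbit(1)[OF f that] T.psi_phi by metis
      qed
      moreover have "f \<in> extensional (carrier M)" using f by (auto simp: lie_hom_def PiE_def)
      ultimately show ?thesis by (intro extensionalityI[of _ "carrier M"]) (auto simp: mk_def)
    qed
  qed (simp add: ev_mk)
  have closed: "f \<in> carrier (lie_hom_space sl2 M T)"
    if "u \<in> sing \<mu> \<nu> l" "f = mk u" for u f using that mk_hom by (simp add: lie_hom_space_def)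
  have fc: "f v \<in> carrier T" if "f \<in> lie_hom sl2 M T" "v \<in> carrier M" for f v using that by (auto simp: lie_hom_def)
  have mk_eq: "(\<lambda>v\<in>carrier M. F v) = mk u" if "\<And>v. v \<in> carrier M \<Longrightarrow> F v \<in> carrier T"
    "\<And>v. v \<in> carrier M \<Longrightarrow> \<theta> (F v) = orbit_map tF u (\<phi> v)" for F u
  proof -
    have "F v = T.\<psi> (orbit_map tF u (\<phi> v))" if "v \<in> carrier M" for v
      using T.psi_phi[of "F v"] that \<open>\<And>v. v \<in> carrier M \<Longrightarrow> F v \<in> carrier T\<close>
        \<open>\<And>v. v \<in> carrier M \<Longrightarrow> \<theta> (F v) = orbit_map tF u (\<phi> v)\<close> by metis
    then show ?thesis unfolding mk_def by (intro restrict_ext)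
  qed
  have olin: "orbit_map tF (u + u') p = orbit_map tF u p + orbit_map tF u' p"
    "orbit_map tF (pscale k u) p = pscale k (orbit_map tF u p)" "orbit_map tF 0 p = 0" for u u' k p
  proof -
    note F = clinear_funpow[OF t_clinear(2)]
    show "orbit_map tF (u + u') p = orbit_map tF u p + orbit_map tF u' p"
      by (rule clinear_eqI[OF orbit_map_clinear clinear_plus[OF orbit_map_clinear orbit_map_clinear]])
        (simp add: clinear_add[OF F])
    show "orbit_map tF (pscale k u) p = pscale k (orbit_map tF u p)"
      by (rule clinear_eqI[OF orbit_map_clinear clinear_smult[OF orbit_map_clinear]])
        (simp add: clinear_scale[OF F])
    then show "orbit_map tF 0 p = 0"
      by (simp add: orbit_map_def pextend_def clinear_zero[OF F])
  qed
  have z: "\<zero>\<^bsub>lie_hom_space sl2 M T\<^esub> = mk 0"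
    unfolding lie_hom_space_def module.simps ring.simps
    by (rule mk_eq) (simp_all add: T.zero_closed T.zero olin)
  have a: "f \<oplus>\<^bsub>lie_hom_space sl2 M T\<^esub> g = mk (ev f + ev g)"
    if "f \<in> lie_hom sl2 M T" "g \<in> lie_hom sl2 M T" for f g
    unfolding lie_hom_space_def using that
    by (simp?, intro mk_eq) (simp_all add: T.add T.add_closed fc hom_orbit olin)
  have m: "c \<odot>\<^bsub>lie_hom_space sl2 M T\<^esub> f = mk (pscale c (ev f))" if "f \<in> lie_hom sl2 M T" for c f
    unfolding lie_hom_space_def using that
    by (simp?, intro mk_eq) (simp_all add: T.smult T.smult_closed fc hom_orbit olin)
  have car: "carrier (lie_hom_space sl2 M T) = lie_hom sl2 M T" by (simp add: lie_hom_space_def)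
  note evS = hom_orbit(2)[OF _ M.zero_closed]
  have "has_dimension (lie_hom_space sl2 M T) 2 \<longleftrightarrow>
    (\<exists>s1\<in>sing \<mu> \<nu> l. \<exists>s2\<in>sing \<mu> \<nu> l. (\<forall>x y. pscale x s1 + pscale y s2 = 0 \<longrightarrow> x = 0 \<and> y = 0)
    \<and> (\<forall>v\<in>sing \<mu> \<nu> l. \<exists>x y. v = pscale x s1 + pscale y s2))"
    by (rule has_dimension_two_iff[OF pm.vector_space_axioms bij])
      (simp_all add: sing_zero sing_add sing_scale z a m car ev_mk mk_hom evS)
  also have "\<dots> \<longleftrightarrow> exceptional \<mu> \<nu> l"
  proof
    assume "\<exists>s1\<in>sing \<mu> \<nu> l. \<exists>s2\<in>sing \<mu> \<nu> l. (\<forall>x y. pscale x s1 + pscale y s2 = 0 \<longrightarrow> x = 0 \<and> y = 0)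
    \<and> (\<forall>v\<in>sing \<mu> \<nu> l. \<exists>x y. v = pscale x s1 + pscale y s2)"
    then obtain s1 s2 where s: "s1 \<in> sing \<mu> \<nu> l" "s2 \<in> sing \<mu> \<nu> l"
      and ind: "\<And>x y. pscale x s1 + pscale y s2 = 0 \<Longrightarrow> x = 0 \<and> y = 0" by blast
    have "s1 \<noteq> 0" using ind[of 1 0] by auto
    moreover have "s2 \<noteq> pscale c s1" for c using ind[of "- c" 1] by (auto simp: pm.scale_minus_left)
    ultimately show "exceptional \<mu> \<nu> l" by (rule independent_sing_exceptional[OF s])
  next
    assume ex: "exceptional \<mu> \<nu> l"
    obtain s1 s2 where s: "s1 \<in> sing \<mu> \<nu> l" "lk s1 (0, l) = 1" "lk s1 (l, 0) = 0"
      "s2 \<in> sing \<mu> \<nu> l" "lk s2 (0, l) = 0" "lk s2 (l, 0) = 1"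
      using exceptional_corners[OF ex] by blast
    have "x = 0 \<and> y = 0" if "pscale x s1 + pscale y s2 = 0" for x y
    proof -
      have "lk (pscale x s1 + pscale y s2) (0, l) = 0" "lk (pscale x s1 + pscale y s2) (l, 0) = 0"
        unfolding that by simp_all
      then show ?thesis using s by (simp add: lookup_add)
    qed
    moreover have "v = pscale (lk v (0, l)) s1 + pscale (lk v (l, 0)) s2" if v: "v \<in> sing \<mu> \<nu> l" for v
    proof -
      have "v - (pscale (lk v (0, l)) s1 + pscale (lk v (l, 0)) s2) = 0"
        by (rule exceptional_corners_zero[OF ex])
          (use s v in \<open>simp_all add: sing_sub sing_add sing_scale lookup_minus lookup_add\<close>)
      then show ?thesis by simp
    qed
    ultimately show "\<exists>s1\<in>sing \<mu> \<nu> l. \<exists>s2\<in>sing \<mu> \<nu> l. (\<forall>x y. pscale x s1 + pscale y s2 = 0 \<longrightarrow> x = 0 \<and> y = 0)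
    \<and> (\<forall>v\<in>sing \<mu> \<nu> l. \<exists>x y. v = pscale x s1 + pscale y s2)"
      using s by blast
  qed
  finally show ?thesis .
qed

end

section \<open>The block decomposition\<close>

text \<open>Homomorphisms commute with the enveloping algebra.\<close>

lemma wact_intertwine:
  assumes r1: "lie_rep s1 L act1" and r2: "lie_rep s2 L act2" and j: "clinear s1 s2 j"
    and jx: "\<And>x v. x \<in> L \<Longrightarrow> j (act1 x v) = act2 x (j v)" and p: "p \<in> words L"
  shows "j (lie_rep.wact s1 act1 p v) = lie_rep.wact s2 act2 p (j v)"
proof -
  interpret A: lie_rep s1 L act1 by (rule r1)
  interpret B: lie_rep s2 L act2 by (rule r2)
  show ?thesis
  proof (rule clinear_eqI[OF clinear_compose[OF A.wact_clinear_left j] B.wact_clinear_left])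
    fix w assume "w \<in> keys p"
    then have "w \<in> lists L" using p by blast
    then show "j (A.wact (basis_vec w) v) = B.wact (basis_vec w) (j v)"
      by (induction w) (simp_all add: jx)
  qed
qed

lemma lie_dsum_simps:
  "carrier (lie_dsum V W) = carrier V \<times> carrier W"
  "x \<oplus>\<^bsub>lie_dsum V W\<^esub> y = (fst x \<oplus>\<^bsub>V\<^esub> fst y, snd x \<oplus>\<^bsub>W\<^esub> snd y)"
  "c \<odot>\<^bsub>lie_dsum V W\<^esub> x = (c \<odot>\<^bsub>V\<^esub> fst x, c \<odot>\<^bsub>W\<^esub> snd x)"
  "lact (lie_dsum V W) a x = (lact V a (fst x), lact W a (snd x))"
  by (simp_all add: lie_dsum_def case_prod_unfold)

lemma inf_char_part_simps:
  "x \<oplus>\<^bsub>inf_char_part h b V \<nu>\<^esub> y = x \<oplus>\<^bsub>V\<^esub> y" "c \<odot>\<^bsub>inf_char_part h b V \<nu>\<^esub> x = c \<odot>\<^bsub>V\<^esub> x"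
  "lact (inf_char_part h b V \<nu>) = lact V"
  by (simp_all add: inf_char_part_def)

context frame
begin

lemma orbit_vact:
  assumes u: "u \<in> sing \<mu> \<nu> l" and "\<kappa> = \<mu> + \<nu> - 2 * of_nat l"
  shows "orbit_map tF u (vact \<kappa> x p) = tact \<mu> \<nu> x (orbit_map tF u p)"
  unfolding opact_def assms(2)
  by (simp add: clinear_add[OF orbit_map_clinear] clinear_scale[OF orbit_map_clinear] sing_orbit[OF u])

text \<open>The weights \<open>\<kappa>\<close> and \<open>\<kappa>'\<close> are linked by the reflection, and \<open>f^k v\<close> is a singular vector of weight \<open>\<kappa>\<close> in the Verma module
  of highest weight \<open>\<kappa>'\<close>. A central element that kills the embedded Verma module acts by a scalar on the larger
  one, and that scalar is zero.\<close>

lemma central_zero_linked: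
  assumes p: "central p" and zero: "\<And>v. vw \<kappa> p v = 0"
    and k: "\<kappa>' = of_nat k - 1" "\<kappa> = - of_nat k - 1"
  shows "vw \<kappa>' p v = 0"
proof -
  obtain c where c: "\<And>v. vw \<kappa>' p v = pscale c v" using central_acts_as_scalar[OF p] by blast
  let ?b = "basis_vec k :: nat \<Rightarrow>\<^sub>0 complex"
  have b: "vE \<kappa>' ?b = 0" "vH \<kappa>' ?b = pscale \<kappa> ?b"
    by (simp_all add: k algebra_simps)
  have r: "orbit_map vF ?b (vF p) = vF (orbit_map vF ?b p)"
    "orbit_map vF ?b (vH \<kappa> p) = vH \<kappa>' (orbit_map vF ?b p)"
    "orbit_map vF ?b (vE \<kappa> p) = vE \<kappa>' (orbit_map vF ?b p)" for p
    by (rule orbit_map_intertwines[where E = "vE \<kappa>'" and F = vF and H = "vH \<kappa>'",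
      OF v_clinear(1) v_clinear(2) v_clinear(3) v_rel(1) v_rel(3) b])+
  have x: "orbit_map vF ?b (vact \<kappa> x p) = vact \<kappa>' x (orbit_map vF ?b p)" for x p
    unfolding opact_def by (simp add: clinear_add[OF orbit_map_clinear] clinear_scale[OF orbit_map_clinear] r)
  have "orbit_map vF ?b (vw \<kappa> p (basis_vec 0)) = vw \<kappa>' p (orbit_map vF ?b (basis_vec 0))"
    by (rule wact_intertwine[where j = "orbit_map vF ?b", OF vact_rep vact_rep orbit_map_clinear])
      (use p x in \<open>simp_all add: central_def\<close>)
  then have "pscale c ?b = 0" by (simp add: zero c clinear_zero[OF orbit_map_clinear])
  then have "c = 0" by (simp add: single_zero_iff)
  then show ?thesis by (simp add: c)
qed

text \<open>The map \<open>G\<close> is the inclusion of the direct sum of the two Verma modules generated by \<open>u\<close> and \<open>w\<close>. Its image is the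
  block: central elements that vanish on the first summand vanish on the second, and conversely the block
  consists of generalised Casimir eigenvectors.\<close>

lemma block_decomposition:
  assumes T: "lie_model pscale sl2 (tact \<mu> \<nu>) T \<theta>"
    and M1: "lie_model pscale sl2 (vact \<kappa>) M1 \<phi>1" and M2: "lie_model pscale sl2 (vact \<kappa>') M2 \<phi>2"
    and \<kappa>: "\<kappa> = \<mu> + \<nu> - 2 * of_nat l" "\<kappa>' = - \<kappa> - 2" and ex: "exceptional \<mu> \<nu> l"
  shows "lie_iso sl2 (inf_char_part hset bset T (\<kappa> + 1)) (lie_dsum M1 M2)"
proof -
  interpret T: lie_model pscale sl2 "tact \<mu> \<nu>" T \<theta> by (rule T)
  interpret M1: lie_model pscale sl2 "vact \<kappa>" M1 \<phi>1 by (rule M1)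
  interpret M2: lie_model pscale sl2 "vact \<kappa>'" M2 \<phi>2 by (rule M2)
  obtain a b where ab: "\<mu> = of_nat a" "\<nu> = of_nat b" "a < l" "b < l" "l \<le> a + b + 1"
    using ex by (auto simp: exceptional_def)
  define n where "n = a + b + 1 - l"
  have nl: "n < l" and na: "n \<le> a" and nab: "n + l = a + b + 1" using ab by (auto simp: n_def)
  have "of_nat n + of_nat l = (of_nat (a + b + 1) :: complex)" unfolding nab[symmetric] by simp
  then have \<mu>\<nu>: "\<mu> + \<nu> = of_nat n + of_nat l - 1" using ab by (simp add: algebra_simps)
  define w where "w = svec \<mu> \<nu> n"
  have w: "w \<in> sing \<mu> \<nu> n" unfolding w_def by (rule svec_sing) (use na ab(1) in auto)
  have w0: "w \<noteq> 0" using svec_corner[of \<mu> \<nu> n] by (auto simp: w_def)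
  let ?W = "(tF ^^ (l - n)) w"
  obtain s1 s2 where s: "s1 \<in> sing \<mu> \<nu> l" "lk s1 (0, l) = 1" "lk s1 (l, 0) = 0"
      "s2 \<in> sing \<mu> \<nu> l" "lk s2 (0, l) = 0" "lk s2 (l, 0) = 1"
    using exceptional_corners[OF ex] by blast
  have "\<not> ((\<exists>c. s1 = pscale c ?W) \<and> (\<exists>c. s2 = pscale c ?W))"
  proof
    assume "(\<exists>c. s1 = pscale c ?W) \<and> (\<exists>c. s2 = pscale c ?W)"
    then obtain c d where "s1 = pscale c ?W" "s2 = pscale d ?W" by blast
    then have "c * lk ?W (0, l) = 1" "d * lk ?W (0, l) = 0" "d * lk ?W (l, 0) = 1"
      using s(2,5,6) by simp_all
    then show False by auto
  qed
  then obtain u where u: "u \<in> sing \<mu> \<nu> l" and ind: "\<And>c. u \<noteq> pscale c ?W" using s by blast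
  define c where "c = \<kappa>\<^sup>2 + 2 * \<kappa>"
  have c: "c = (\<mu> + \<nu> - 2 * of_nat l)\<^sup>2 + 2 * (\<mu> + \<nu> - 2 * of_nat l)" by (simp add: c_def \<kappa>)
  define G where "G = (\<lambda>(p, q). orbit_map tF u p + orbit_map tF w q)"
  have \<kappa>'n: "\<kappa>' = \<mu> + \<nu> - 2 * of_nat n" unfolding \<kappa> \<mu>\<nu> by (simp add: algebra_simps)
  have \<kappa>k: "\<kappa>' = of_nat (l - n) - 1" "\<kappa> = - of_nat (l - n) - 1"
    unfolding \<kappa> \<mu>\<nu> using nl by (simp_all add: of_nat_diff algebra_simps)
  note lin = clinear_add[OF orbit_map_clinear] clinear_scale[OF orbit_map_clinear] clinear_diff[OF orbit_map_clinear]
  have G_inj: "inj G"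
  proof (rule injI)
    fix x y assume "G x = G y"
    then have "orbit_map tF u (fst x - fst y) + orbit_map tF w (snd x - snd y) = 0"
      by (simp add: G_def case_prod_unfold lin algebra_simps)
    from orbit_sum_eq_0[OF \<mu>\<nu> nl c w w0 u ind this] show "x = y" by (simp add: prod_eq_iff)
  qed
  have G_add: "G (fst x + fst y, snd x + snd y) = G x + G y" for x y
    by (simp add: G_def case_prod_unfold lin algebra_simps)
  have G_scale: "G (pscale k (fst x), pscale k (snd x)) = pscale k (G x)" for k x
    by (simp add: G_def case_prod_unfold lin pm.scale_right_distrib)
  have G_act: "G (vact \<kappa> y (fst x), vact \<kappa>' y (snd x)) = tact \<mu> \<nu> y (G x)" if "y \<in> sl2" for y x
    using clinear_add[OF T.act_clinear[OF that]]
    by (simp add: G_def case_prod_unfold orbit_vact[OF u \<kappa>(1)] orbit_vact[OF w \<kappa>'n])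
  let ?P = "inf_char_part hset bset T (\<kappa> + 1)"
  have P: "v \<in> carrier ?P \<longleftrightarrow> v \<in> carrier T \<and> \<theta> v \<in> range G" for v
  proof
    assume v: "v \<in> carrier ?P"
    obtain N where "(T.wact (cas (\<kappa>\<^sup>2 + 2 * \<kappa>)) ^^ N) (\<theta> v) = 0"
      using inf_char_part_casimir[OF T v] by blast
    moreover have "T.wact (cas (\<kappa>\<^sup>2 + 2 * \<kappa>)) = tC \<mu> \<nu> c"
      by (rule ext) (simp add: wact_cas[OF tact_rep] tC_def c_def)
    ultimately have "(tC \<mu> \<nu> c ^^ N) (\<theta> v) = 0" by simp
    from generalised_eigenvector_in_blk[OF \<mu>\<nu> nl c w w0 u ind this]
    have "\<theta> v \<in> range G" unfolding blk_def[OF \<mu>\<nu> nl c w w0 u ind] G_def .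
    then show "v \<in> carrier T \<and> \<theta> v \<in> range G" using v by (simp add: inf_char_part_def)
  next
    assume v: "v \<in> carrier T \<and> \<theta> v \<in> range G"
    then obtain p q where pq: "\<theta> v = orbit_map tF u p + orbit_map tF w q" by (auto simp: G_def)
    show "v \<in> carrier ?P"
    proof (rule inf_char_partI[OF T])
      show "v \<in> carrier T" using v by simp
      fix z assume z: "central z" and z0: "\<And>v. vw \<kappa> z v = 0"
      have zw: "z \<in> words sl2" using z by (simp add: central_def)
      have "orbit_map tF u (vw \<kappa> z p) = T.wact z (orbit_map tF u p)"
        by (rule wact_intertwine[where j = "orbit_map tF u", OF vact_rep tact_rep orbit_map_clinear _ zw])
          (rule orbit_vact[OF u \<kappa>(1)])
      moreover have "orbit_map tF w (vw \<kappa>' z q) = T.wact z (orbit_map tF w q)"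
        by (rule wact_intertwine[where j = "orbit_map tF w", OF vact_rep tact_rep orbit_map_clinear _ zw])
          (rule orbit_vact[OF w \<kappa>'n])
      ultimately show "T.wact z (\<theta> v) = 0"
        using central_zero_linked[OF z z0 \<kappa>k, of q]
        by (simp add: pq clinear_add[OF T.wact_clinear_right[OF zw]] z0 clinear_zero[OF orbit_map_clinear])
    qed
  qed
  define f where "f v = (M1.\<psi> (fst (inv_into UNIV G (\<theta> v))), M2.\<psi> (snd (inv_into UNIV G (\<theta> v))))" for v
  have f_eq: "f v = (M1.\<psi> (fst x), M2.\<psi> (snd x))" if "\<theta> v = G x" for v x
    by (simp add: f_def that G_inj)
  note psi1 = M1.psi_add M1.psi_smult M1.psi_lact and psi2 = M2.psi_add M2.psi_smult M2.psi_lact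
  have PE: "\<exists>x. v \<in> carrier T \<and> \<theta> v = G x" if "v \<in> carrier ?P" for v using that P by blast
  have add: "v \<oplus>\<^bsub>T\<^esub> v' \<in> carrier ?P \<and> f (v \<oplus>\<^bsub>T\<^esub> v') = f v \<oplus>\<^bsub>lie_dsum M1 M2\<^esub> f v'"
    if v: "v \<in> carrier ?P" "v' \<in> carrier ?P" for v v'
  proof -
    obtain x x' where x: "v \<in> carrier T" "\<theta> v = G x" "v' \<in> carrier T" "\<theta> v' = G x'" using PE v by blast
    then have "\<theta> (v \<oplus>\<^bsub>T\<^esub> v') = G (fst x + fst x', snd x + snd x')" by (simp add: T.add G_add)
    from f_eq[OF this] this show ?thesis
      using P x T.add_closed by (auto simp: f_eq[OF x(2)] f_eq[OF x(4)] lie_dsum_simps psi1 psi2)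
  qed
  have smult: "k \<odot>\<^bsub>T\<^esub> v \<in> carrier ?P \<and> f (k \<odot>\<^bsub>T\<^esub> v) = k \<odot>\<^bsub>lie_dsum M1 M2\<^esub> f v"
    if v: "v \<in> carrier ?P" for v k
  proof -
    obtain x where x: "v \<in> carrier T" "\<theta> v = G x" using PE v by blast
    then have "\<theta> (k \<odot>\<^bsub>T\<^esub> v) = G (pscale k (fst x), pscale k (snd x))" by (simp add: T.smult G_scale)
    from f_eq[OF this] this show ?thesis
      using P x T.smult_closed by (auto simp: f_eq[OF x(2)] lie_dsum_simps psi1 psi2)
  qed
  have act: "lact T y v \<in> carrier ?P \<and> f (lact T y v) = lact (lie_dsum M1 M2) y (f v)"
    if v: "v \<in> carrier ?P" and y: "y \<in> sl2" for v y
  proof -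
    obtain x where x: "v \<in> carrier T" "\<theta> v = G x" using PE v by blast
    then have "\<theta> (lact T y v) = G (vact \<kappa> y (fst x), vact \<kappa>' y (snd x))" using y by (simp add: T.lact G_act)
    from f_eq[OF this] this show ?thesis
      using P x T.lact_closed y by (auto simp: f_eq[OF x(2)] lie_dsum_simps psi1 psi2)
  qed
  have fcar: "f v \<in> carrier M1 \<times> carrier M2" for v by (simp add: f_def)
  have "restrict f (carrier ?P) \<in> lie_hom sl2 ?P (lie_dsum M1 M2)"
    unfolding lie_hom_def inf_char_part_simps using add smult act fcar by (auto simp: lie_dsum_simps(1))
  moreover have "bij_betw f (carrier ?P) (carrier (lie_dsum M1 M2))"
    unfolding lie_dsum_simps(1)
  proof (rule bij_betwI[of _ _ _ "\<lambda>y. T.\<psi> (G (\<phi>1 (fst y), \<phi>2 (snd y)))"])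
    show "f \<in> carrier ?P \<rightarrow> carrier M1 \<times> carrier M2" using fcar by auto
    show "(\<lambda>y. T.\<psi> (G (\<phi>1 (fst y), \<phi>2 (snd y)))) \<in> carrier M1 \<times> carrier M2 \<rightarrow> carrier ?P"
      using P by simp
    show "T.\<psi> (G (\<phi>1 (fst (f v)), \<phi>2 (snd (f v)))) = v" if vP: "v \<in> carrier ?P" for v
    proof -
      obtain x where x: "v \<in> carrier T" "\<theta> v = G x" using PE[OF vP] by blast
      then have "G (\<phi>1 (fst (f v)), \<phi>2 (snd (f v))) = \<theta> v" by (simp add: f_eq)
      then show ?thesis using x(1) by simp
    qed
    show "f (T.\<psi> (G (\<phi>1 (fst y), \<phi>2 (snd y)))) = y" if "y \<in> carrier M1 \<times> carrier M2" for y
      using that f_eq[of "T.\<psi> (G (\<phi>1 (fst y), \<phi>2 (snd y)))" "(\<phi>1 (fst y), \<phi>2 (snd y))"] by auto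
  qed
  then have "bij_betw (restrict f (carrier ?P)) (carrier ?P) (carrier (lie_dsum M1 M2))"
    by (simp cong: bij_betw_cong)
  ultimately show ?thesis unfolding lie_iso_def by blast
qed

text \<open>The preimages \<open>t1\<close> and \<open>t2\<close> of \<open>(v, 0)\<close> and \<open>(0, f^k v')\<close> are independent singular vectors of weight \<open>\<kappa>\<close>. That \<open>k\<close> is a natural number follows
  because the preimage \<open>t3\<close> of \<open>(0, v')\<close> has weight \<open>\<kappa>'\<close>, and the weights of the tensor product differ by even integers.\<close>

lemma decomposition_exceptional:
  assumes T: "lie_model pscale sl2 (tact \<mu> \<nu>) T \<theta>"
    and M1: "lie_model pscale sl2 (vact \<kappa>) M1 \<phi>1" and M2: "lie_model pscale sl2 (vact \<kappa>') M2 \<phi>2"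
    and \<kappa>: "\<kappa> = \<mu> + \<nu> - 2 * of_nat l" "\<kappa>' = - \<kappa> - 2" and re: "Re \<kappa> \<le> - 2"
    and iso: "lie_iso sl2 (inf_char_part hset bset T (\<kappa> + 1)) (lie_dsum M1 M2)"
  shows "exceptional \<mu> \<nu> l"
proof -
  interpret T: lie_model pscale sl2 "tact \<mu> \<nu>" T \<theta> by (rule T)
  interpret M1: lie_model pscale sl2 "vact \<kappa>" M1 \<phi>1 by (rule M1)
  interpret M2: lie_model pscale sl2 "vact \<kappa>'" M2 \<phi>2 by (rule M2)
  let ?P = "inf_char_part hset bset T (\<kappa> + 1)"
  obtain f where f: "f \<in> lie_hom sl2 ?P (lie_dsum M1 M2)" and bij: "bij_betw f (carrier ?P) (carrier M1 \<times> carrier M2)"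
    using iso by (auto simp: lie_iso_def lie_dsum_simps)
  have PT: "v \<in> carrier T" if "v \<in> carrier ?P" for v using that by (simp add: inf_char_part_def)
  note closed = inf_char_part_closed[OF T, of _ "hset" "bset" "\<kappa> + 1"]
  define B where "B = \<theta> ` carrier ?P"
  define g where "g t = (\<phi>1 (fst (f (T.\<psi> t))), \<phi>2 (snd (f (T.\<psi> t))))" for t
  have \<psi>P: "T.\<psi> t \<in> carrier ?P" if "t \<in> B" for t using that PT by (auto simp: B_def)
  have fcar: "f v \<in> carrier M1 \<times> carrier M2" if "v \<in> carrier ?P" for v using bij that by (auto simp: bij_betw_def)
  have g_inj: "t = t'" if "t \<in> B" "t' \<in> B" "g t = g t'" for t t'
  proof -
    have "f (T.\<psi> t) = f (T.\<psi> t')"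
      using that fcar[OF \<psi>P[OF that(1)]] fcar[OF \<psi>P[OF that(2)]]
      by (auto simp: g_def prod_eq_iff M1.phi_eq_iff M2.phi_eq_iff mem_Times_iff)
    then have "T.\<psi> t = T.\<psi> t'" using bij \<psi>P that by (auto simp: bij_betw_def inj_on_def)
    then show ?thesis by (metis T.phi_psi)
  qed
  have g_surj: "\<exists>t\<in>B. g t = (p, q)" for p q
  proof -
    have "(M1.\<psi> p, M2.\<psi> q) \<in> f ` carrier ?P" using bij_betw_imp_surj_on[OF bij] by simp
    then obtain v where fv: "(M1.\<psi> p, M2.\<psi> q) = f v" and v: "v \<in> carrier ?P" by (rule imageE)
    have "g (\<theta> v) = (p, q)" by (simp add: g_def T.psi_phi[OF PT[OF v]] fv[symmetric])
    then show ?thesis using v by (auto simp: B_def)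
  qed
  have g_act: "tact \<mu> \<nu> x t \<in> B \<and> g (tact \<mu> \<nu> x t) = (vact \<kappa> x (fst (g t)), vact \<kappa>' x (snd (g t)))"
    if t: "t \<in> B" and x: "x \<in> sl2" for t x
  proof -
    have "f (lact T x (T.\<psi> t)) = lact (lie_dsum M1 M2) x (f (T.\<psi> t))"
      using f \<psi>P[OF t] x unfolding lie_hom_def inf_char_part_simps by blast
    then have "g (tact \<mu> \<nu> x t) = (vact \<kappa> x (fst (g t)), vact \<kappa>' x (snd (g t)))"
      using fcar[OF \<psi>P[OF t]] x by (auto simp: g_def T.psi_lact lie_dsum_simps M1.lact M2.lact)
    moreover have "tact \<mu> \<nu> x t = \<theta> (lact T x (T.\<psi> t))" using x by (simp add: T.lact)
    ultimately show ?thesis using closed(1)[OF \<psi>P[OF t] x] by (auto simp: B_def)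
  qed
  have g_smult: "pscale k t \<in> B \<and> g (pscale k t) = (pscale k (fst (g t)), pscale k (snd (g t)))"
    if t: "t \<in> B" for t k
  proof -
    have "f (k \<odot>\<^bsub>T\<^esub> T.\<psi> t) = k \<odot>\<^bsub>lie_dsum M1 M2\<^esub> f (T.\<psi> t)"
      using f \<psi>P[OF t] unfolding lie_hom_def inf_char_part_simps by blast
    then have "g (pscale k t) = (pscale k (fst (g t)), pscale k (snd (g t)))"
      using fcar[OF \<psi>P[OF t]] by (auto simp: g_def T.psi_smult lie_dsum_simps M1.smult M2.smult)
    moreover have "pscale k t = \<theta> (k \<odot>\<^bsub>T\<^esub> T.\<psi> t)" by (simp add: T.smult)
    ultimately show ?thesis using closed(2)[OF \<psi>P[OF t], of k] by (auto simp: B_def)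
  qed
  have efh: "vact \<alpha> \<e> v = vE \<alpha> v" "vact \<alpha> \<h> v = vH \<alpha> v" "tact \<mu> \<nu> \<e> t = tE \<mu> \<nu> t" "tact \<mu> \<nu> \<h> t = tH \<mu> \<nu> t" for \<alpha> v t
    by (rule opact_efh[OF pm.vector_space_axioms])+
  note gE = g_act[OF _ triple_sl2(1), unfolded efh] and gH = g_act[OF _ triple_sl2(3), unfolded efh]
  have gw: "tH \<mu> \<nu> t = pscale \<omega> t"
    if "t \<in> B" "vH \<kappa> (fst (g t)) = pscale \<omega> (fst (g t))" "vH \<kappa>' (snd (g t)) = pscale \<omega> (snd (g t))" for t \<omega>
    by (rule g_inj) (use gH[OF that(1)] g_smult[OF that(1), of \<omega>] that in auto)
  have g0: "tE \<mu> \<nu> t = 0" if "t \<in> B" "vE \<kappa> (fst (g t)) = 0" "vE \<kappa>' (snd (g t)) = 0" for t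
  proof -
    have "tE \<mu> \<nu> t = pscale 0 t"
      by (rule g_inj) (use gE[OF that(1)] g_smult[OF that(1), of 0] that in auto)
    then show ?thesis by simp
  qed
  note z = v_clinear[THEN clinear_zero]
  obtain t3 where t3: "t3 \<in> B" "g t3 = (0, basis_vec 0)" using g_surj by blast
  have t30: "t3 \<noteq> 0" using t3 g_smult[OF t3(1), of 0] by (auto simp: single_zero_iff)
  have "tH \<mu> \<nu> t3 = pscale \<kappa>' t3" by (rule gw) (use t3 z in auto)
  moreover obtain i j where ij: "lk t3 (i, j) \<noteq> 0" using t30 by (metis lookup_zero poly_mapping_eqI surj_pair)
  ultimately have "(\<mu> + \<nu> - 2 * of_nat (i + j)) * lk t3 (i, j) = \<kappa>' * lk t3 (i, j)"
    using lookup_tH lookup_pscale by metis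
  then have "\<mu> + \<nu> - 2 * of_nat (i + j) = \<kappa>'" using ij by simp
  then have "2 * \<kappa> = 2 * (of_nat (i + j) - of_nat l - 1)" unfolding \<kappa> by (simp add: algebra_simps)
  then have \<kappa>2: "\<kappa> = of_nat (i + j) - of_nat l - 1" by (metis mult_cancel_left zero_neq_numeral)
  then have "real (i + j) - real l - 1 \<le> - 2" using re by simp
  then have il: "i + j < l" by linarith
  define k where "k = l - (i + j)"
  have k: "\<kappa> = - of_nat k - 1" "\<kappa>' = of_nat k - 1" using il by (simp_all add: \<kappa>2 \<kappa>(2) k_def of_nat_diff)
  obtain t1 where t1: "t1 \<in> B" "g t1 = (basis_vec 0, 0)" using g_surj by blast
  obtain t2 where t2: "t2 \<in> B" "g t2 = (0, basis_vec k)" using g_surj by blast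
  have "t1 \<in> sing \<mu> \<nu> l"
    unfolding sing_iff \<kappa>(1)[symmetric] using g0[OF t1(1)] gw[OF t1(1), of \<kappa>] z by (simp add: t1(2))
  moreover have "t2 \<in> sing \<mu> \<nu> l"
    unfolding sing_iff \<kappa>(1)[symmetric] using g0[OF t2(1)] gw[OF t2(1), of \<kappa>] z by (simp add: t2(2) k)
  moreover have "t1 \<noteq> 0" using t1 g_smult[OF t1(1), of 0] by (auto simp: single_zero_iff)
  moreover have "t2 \<noteq> pscale c t1" for c
    using t2(2) g_smult[OF t1(1), of c] t1(2) by (auto simp: single_zero_iff)
  ultimately show ?thesis by (rule independent_sing_exceptional)
qed

end

section \<open>The equivalence\<close>

theorem theorem1p2:
  fixes h b :: "cmat set" and lam1 lam2 lam3 :: complex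
  assumes "cartan_subalgebra h" and "borel_subalgebra b" and "h \<subseteq> b"
    and "\<exists>l::nat. lam3 - lam1 - lam2 = 2 * of_nat l"
  shows
    "let i = has_dimension (mult_space h b lam1 lam2 lam3) 2;
         ii = (\<exists>n1 n2 n3 :: int. lam1 = of_int n1 \<and> lam2 = of_int n2 \<and> lam3 = of_int n3 \<and>
                2 \<ge> n1 + n2 + n3 \<and> n3 \<ge> \<bar>n1 - n2\<bar> + 2);
         iii = rankin_cohen_vanishes lam1 lam2 lam3;
         iv = (lam3 \<in> \<real> \<and> 2 \<le> Re lam3 \<and>
                lie_iso sl2
                  (inf_char_part h b (lie_tensor (verma h b (- lam1)) (verma h b (- lam2))) (- lam3 + 1))
                  (lie_dsum (verma h b (- lam3)) (verma h b (lam3 - 2))))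
     in (i \<longleftrightarrow> ii) \<and> (ii \<longleftrightarrow> iii) \<and> (iii \<longleftrightarrow> iv)"
proof -
  obtain P Q where "frame P Q" and h: "h = range (frame.hh P Q)" and b: "b = range (case_prod (frame.bb P Q))"
    using cartan_borel_frame[OF assms(1-3)] by blast
  interpret frame P Q by fact
  obtain l :: nat where l: "lam3 - lam1 - lam2 = 2 * of_nat l" using assms(4) by blast
  let ?ex = "exceptional (- lam1) (- lam2) l"
  have \<kappa>: "- lam3 = - lam1 + - lam2 - 2 * of_nat l" using l by (simp add: algebra_simps)
  obtain \<phi>1 where "lie_model pscale sl2 (vact (- lam1)) (verma h b (- lam1)) \<phi>1" unfolding h b using verma_model by blast
  moreover obtain \<phi>2 where "lie_model pscale sl2 (vact (- lam2)) (verma h b (- lam2)) \<phi>2" unfolding h b using verma_model by blast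
  ultimately obtain \<theta> where T: "lie_model pscale sl2 (tact (- lam1) (- lam2)) (lie_tensor (verma h b (- lam1)) (verma h b (- lam2))) \<theta>"
    using tensor_model by blast
  obtain \<phi>3 where M: "lie_model pscale sl2 (vact (- lam3)) (verma h b (- lam3)) \<phi>3" unfolding h b using verma_model by blast
  obtain \<phi>4 where M': "lie_model pscale sl2 (vact (lam3 - 2)) (verma h b (lam3 - 2)) \<phi>4" unfolding h b using verma_model by blast
  have M0: "lie_model pscale sl2 (vact (- lam1 + - lam2 - 2 * of_nat l)) (verma h b (- lam3)) \<phi>3"
    using M by (simp only: \<kappa>[symmetric])
  have i: "has_dimension (mult_space h b lam1 lam2 lam3) 2 \<longleftrightarrow> ?ex"
    unfolding mult_space_def by (rule hom_space_dimension[OF M0 T])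
  have ii: "?ex \<longleftrightarrow> (\<exists>n1 n2 n3 :: int. lam1 = of_int n1 \<and> lam2 = of_int n2 \<and> lam3 = of_int n3 \<and>
                2 \<ge> n1 + n2 + n3 \<and> n3 \<ge> \<bar>n1 - n2\<bar> + 2)"
    by (rule exceptional_iff_integral[OF l])
  have iii: "rankin_cohen_vanishes lam1 lam2 lam3 \<longleftrightarrow> ?ex"
    by (rule rankin_cohen_vanishes_iff[OF l])
  have \<kappa>': "lam3 - 2 = - (- lam3) - 2" by simp
  have "lam3 \<in> \<real> \<and> 2 \<le> Re lam3" if "?ex"
  proof -
    obtain n1 n2 n3 :: int where n: "lam3 = of_int n3" "n3 \<ge> \<bar>n1 - n2\<bar> + 2" using \<open>?ex\<close> ii by blast
    then show ?thesis by simp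
  qed
  then have iv: "?ex \<longleftrightarrow> (lam3 \<in> \<real> \<and> 2 \<le> Re lam3 \<and>
                lie_iso sl2
                  (inf_char_part h b (lie_tensor (verma h b (- lam1)) (verma h b (- lam2))) (- lam3 + 1))
                  (lie_dsum (verma h b (- lam3)) (verma h b (lam3 - 2))))"
    using block_decomposition[OF T M M' \<kappa> \<kappa>'] decomposition_exceptional[OF T M M' \<kappa> \<kappa>']
    unfolding h b by auto
  show ?thesis unfolding Let_def using i ii iii iv by blast
qed

end
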